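(* Let $\mathcal C$ be a $C^*$-category closed for subobjects and $\Omega$ a connected compact Hausdorff space. Then for each object $e$ of the extension category $\mathcal C^\Omega$ there exist an object $\rho_0$ of $\mathcal C$, defined up to unitary equivalence, and an element $\delta(e)$ of the cohomology set $H^1(\Omega,\mathbf U_{\rho_0})$, namely the class of the cocycles $(\{\Omega_i\},\{v_iv_j^*\})$ coming from trivializations $(\rho_0,\{\Omega_i,v_i\}_i)$ of $e$. Two objects $e$ and $f$ of $\mathcal C^\Omega$ are unitarily equivalent if and only if $\delta(e)=\delta(f)$ (meaning that $e$ and $f$ admit a common $\rho_0$ and the two classes coincide in $H^1(\Omega,\mathbf U_{\rho_0})$).
   Context: A $C^*$-category has Banach spaces of arrows $(\rho,\sigma)$ from $\rho$ to $\sigma$, bilinear submultiplicative composition, an antilinear involution $*:(\rho,\sigma)\to(\sigma,\rho)$ with $\|s^*s\|=\|s\|^2$, and $s^*s$ positive in the unital $C^*$-algebra $(\rho,\rho)$. It is closed for subobjects if for each projection $p\in(\rho,\rho)$ there are an object $\sigma$ and $v\in(\sigma,\rho)$ with $v^*v=1_\sigma$, $vv^*=p$. Objects $\rho,\sigma$ are unitarily equivalent if there is $u\in(\rho,\sigma)$ with $u^*u=1_\rho$, $uu^*=1_\sigma$. $\mathbf U_{\rho_0}$ is the (norm-topology) group of unitary arrows in $(\rho_0,\rho_0)$. Extension category $\mathcal C^\Omega$: for objects $\rho,\sigma$ of $\mathcal C$ put $(\rho,\sigma)^\Omega:=C(\Omega)\otimes(\rho,\sigma)\simeq C(\Omega,(\rho,\sigma))$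 with sup norm, pointwise composition and involution. Objects of $\mathcal C^\Omega$ are projections $e\in(\rho,\rho)^\Omega$ for some object $\rho$ of $\mathcal C$; arrows are $(e,f):=\{x\in(\rho,\sigma)^\Omega: xe=fx=x\}$ for $e\in(\rho,\rho)^\Omega$, $f\in(\sigma,\sigma)^\Omega$; the identity arrow of $e$ is $e$. A trivialization of $e\in(\rho,\rho)^\Omega$ is a family $(\rho_0,\{\Omega_i,v_i\}_i)$ where $\rho_0$ is an object of $\mathcal C$, $\{\Omega_i\}$ is an open cover of $\Omega$ and $v_i\in(\rho,\rho_0)^{\overline{\Omega_i}}$ satisfy $e|_{\Omega_i}=v_i^*v_i$ and $v_iv_i^*=1_{\rho_0}$. For a topological group $G$, $H^1(\Omega,G)$ is the set of equivalence classes of $G$-cocycles $(\{\Omega_i\},\{\alpha_{ij}\})$: $\{\Omega_i\}$ an open cover, $\alpha_{ij}:\Omega_i\cap\Omega_j\to G$ continuous, $\alpha_{ij}\alpha_{jk}=\alpha_{ik}$ on triple intersections; two cocycles $(\{\Omega_i\},\{\alpha_{ij}\})$, $(\{\Omega'_l\},\{\alpha'_{lm}\})$ are equivalent if there are continuous $u_{il}:\Omega_i\cap\Omega'_l\to G$ with $\alpha_{ij}=u_{il}\alpha'_{lm}u_{jm}^{-1}$ on $\Omega_i\cap\Omega_j\cap\Omega'_l\cap\Omega'_m$. *)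

theory Defs
  imports "HOL-Analysis.Analysis" "HOL-Algebra.Group"
begin

section \<open>Complex Banach spaces on a carrier set\<close>

text \<open>
  \<open>Metric_space\<close> requires a distance that is nonnegative and symmetric on the whole type, hence
  the value 0 off the carrier.
\<close>

definition norm_dist ::
    "'a set \<Rightarrow> ('a \<Rightarrow> 'a \<Rightarrow> 'a) \<Rightarrow> (complex \<Rightarrow> 'a \<Rightarrow> 'a) \<Rightarrow> ('a \<Rightarrow> real) \<Rightarrow> 'a \<Rightarrow> 'a \<Rightarrow> real" where
  "norm_dist V add scl nrm x y =
     (if x \<in> V \<and> y \<in> V then nrm (add x (scl (-1) y)) else 0)"

locale complex_banach =
  fixes V :: "'a set"
    and add :: "'a \<Rightarrow> 'a \<Rightarrow> 'a"
    and zero :: 'a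
    and scl :: "complex \<Rightarrow> 'a \<Rightarrow> 'a"
    and nrm :: "'a \<Rightarrow> real"
  assumes add_closed: "x \<in> V \<Longrightarrow> y \<in> V \<Longrightarrow> add x y \<in> V"
    and zero_closed: "zero \<in> V"
    and scale_closed: "x \<in> V \<Longrightarrow> scl c x \<in> V"
    and add_assoc: "x \<in> V \<Longrightarrow> y \<in> V \<Longrightarrow> z \<in> V \<Longrightarrow> add (add x y) z = add x (add y z)"
    and add_commute: "x \<in> V \<Longrightarrow> y \<in> V \<Longrightarrow> add x y = add y x"
    and add_zero: "x \<in> V \<Longrightarrow> add x zero = x"
    and add_inverse: "x \<in> V \<Longrightarrow> add x (scl (-1) x) = zero"
    and scale_add_right: "x \<in> V \<Longrightarrow> y \<in> V \<Longrightarrow> scl c (add x y) = add (scl c x) (scl c y)"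
    and scale_add_left: "x \<in> V \<Longrightarrow> scl (c + d) x = add (scl c x) (scl d x)"
    and scale_scale: "x \<in> V \<Longrightarrow> scl c (scl d x) = scl (c * d) x"
    and scale_one: "x \<in> V \<Longrightarrow> scl 1 x = x"
    and norm_nonneg: "x \<in> V \<Longrightarrow> 0 \<le> nrm x"
    and norm_eq_zero: "x \<in> V \<Longrightarrow> nrm x = 0 \<longleftrightarrow> x = zero"
    and norm_scale: "x \<in> V \<Longrightarrow> nrm (scl c x) = cmod c * nrm x"
    and norm_triangle: "x \<in> V \<Longrightarrow> y \<in> V \<Longrightarrow> nrm (add x y) \<le> nrm x + nrm y"
    and complete: "Metric_space.mcomplete V (norm_dist V add scl nrm)"

section \<open>C*-categories\<close>

text \<open>
  \<open>Arr C \<rho> \<sigma>\<close> is the space $(\rho,\sigma)$ of arrows from \<open>\<rho>\<close> to \<open>\<sigma>\<close>, and \<open>Cmp C y x\<close> is the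
  composite \<open>y x\<close>, i.e. \<open>x\<close> followed by \<open>y\<close>.  Different arrow spaces may overlap as sets; all axioms
  are relative to chosen source and target objects.
\<close>

record ('o, 'a) cstar_cat =
  Obj :: "'o set"
  Arr :: "'o \<Rightarrow> 'o \<Rightarrow> 'a set"
  Add :: "'a \<Rightarrow> 'a \<Rightarrow> 'a"
  Zero :: "'o \<Rightarrow> 'o \<Rightarrow> 'a"
  Scale :: "complex \<Rightarrow> 'a \<Rightarrow> 'a"
  Nrm :: "'a \<Rightarrow> real"
  Cmp :: "'a \<Rightarrow> 'a \<Rightarrow> 'a"
  Star :: "'a \<Rightarrow> 'a"
  Ident :: "'o \<Rightarrow> 'a"

definition arr_spectrum :: "('o, 'a) cstar_cat \<Rightarrow> 'o \<Rightarrow> 'a \<Rightarrow> complex set" where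
  "arr_spectrum C \<rho> a =
     {\<mu>. \<not> (\<exists>b \<in> Arr C \<rho> \<rho>.
            Cmp C b (Add C a (Scale C (- \<mu>) (Ident C \<rho>))) = Ident C \<rho> \<and>
            Cmp C (Add C a (Scale C (- \<mu>) (Ident C \<rho>))) b = Ident C \<rho>)}"

definition arr_positive :: "('o, 'a) cstar_cat \<Rightarrow> 'o \<Rightarrow> 'a \<Rightarrow> bool" where
  "arr_positive C \<rho> a \<longleftrightarrow>
     a \<in> Arr C \<rho> \<rho> \<and> Star C a = a \<and> arr_spectrum C \<rho> a \<subseteq> complex_of_real ` {0..}"

locale cstar_category =
  fixes C :: "('o, 'a) cstar_cat"
  assumes banach: "\<rho> \<in> Obj C \<Longrightarrow> \<sigma> \<in> Obj C \<Longrightarrow>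
      complex_banach (Arr C \<rho> \<sigma>) (Add C) (Zero C \<rho> \<sigma>) (Scale C) (Nrm C)"
    and ident_closed: "\<rho> \<in> Obj C \<Longrightarrow> Ident C \<rho> \<in> Arr C \<rho> \<rho>"
    and cmp_closed: "\<lbrakk>\<rho> \<in> Obj C; \<sigma> \<in> Obj C; \<tau> \<in> Obj C; x \<in> Arr C \<rho> \<sigma>; y \<in> Arr C \<sigma> \<tau>\<rbrakk>
      \<Longrightarrow> Cmp C y x \<in> Arr C \<rho> \<tau>"
    and cmp_assoc: "\<lbrakk>\<rho> \<in> Obj C; \<sigma> \<in> Obj C; \<tau> \<in> Obj C; \<upsilon> \<in> Obj C;
        x \<in> Arr C \<rho> \<sigma>; y \<in> Arr C \<sigma> \<tau>; z \<in> Arr C \<tau> \<upsilon>\<rbrakk>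
      \<Longrightarrow> Cmp C (Cmp C z y) x = Cmp C z (Cmp C y x)"
    and cmp_ident_right: "\<lbrakk>\<rho> \<in> Obj C; \<sigma> \<in> Obj C; x \<in> Arr C \<rho> \<sigma>\<rbrakk> \<Longrightarrow> Cmp C x (Ident C \<rho>) = x"
    and cmp_ident_left: "\<lbrakk>\<rho> \<in> Obj C; \<sigma> \<in> Obj C; x \<in> Arr C \<rho> \<sigma>\<rbrakk> \<Longrightarrow> Cmp C (Ident C \<sigma>) x = x"
    and cmp_add_right: "\<lbrakk>\<rho> \<in> Obj C; \<sigma> \<in> Obj C; \<tau> \<in> Obj C;
        x \<in> Arr C \<rho> \<sigma>; x' \<in> Arr C \<rho> \<sigma>; y \<in> Arr C \<sigma> \<tau>\<rbrakk>
      \<Longrightarrow> Cmp C y (Add C x x') = Add C (Cmp C y x) (Cmp C y x')"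
    and cmp_add_left: "\<lbrakk>\<rho> \<in> Obj C; \<sigma> \<in> Obj C; \<tau> \<in> Obj C;
        x \<in> Arr C \<rho> \<sigma>; y \<in> Arr C \<sigma> \<tau>; y' \<in> Arr C \<sigma> \<tau>\<rbrakk>
      \<Longrightarrow> Cmp C (Add C y y') x = Add C (Cmp C y x) (Cmp C y' x)"
    and cmp_scale_right: "\<lbrakk>\<rho> \<in> Obj C; \<sigma> \<in> Obj C; \<tau> \<in> Obj C; x \<in> Arr C \<rho> \<sigma>; y \<in> Arr C \<sigma> \<tau>\<rbrakk>
      \<Longrightarrow> Cmp C y (Scale C c x) = Scale C c (Cmp C y x)"
    and cmp_scale_left: "\<lbrakk>\<rho> \<in> Obj C; \<sigma> \<in> Obj C; \<tau> \<in> Obj C; x \<in> Arr C \<rho> \<sigma>; y \<in> Arr C \<sigma> \<tau>\<rbrakk>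
      \<Longrightarrow> Cmp C (Scale C c y) x = Scale C c (Cmp C y x)"
    and norm_cmp: "\<lbrakk>\<rho> \<in> Obj C; \<sigma> \<in> Obj C; \<tau> \<in> Obj C; x \<in> Arr C \<rho> \<sigma>; y \<in> Arr C \<sigma> \<tau>\<rbrakk>
      \<Longrightarrow> Nrm C (Cmp C y x) \<le> Nrm C y * Nrm C x"
    and star_closed: "\<lbrakk>\<rho> \<in> Obj C; \<sigma> \<in> Obj C; x \<in> Arr C \<rho> \<sigma>\<rbrakk> \<Longrightarrow> Star C x \<in> Arr C \<sigma> \<rho>"
    and star_add: "\<lbrakk>\<rho> \<in> Obj C; \<sigma> \<in> Obj C; x \<in> Arr C \<rho> \<sigma>; y \<in> Arr C \<rho> \<sigma>\<rbrakk>
      \<Longrightarrow> Star C (Add C x y) = Add C (Star C x) (Star C y)"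
    and star_scale: "\<lbrakk>\<rho> \<in> Obj C; \<sigma> \<in> Obj C; x \<in> Arr C \<rho> \<sigma>\<rbrakk>
      \<Longrightarrow> Star C (Scale C c x) = Scale C (cnj c) (Star C x)"
    and star_star: "\<lbrakk>\<rho> \<in> Obj C; \<sigma> \<in> Obj C; x \<in> Arr C \<rho> \<sigma>\<rbrakk> \<Longrightarrow> Star C (Star C x) = x"
    and star_cmp: "\<lbrakk>\<rho> \<in> Obj C; \<sigma> \<in> Obj C; \<tau> \<in> Obj C; x \<in> Arr C \<rho> \<sigma>; y \<in> Arr C \<sigma> \<tau>\<rbrakk>
      \<Longrightarrow> Star C (Cmp C y x) = Cmp C (Star C x) (Star C y)"
    and cstar_identity: "\<lbrakk>\<rho> \<in> Obj C; \<sigma> \<in> Obj C; x \<in> Arr C \<rho> \<sigma>\<rbrakk>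
      \<Longrightarrow> Nrm C (Cmp C (Star C x) x) = (Nrm C x)\<^sup>2"
    and star_cmp_positive: "\<lbrakk>\<rho> \<in> Obj C; \<sigma> \<in> Obj C; x \<in> Arr C \<rho> \<sigma>\<rbrakk>
      \<Longrightarrow> arr_positive C \<rho> (Cmp C (Star C x) x)"

definition is_projection :: "('o, 'a) cstar_cat \<Rightarrow> 'o \<Rightarrow> 'a \<Rightarrow> bool" where
  "is_projection C \<rho> p \<longleftrightarrow> p \<in> Arr C \<rho> \<rho> \<and> Cmp C p p = p \<and> Star C p = p"

definition closed_for_subobjects :: "('o, 'a) cstar_cat \<Rightarrow> bool" where
  "closed_for_subobjects C \<longleftrightarrow>
     (\<forall>\<rho> \<in> Obj C. \<forall>p. is_projection C \<rho> p \<longrightarrow>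
        (\<exists>\<sigma> \<in> Obj C. \<exists>v \<in> Arr C \<sigma> \<rho>. Cmp C (Star C v) v = Ident C \<sigma> \<and> Cmp C v (Star C v) = p))"

definition unitarily_equivalent :: "('o, 'a) cstar_cat \<Rightarrow> 'o \<Rightarrow> 'o \<Rightarrow> bool" where
  "unitarily_equivalent C \<rho> \<sigma> \<longleftrightarrow>
     (\<exists>u \<in> Arr C \<rho> \<sigma>. Cmp C (Star C u) u = Ident C \<rho> \<and> Cmp C u (Star C u) = Ident C \<sigma>)"

definition arr_topology :: "('o, 'a) cstar_cat \<Rightarrow> 'o \<Rightarrow> 'o \<Rightarrow> 'a topology" where
  "arr_topology C \<rho> \<sigma> =
     Metric_space.mtopology (Arr C \<rho> \<sigma>) (norm_dist (Arr C \<rho> \<sigma>) (Add C) (Scale C) (Nrm C))"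

definition unitary_group :: "('o, 'a) cstar_cat \<Rightarrow> 'o \<Rightarrow> 'a monoid" where
  "unitary_group C \<rho> =
     \<lparr>carrier = {u \<in> Arr C \<rho> \<rho>. Cmp C (Star C u) u = Ident C \<rho> \<and> Cmp C u (Star C u) = Ident C \<rho>},
      mult = Cmp C, one = Ident C \<rho>\<rparr>"

definition unitary_topology :: "('o, 'a) cstar_cat \<Rightarrow> 'o \<Rightarrow> 'a topology" where
  "unitary_topology C \<rho> = subtopology (arr_topology C \<rho> \<rho>) (carrier (unitary_group C \<rho>))"

section \<open>The extension category\<close>

text \<open>
  \<open>function_category C X\<close> has the objects of \<open>C\<close> and the arrow spaces $C(X,(\rho,\sigma))$, i.e.
  $(\rho,\sigma)^X$.  Functions are \<open>extensional\<close> on \<open>topspace X\<close>, so that equality of arrows is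
  equality of functions on \<open>X\<close>.  The 0 inserted in the supremum is the norm for empty \<open>X\<close>
  (the closure of a member of an open cover can be empty).
\<close>

definition function_category ::
    "('o, 'a) cstar_cat \<Rightarrow> 'w topology \<Rightarrow> ('o, 'w \<Rightarrow> 'a) cstar_cat" where
  "function_category C X =
     \<lparr>Obj = Obj C,
      Arr = (\<lambda>\<rho> \<sigma>. {x \<in> extensional (topspace X). continuous_map X (arr_topology C \<rho> \<sigma>) x}),
      Add = (\<lambda>x y. \<lambda>w \<in> topspace X. Add C (x w) (y w)),
      Zero = (\<lambda>\<rho> \<sigma>. \<lambda>w \<in> topspace X. Zero C \<rho> \<sigma>),
      Scale = (\<lambda>c x. \<lambda>w \<in> topspace X. Scale C c (x w)),
      Nrm = (\<lambda>x. Sup (insert 0 ((\<lambda>w. Nrm C (x w)) ` topspace X))),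
      Cmp = (\<lambda>y x. \<lambda>w \<in> topspace X. Cmp C (y w) (x w)),
      Star = (\<lambda>x. \<lambda>w \<in> topspace X. Star C (x w)),
      Ident = (\<lambda>\<rho>. \<lambda>w \<in> topspace X. Ident C \<rho>)\<rparr>"

text \<open>
  The category whose objects are the projections of \<open>D\<close>.  A projection $e \in (\rho,\rho)$ is
  stored as the pair \<open>(\<rho>, e)\<close>, since \<open>e\<close> alone need not determine \<open>\<rho>\<close>.
\<close>

definition projection_category :: "('o, 'a) cstar_cat \<Rightarrow> ('o \<times> 'a, 'a) cstar_cat" where
  "projection_category D =
     \<lparr>Obj = {(\<rho>, e). \<rho> \<in> Obj D \<and> is_projection D \<rho> e},
      Arr = (\<lambda>(\<rho>, e) (\<sigma>, f). {x \<in> Arr D \<rho> \<sigma>. Cmp D x e = x \<and> Cmp D f x = x}),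
      Add = Add D,
      Zero = (\<lambda>(\<rho>, e) (\<sigma>, f). Zero D \<rho> \<sigma>),
      Scale = Scale D,
      Nrm = Nrm D,
      Cmp = Cmp D,
      Star = Star D,
      Ident = (\<lambda>(\<rho>, e). e)\<rparr>"

definition extension_category ::
    "('o, 'a) cstar_cat \<Rightarrow> 'w topology \<Rightarrow> ('o \<times> ('w \<Rightarrow> 'a), 'w \<Rightarrow> 'a) cstar_cat" where
  "extension_category C \<Omega> = projection_category (function_category C \<Omega>)"

section \<open>Nonabelian first cohomology\<close>

text \<open>
  Open covers and cocycles are families indexed by a set \<open>I\<close> of elements of an index type \<open>'i\<close>,
  which stays a parameter: HOL cannot quantify over types inside a formula.  Values of \<open>\<alpha> i j\<close>
  off the overlap of \<open>U i\<close> and \<open>U j\<close>, and values of \<open>U\<close> and \<open>\<alpha>\<close> at indices outside \<open>I\<close>,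
  are irrelevant; data that differ only there are identified by \<open>cocycle_rel\<close>.
\<close>

type_synonym ('i, 'w, 'g) cocycle = "'i set \<times> ('i \<Rightarrow> 'w set) \<times> ('i \<Rightarrow> 'i \<Rightarrow> 'w \<Rightarrow> 'g)"

definition open_cover :: "'w topology \<Rightarrow> 'i set \<Rightarrow> ('i \<Rightarrow> 'w set) \<Rightarrow> bool" where
  "open_cover \<Omega> I U \<longleftrightarrow> (\<forall>i \<in> I. openin \<Omega> (U i)) \<and> (\<Union>i \<in> I. U i) = topspace \<Omega>"

definition cocycles :: "'w topology \<Rightarrow> 'g monoid \<Rightarrow> 'g topology \<Rightarrow> ('i, 'w, 'g) cocycle set" where
  "cocycles \<Omega> G T =
     {(I, U, \<alpha>). open_cover \<Omega> I U \<and>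
        (\<forall>i \<in> I. \<forall>j \<in> I. continuous_map (subtopology \<Omega> (U i \<inter> U j)) T (\<alpha> i j)) \<and>
        (\<forall>i \<in> I. \<forall>j \<in> I. \<forall>k \<in> I. \<forall>w \<in> U i \<inter> U j \<inter> U k.
           \<alpha> i j w \<otimes>\<^bsub>G\<^esub> \<alpha> j k w = \<alpha> i k w)}"

definition cocycle_rel ::
    "'w topology \<Rightarrow> 'g monoid \<Rightarrow> 'g topology \<Rightarrow> ('i, 'w, 'g) cocycle rel" where
  "cocycle_rel \<Omega> G T =
     {((I, U, \<alpha>), (I', U', \<alpha>')).
        (I, U, \<alpha>) \<in> cocycles \<Omega> G T \<and> (I', U', \<alpha>') \<in> cocycles \<Omega> G T \<and>
        (\<exists>u. (\<forall>i \<in> I. \<forall>l \<in> I'. continuous_map (subtopology \<Omega> (U i \<inter> U' l)) T (u i l)) \<and>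
             (\<forall>i \<in> I. \<forall>j \<in> I. \<forall>l \<in> I'. \<forall>m \<in> I'. \<forall>w \<in> U i \<inter> U j \<inter> U' l \<inter> U' m.
                \<alpha> i j w = u i l w \<otimes>\<^bsub>G\<^esub> \<alpha>' l m w \<otimes>\<^bsub>G\<^esub> inv\<^bsub>G\<^esub> (u j m w)))}"

definition H1 :: "'w topology \<Rightarrow> 'g monoid \<Rightarrow> 'g topology \<Rightarrow> ('i, 'w, 'g) cocycle set set" where
  "H1 \<Omega> G T = cocycles \<Omega> G T // cocycle_rel \<Omega> G T"

definition cocycle_class ::
    "'w topology \<Rightarrow> 'g monoid \<Rightarrow> 'g topology \<Rightarrow> ('i, 'w, 'g) cocycle \<Rightarrow> ('i, 'w, 'g) cocycle set" where
  "cocycle_class \<Omega> G T a = cocycle_rel \<Omega> G T `` {a}"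

section \<open>Trivializations and the class of an object\<close>

type_synonym ('i, 'w, 'a) local_arrows = "'i set \<times> ('i \<Rightarrow> 'w set) \<times> ('i \<Rightarrow> 'w \<Rightarrow> 'a)"

definition trivializations ::
    "('o, 'a) cstar_cat \<Rightarrow> 'w topology \<Rightarrow> 'o \<times> ('w \<Rightarrow> 'a) \<Rightarrow> 'o \<Rightarrow> ('i, 'w, 'a) local_arrows set" where
  "trivializations C \<Omega> = (\<lambda>(\<rho>, e) \<rho>\<^sub>0.
     {(I, U, v). \<rho>\<^sub>0 \<in> Obj C \<and> open_cover \<Omega> I U \<and>
        (\<forall>i \<in> I.
           let D = function_category C (subtopology \<Omega> (\<Omega> closure_of (U i)))
           in v i \<in> Arr D \<rho> \<rho>\<^sub>0 \<and>
              (\<forall>w \<in> U i. e w = Cmp C (Star C (v i w)) (v i w)) \<and>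
              Cmp D (v i) (Star D (v i)) = Ident D \<rho>\<^sub>0)})"

definition transition_cocycle ::
    "('o, 'a) cstar_cat \<Rightarrow> ('i, 'w, 'a) local_arrows \<Rightarrow> ('i, 'w, 'a) cocycle" where
  "transition_cocycle C = (\<lambda>(I, U, v). (I, U, \<lambda>i j w. Cmp C (v i w) (Star C (v j w))))"

text \<open>
  \<open>\<delta>(e)\<close>, computed with the model object \<open>\<rho>\<^sub>0\<close>: the unique class arising from trivializations of
  \<open>e\<close> over \<open>\<rho>\<^sub>0\<close> (meaningful once existence and uniqueness of that class are known).
\<close>

definition delta ::
    "('o, 'a) cstar_cat \<Rightarrow> 'w topology \<Rightarrow> 'o \<Rightarrow> 'o \<times> ('w \<Rightarrow> 'a) \<Rightarrow> ('i, 'w, 'a) cocycle set" where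
  "delta C \<Omega> \<rho>\<^sub>0 e = (THE c. \<exists>t \<in> trivializations C \<Omega> e \<rho>\<^sub>0.
     c = cocycle_class \<Omega> (unitary_group C \<rho>\<^sub>0) (unitary_topology C \<rho>\<^sub>0) (transition_cocycle C t))"

end

theory Submission
  imports Defs
begin

text \<open>
  An object \<open>e\<close> of the extension category is a norm-continuous field of projections over \<open>\<Omega>\<close>, and the
  theorem is the bundle dictionary for such fields: they are locally trivial, hence classified by
  cocycles with values in the unitary group of a model fibre.

  The bookkeeping becomes transparent in the groupoid whose objects are pairs \<open>(\<rho>, p)\<close> with \<open>p\<close> a
  projection of \<open>\<rho>\<close>, and whose isomorphisms from \<open>(\<rho>, p)\<close> to \<open>(\<sigma>, q)\<close> are the partial isometries
  \<open>v \<in> (\<rho>,\<sigma>)\<close> with \<open>v\<^sup>\<star> v = p\<close> and \<open>v v\<^sup>\<star> = q\<close> (predicate \<open>piso\<close>; the inverse of \<open>v\<close> is \<open>v\<^sup>\<star>\<close>).  A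
  unitary arrow from \<open>e\<close> to \<open>f\<close> is a continuous field of such isomorphisms (\<open>extension_unitary_iff\<close>),
  and a trivialization consists of local fields of isomorphisms \<open>v i\<close> from \<open>e\<close> to the constant
  object \<open>(\<rho>\<^sub>0, 1)\<close> (\<open>trivializations_iff\<close>).  Everything algebraic is then groupoid arithmetic:
  \<open>v i w (v j w)\<^sup>\<star>\<close> is a cocycle of automorphisms of \<open>(\<rho>\<^sub>0, 1)\<close>; two trivializations \<open>v\<close>, \<open>v'\<close> of the same
  \<open>e\<close> have cocycles related by \<open>v i w (v' l w)\<^sup>\<star>\<close> (\<open>transition_cocycles_related\<close>); a unitary from \<open>e\<close> to
  \<open>f\<close> carries a trivialization of \<open>e\<close> to one of \<open>f\<close> with the same cocycle (\<open>delta_unitary_invariant\<close>);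
  and if \<open>u\<close> relates the cocycles of \<open>v\<close> and \<open>v'\<close>, then the local unitaries
  \<open>(v' l w)\<^sup>\<star> (u i l w)\<^sup>\<star> v i w\<close> from \<open>e\<close> to \<open>f\<close> agree on overlaps and glue
  (\<open>unitarily_equivalent_if_cocycles_related\<close>).

  The analytic content is local triviality.  If \<open>v\<close> is an isomorphism from \<open>(\<rho>, p)\<close> to \<open>(\<sigma>, 1)\<close> and
  \<open>\<parallel>p - e\<parallel> \<le> 1/2\<close>, then \<open>k = (v e) (v e)\<^sup>\<star>\<close> is within \<open>1/2\<close> of \<open>1\<close>, and the polar part
  \<open>k\<^bsup>-1/2\<^esup> v e\<close> is an isomorphism from \<open>(\<rho>, e)\<close> to \<open>(\<sigma>, 1)\<close> (\<open>local_lift\<close>).  It depends continuously on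
  \<open>e\<close> because \<open>k\<^bsup>-1/2\<^esup>\<close> does.  The inverse square root comes from two uses of the contraction
  principle: \<open>1 - c\<close> squares to \<open>1 - h\<close> when \<open>c = (h + c c)/2\<close>, and \<open>s\<close> inverts \<open>1 - c\<close> when
  \<open>s = 1 + c s\<close>; comparing the fixed point equations for two values of \<open>h\<close> gives the Lipschitz estimate
  \<open>inv_sqrt_lipschitz\<close>.

  Closure under subobjects turns the fibre of \<open>e\<close> at one point into an object \<open>\<rho>\<^sub>0\<close>; connectedness spreads
  the isomorphism to every fibre (\<open>fibres_isomorphic\<close>), so that one \<open>\<rho>\<^sub>0\<close> serves all of \<open>\<Omega>\<close>; compactness
  leaves finitely many charts, which any infinite type can index (\<open>trivialization_exists\<close>).
\<close>

section \<open>Complex Banach spaces on a carrier set\<close>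

context complex_banach
begin

abbreviation dif :: "'a \<Rightarrow> 'a \<Rightarrow> 'a" (infixl "\<ominus>" 65) where
  "x \<ominus> y \<equiv> add x (scl (-1) y)"

lemmas closed [simp] = add_closed zero_closed scale_closed

lemma add_left_commute:
  "x \<in> V \<Longrightarrow> y \<in> V \<Longrightarrow> z \<in> V \<Longrightarrow> add x (add y z) = add y (add x z)"
  by (metis add_assoc add_commute)

lemmas add_ac = add_assoc add_commute add_left_commute

lemma zero_add: "x \<in> V \<Longrightarrow> add zero x = x"
  by (metis add_zero add_commute zero_closed)

lemma add_right_cancel: "x \<in> V \<Longrightarrow> y \<in> V \<Longrightarrow> z \<in> V \<Longrightarrow> add x z = add y z \<longleftrightarrow> x = y"
  by (metis add_assoc add_inverse add_zero scale_closed)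

lemma dif_add_cancel: "x \<in> V \<Longrightarrow> y \<in> V \<Longrightarrow> add (x \<ominus> y) y = x"
  by (metis add_assoc add_commute add_inverse add_zero scale_closed)

lemma dif_eq_zero_iff: "x \<in> V \<Longrightarrow> y \<in> V \<Longrightarrow> x \<ominus> y = zero \<longleftrightarrow> x = y"
  by (metis add_right_cancel add_inverse scale_closed)

lemma dif_telescope: "x \<in> V \<Longrightarrow> y \<in> V \<Longrightarrow> z \<in> V \<Longrightarrow> add (x \<ominus> y) (y \<ominus> z) = x \<ominus> z"
  by (metis add_assoc closed(1,3) dif_add_cancel)

lemma dif_swap: "x \<in> V \<Longrightarrow> y \<in> V \<Longrightarrow> scl (-1) (x \<ominus> y) = y \<ominus> x"
  by (simp add: scale_add_right scale_scale scale_one add_commute)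

lemma norm_dif_commute: "x \<in> V \<Longrightarrow> y \<in> V \<Longrightarrow> nrm (x \<ominus> y) = nrm (y \<ominus> x)"
  by (subst dif_swap[symmetric]) (simp_all only: norm_scale closed, simp)

lemma norm_zero: "nrm zero = 0"
  by (simp add: norm_eq_zero)

sublocale metric: Metric_space V "norm_dist V add scl nrm"
proof
  fix x y z
  show "0 \<le> norm_dist V add scl nrm x y"
    by (simp add: norm_dist_def norm_nonneg)
  show "norm_dist V add scl nrm x y = norm_dist V add scl nrm y x"
    by (auto simp: norm_dist_def norm_dif_commute)
  assume xy: "x \<in> V" "y \<in> V"
  show "norm_dist V add scl nrm x y = 0 \<longleftrightarrow> x = y"
    using xy by (simp add: norm_dist_def norm_eq_zero dif_eq_zero_iff)
  assume z: "z \<in> V"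
  have "nrm (x \<ominus> z) \<le> nrm (x \<ominus> y) + nrm (y \<ominus> z)"
    using xy z norm_triangle[of "x \<ominus> y" "y \<ominus> z"] by (simp add: dif_telescope)
  then show "norm_dist V add scl nrm x z \<le> norm_dist V add scl nrm x y + norm_dist V add scl nrm y z"
    using xy z by (simp add: norm_dist_def)
qed

text \<open>
  Continuity becomes convergence of real numbers along \<open>nhdsin X w\<close>, so that estimates for products and
  Lipschitz maps can be fed to the limit calculus of \<open>real\<close>.
\<close>

lemma continuous_map_iff_tendsto:
  "continuous_map X metric.mtopology f \<longleftrightarrow>
     (\<forall>w \<in> topspace X. f w \<in> V \<and> ((\<lambda>y. nrm (f y \<ominus> f w)) \<longlongrightarrow> 0) (nhdsin X w))"
proof (cases "f \<in> topspace X \<rightarrow> V")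
  case False
  then show ?thesis
    by (auto simp: continuous_map_def)
next
  case fV: True
  have "(\<forall>\<epsilon>>0. \<exists>U. openin X U \<and> w \<in> U \<and> (\<forall>y\<in>U. f y \<in> metric.mball (f w) \<epsilon>)) \<longleftrightarrow>
      ((\<lambda>y. nrm (f y \<ominus> f w)) \<longlongrightarrow> 0) (nhdsin X w)" if w: "w \<in> topspace X" for w
  proof -
    have "f y \<in> metric.mball (f w) \<epsilon> \<longleftrightarrow> \<bar>nrm (f y \<ominus> f w)\<bar> < \<epsilon>" if "openin X U" "y \<in> U" for U y \<epsilon>
    proof -
      have "f y \<in> V" "f w \<in> V"
        using that w fV openin_subset by fast+
      then show ?thesis
        by (auto simp: norm_dist_def norm_nonneg norm_dif_commute)
    qed
    then have "(\<exists>U. openin X U \<and> w \<in> U \<and> (\<forall>y\<in>U. f y \<in> metric.mball (f w) \<epsilon>)) \<longleftrightarrow>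
        (\<exists>U. openin X U \<and> w \<in> U \<and> (\<forall>y\<in>U. \<bar>nrm (f y \<ominus> f w)\<bar> < \<epsilon>))" for \<epsilon>
      by meson
    with w show ?thesis
      by (simp add: tendsto_iff eventually_nhdsin dist_real_def)
  qed
  with fV show ?thesis
    by (auto simp: metric.continuous_map_to_metric)
qed

text \<open>
  The closed ball is itself a complete metric space, so a contraction of the ball into itself has a
  fixed point there.
\<close>

lemma fixed_point_in_ball:
  assumes r: "0 \<le> r" and k: "k < 1"
    and F: "\<And>x. x \<in> V \<Longrightarrow> nrm x \<le> r \<Longrightarrow> F x \<in> V \<and> nrm (F x) \<le> r"
    and con: "\<And>x y. \<lbrakk>x \<in> V; y \<in> V; nrm x \<le> r; nrm y \<le> r\<rbrakk> \<Longrightarrow> nrm (F x \<ominus> F y) \<le> k * nrm (x \<ominus> y)"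
  obtains x where "x \<in> V" "nrm x \<le> r" "F x = x"
proof -
  define B where "B = metric.mcball zero r"
  have B: "x \<in> B \<longleftrightarrow> x \<in> V \<and> nrm x \<le> r" for x
  proof -
    have "nrm (zero \<ominus> x) = nrm x" if "x \<in> V"
      using that by (simp add: zero_add norm_scale)
    then show ?thesis
      by (auto simp: B_def norm_dist_def)
  qed
  interpret S: Submetric V "norm_dist V add scl nrm" B
    by unfold_locales (auto simp: B)
  have "S.sub.mcomplete"
    using S.closedin_mcomplete_imp_mcomplete complete metric.closedin_mcball
    unfolding B_def by blast
  moreover have "zero \<in> B"
    using r by (simp add: B norm_zero)
  moreover have "F \<in> B \<rightarrow> B"
    using F by (auto simp: B)
  moreover have "norm_dist V add scl nrm (F x) (F y) \<le> k * norm_dist V add scl nrm x y"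
    if "x \<in> B" "y \<in> B" for x y
    using that F con by (auto simp: B norm_dist_def)
  ultimately obtain x where "x \<in> B" "F x = x"
    using S.sub.Banach_fixedpoint_thm[OF _ _ _ k] by blast
  with B show thesis
    using that by blast
qed

end

section \<open>Arithmetic of arrows\<close>

context cstar_category
begin

abbreviation comp_arr (infixr "\<cdot>" 70) where "y \<cdot> x \<equiv> Cmp C y x"
abbreviation adj ("_\<^sup>\<star>" [1000] 1000) where "x\<^sup>\<star> \<equiv> Star C x"
abbreviation plus_arr (infixl "\<oplus>" 65) where "x \<oplus> y \<equiv> Add C x y"
abbreviation diff_arr (infixl "\<ominus>" 65) where "x \<ominus> y \<equiv> Add C x (Scale C (-1) y)"
abbreviation ident ("\<iota>") where "\<iota> \<sigma> \<equiv> Ident C \<sigma>"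

text \<open>
  Arrow spaces may overlap, so an element does not determine its source and target; \<open>arr \<rho> \<sigma> x\<close> keeps the
  typing together with the membership of both objects, in the form in which the axioms consume it.
\<close>

definition arr :: "'o \<Rightarrow> 'o \<Rightarrow> 'a \<Rightarrow> bool" where
  "arr \<rho> \<sigma> x \<longleftrightarrow> \<rho> \<in> Obj C \<and> \<sigma> \<in> Obj C \<and> x \<in> Arr C \<rho> \<sigma>"

lemma arr_cmp [intro]: "arr \<rho> \<sigma> x \<Longrightarrow> arr \<sigma> \<tau> y \<Longrightarrow> arr \<rho> \<tau> (y \<cdot> x)"
  by (auto simp: arr_def intro: cmp_closed)

lemma arr_star [intro]: "arr \<rho> \<sigma> x \<Longrightarrow> arr \<sigma> \<rho> (x\<^sup>\<star>)"
  by (auto simp: arr_def intro: star_closed)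

lemma arr_ident [intro]: "\<sigma> \<in> Obj C \<Longrightarrow> arr \<sigma> \<sigma> (\<iota> \<sigma>)"
  by (auto simp: arr_def intro: ident_closed)

lemma arr_banach:
  "arr \<rho> \<sigma> x \<Longrightarrow> complex_banach (Arr C \<rho> \<sigma>) (Add C) (Zero C \<rho> \<sigma>) (Scale C) (Nrm C)"
  by (auto simp: arr_def intro: banach)

lemma arr_add [intro]: "arr \<rho> \<sigma> x \<Longrightarrow> arr \<rho> \<sigma> y \<Longrightarrow> arr \<rho> \<sigma> (x \<oplus> y)"
  using arr_banach complex_banach.add_closed unfolding arr_def by fastforce

lemma arr_scale [intro]: "arr \<rho> \<sigma> x \<Longrightarrow> arr \<rho> \<sigma> (Scale C c x)"
  using arr_banach complex_banach.scale_closed unfolding arr_def by fastforce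

lemma assoc: "arr \<rho> \<sigma> x \<Longrightarrow> arr \<sigma> \<tau> y \<Longrightarrow> arr \<tau> \<upsilon> z \<Longrightarrow> (z \<cdot> y) \<cdot> x = z \<cdot> y \<cdot> x"
  by (auto simp: arr_def intro: cmp_assoc)

lemma ident_right: "arr \<rho> \<sigma> x \<Longrightarrow> x \<cdot> \<iota> \<rho> = x"
  by (auto simp: arr_def intro: cmp_ident_right)

lemma ident_left: "arr \<rho> \<sigma> x \<Longrightarrow> \<iota> \<sigma> \<cdot> x = x"
  by (auto simp: arr_def intro: cmp_ident_left)

lemma adj_cmp: "arr \<rho> \<sigma> x \<Longrightarrow> arr \<sigma> \<tau> y \<Longrightarrow> (y \<cdot> x)\<^sup>\<star> = x\<^sup>\<star> \<cdot> y\<^sup>\<star>"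
  by (auto simp: arr_def intro: star_cmp)

lemma adj_adj: "arr \<rho> \<sigma> x \<Longrightarrow> x\<^sup>\<star>\<^sup>\<star> = x"
  by (auto simp: arr_def intro: star_star)

text \<open>
  Taking adjoints in \<open>1\<^sup>\<star> = 1 1\<^sup>\<star>\<close> gives \<open>1 = 1 1\<^sup>\<star> = 1\<^sup>\<star>\<close>.
\<close>

lemma adj_ident:
  assumes \<sigma>: "\<sigma> \<in> Obj C"
  shows "(\<iota> \<sigma>)\<^sup>\<star> = \<iota> \<sigma>"
proof -
  note one = arr_ident[OF \<sigma>]
  show ?thesis
    using adj_cmp[OF arr_star[OF one] one] ident_left[OF arr_star[OF one]] adj_adj[OF one] by simp
qed

lemma distrib_left:
  "arr \<rho> \<sigma> x \<Longrightarrow> arr \<rho> \<sigma> x' \<Longrightarrow> arr \<sigma> \<tau> y \<Longrightarrow> y \<cdot> (x \<oplus> x') = y \<cdot> x \<oplus> y \<cdot> x'"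
  by (auto simp: arr_def intro: cmp_add_right)

lemma distrib_right:
  "arr \<rho> \<sigma> x \<Longrightarrow> arr \<sigma> \<tau> y \<Longrightarrow> arr \<sigma> \<tau> y' \<Longrightarrow> (y \<oplus> y') \<cdot> x = y \<cdot> x \<oplus> y' \<cdot> x"
  by (auto simp: arr_def intro: cmp_add_left)

lemma cmp_diff:
  "arr \<rho> \<sigma> x \<Longrightarrow> arr \<rho> \<sigma> x' \<Longrightarrow> arr \<sigma> \<tau> y \<Longrightarrow> y \<cdot> (x \<ominus> x') = y \<cdot> x \<ominus> y \<cdot> x'"
  using arr_scale by (auto simp: distrib_left) (auto simp: arr_def cmp_scale_right)

lemma diff_cmp:
  "arr \<rho> \<sigma> x \<Longrightarrow> arr \<sigma> \<tau> y \<Longrightarrow> arr \<sigma> \<tau> y' \<Longrightarrow> (y \<ominus> y') \<cdot> x = y \<cdot> x \<ominus> y' \<cdot> x"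
  using arr_scale by (auto simp: distrib_right) (auto simp: arr_def cmp_scale_left)

lemma adj_add: "arr \<rho> \<sigma> x \<Longrightarrow> arr \<rho> \<sigma> y \<Longrightarrow> (x \<oplus> y)\<^sup>\<star> = x\<^sup>\<star> \<oplus> y\<^sup>\<star>"
  by (auto simp: arr_def intro: star_add)

lemma adj_scale: "arr \<rho> \<sigma> x \<Longrightarrow> (Scale C c x)\<^sup>\<star> = Scale C (cnj c) (x\<^sup>\<star>)"
  by (auto simp: arr_def intro: star_scale)

lemma adj_diff: "arr \<rho> \<sigma> x \<Longrightarrow> arr \<rho> \<sigma> y \<Longrightarrow> (x \<ominus> y)\<^sup>\<star> = x\<^sup>\<star> \<ominus> y\<^sup>\<star>"
  by (simp add: adj_add[OF _ arr_scale] adj_scale)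

lemma diff_cancel_iff: "arr \<rho> \<sigma> x \<Longrightarrow> arr \<rho> \<sigma> y \<Longrightarrow> Nrm C (x \<ominus> y) = 0 \<longleftrightarrow> x = y"
  using complex_banach.norm_eq_zero[OF arr_banach] complex_banach.dif_eq_zero_iff[OF arr_banach]
    arr_add arr_scale unfolding arr_def by metis

lemma norm_diff_commute: "arr \<rho> \<sigma> x \<Longrightarrow> arr \<rho> \<sigma> y \<Longrightarrow> Nrm C (x \<ominus> y) = Nrm C (y \<ominus> x)"
  using complex_banach.norm_dif_commute[OF arr_banach] unfolding arr_def by metis

lemma norm_add_le: "arr \<rho> \<sigma> x \<Longrightarrow> arr \<rho> \<sigma> y \<Longrightarrow> Nrm C (x \<oplus> y) \<le> Nrm C x + Nrm C y"
  using complex_banach.norm_triangle[OF arr_banach] unfolding arr_def by metis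

lemma norm_nonneg: "arr \<rho> \<sigma> x \<Longrightarrow> 0 \<le> Nrm C x"
  using complex_banach.norm_nonneg[OF arr_banach] unfolding arr_def by metis

lemma norm_cmp_le: "arr \<rho> \<sigma> x \<Longrightarrow> arr \<sigma> \<tau> y \<Longrightarrow> Nrm C (y \<cdot> x) \<le> Nrm C y * Nrm C x"
  by (auto simp: arr_def intro: norm_cmp)

lemma norm_sq: "arr \<rho> \<sigma> x \<Longrightarrow> Nrm C (x\<^sup>\<star> \<cdot> x) = (Nrm C x)\<^sup>2"
  by (auto simp: arr_def intro: cstar_identity)

text \<open>
  The C*-identity gives \<open>\<parallel>y\<parallel>\<^sup>2 = \<parallel>y\<^sup>\<star> y\<parallel> \<le> \<parallel>y\<^sup>\<star>\<parallel> \<parallel>y\<parallel>\<close>, hence \<open>\<parallel>y\<parallel> \<le> \<parallel>y\<^sup>\<star>\<parallel>\<close> for every \<open>y\<close>, in particular for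
  \<open>y = x\<close> and \<open>y = x\<^sup>\<star>\<close>.
\<close>

lemma norm_adj:
  assumes "arr \<rho> \<sigma> x"
  shows "Nrm C (x\<^sup>\<star>) = Nrm C x"
proof -
  have le: "Nrm C y \<le> Nrm C (y\<^sup>\<star>)" if y: "arr \<tau> \<upsilon> y" for \<tau> \<upsilon> y
  proof -
    have "Nrm C y * Nrm C y \<le> Nrm C (y\<^sup>\<star>) * Nrm C y"
      using norm_sq[OF y] norm_cmp_le[OF y arr_star[OF y]] by (simp add: power2_eq_square)
    moreover have "0 \<le> Nrm C y" "0 \<le> Nrm C (y\<^sup>\<star>)"
      using y by (auto intro: norm_nonneg)
    ultimately show ?thesis
      by (cases "Nrm C y = 0") (auto simp: mult_le_cancel_right)
  qed
  show ?thesis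
    using le[OF assms] le[OF arr_star[OF assms]] adj_adj[OF assms] by simp
qed

lemma norm_projection_le_1:
  assumes "arr \<rho> \<rho> e" "e\<^sup>\<star> \<cdot> e = e"
  shows "Nrm C e \<le> 1"
  using norm_sq[OF assms(1)] assms(2) norm_nonneg[OF assms(1)]
  by (cases "Nrm C e = 0") (auto simp: power2_eq_square)

lemma norm_ident_le_1: "\<sigma> \<in> Obj C \<Longrightarrow> Nrm C (\<iota> \<sigma>) \<le> 1"
  using norm_projection_le_1[OF arr_ident] by (simp add: adj_ident ident_left[OF arr_ident])

lemma norm_coisometry_le_1:
  assumes "arr \<rho> \<sigma> v" "v \<cdot> v\<^sup>\<star> = \<iota> \<sigma>"
  shows "Nrm C v \<le> 1" "Nrm C (v\<^sup>\<star>) \<le> 1"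
proof -
  have "(Nrm C (v\<^sup>\<star>))\<^sup>2 \<le> 1"
    using norm_sq[OF arr_star[OF assms(1)]] assms norm_ident_le_1[of \<sigma>]
    by (simp add: adj_adj[OF assms(1)] arr_def)
  then show "Nrm C (v\<^sup>\<star>) \<le> 1"
    using abs_square_le_1[of "Nrm C (v\<^sup>\<star>)"] by simp
  then show "Nrm C v \<le> 1"
    by (simp add: norm_adj[OF assms(1)])
qed

text \<open>
  From \<open>y x - y' x' = (y - y') x + y' (x - x')\<close>.  The continuity of composition and of the inverse square root
  both rest on it.
\<close>

lemma norm_cmp_diff_le:
  assumes x: "arr \<rho> \<sigma> x" "arr \<rho> \<sigma> x'" and y: "arr \<sigma> \<tau> y" "arr \<sigma> \<tau> y'"
  shows "Nrm C (y \<cdot> x \<ominus> y' \<cdot> x') \<le> Nrm C (y \<ominus> y') * Nrm C x + Nrm C y' * Nrm C (x \<ominus> x')"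
proof -
  have a: "arr \<rho> \<tau> (y \<cdot> x)" "arr \<rho> \<tau> (y' \<cdot> x)" "arr \<rho> \<tau> (y' \<cdot> x')"
    using x y by blast+
  have "y \<cdot> x \<ominus> y' \<cdot> x' = (y \<cdot> x \<ominus> y' \<cdot> x) \<oplus> (y' \<cdot> x \<ominus> y' \<cdot> x')"
    using complex_banach.dif_telescope[OF arr_banach[OF a(1)]] a by (simp add: arr_def)
  also have "\<dots> = (y \<ominus> y') \<cdot> x \<oplus> y' \<cdot> (x \<ominus> x')"
    using x y by (simp add: cmp_diff diff_cmp)
  finally have "Nrm C (y \<cdot> x \<ominus> y' \<cdot> x') \<le> Nrm C ((y \<ominus> y') \<cdot> x) + Nrm C (y' \<cdot> (x \<ominus> x'))"
    using x y norm_add_le[of \<rho> \<tau> "(y \<ominus> y') \<cdot> x" "y' \<cdot> (x \<ominus> x')"]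
    by (metis arr_add arr_scale arr_cmp)
  also have "\<dots> \<le> Nrm C (y \<ominus> y') * Nrm C x + Nrm C y' * Nrm C (x \<ominus> x')"
    using x y by (intro add_mono norm_cmp_le) blast+
  finally show ?thesis .
qed

end

section \<open>Inverse square roots near the identity\<close>

context cstar_category
begin

text \<open>
  The fixed point equation says that \<open>(1 - c)\<^sup>2 = 1 - h\<close>.  The bound \<open>1/2\<close> selects the solution near \<open>0\<close> and makes
  it unique, since the right-hand side contracts on that ball.
\<close>

definition is_sqrt_defect :: "'o \<Rightarrow> 'a \<Rightarrow> 'a \<Rightarrow> bool" where
  "is_sqrt_defect \<sigma> h c \<longleftrightarrow> arr \<sigma> \<sigma> c \<and> Nrm C c \<le> 1/2 \<and> c = Scale C (1/2) (h \<oplus> c \<cdot> c)"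

text \<open>
  On the ball of radius \<open>1/2\<close> the quadratic term contributes at most \<open>1/2 * (\<parallel>c\<parallel> + \<parallel>c'\<parallel>) * \<parallel>c - c'\<parallel>\<close>.  With
  \<open>h = h'\<close> the estimate gives existence of the fixed point, with \<open>h \<noteq> h'\<close> its dependence on \<open>h\<close>.
\<close>

lemma sqrt_step_diff_le:
  assumes h: "arr \<sigma> \<sigma> h" "arr \<sigma> \<sigma> h'" and c: "arr \<sigma> \<sigma> c" "arr \<sigma> \<sigma> c'"
    and le: "Nrm C c \<le> 1/2" "Nrm C c' \<le> 1/2"
  shows "Nrm C (Scale C (1/2) (h \<oplus> c \<cdot> c) \<ominus> Scale C (1/2) (h' \<oplus> c' \<cdot> c'))
           \<le> 1/2 * Nrm C (h \<ominus> h') + 1/2 * Nrm C (c \<ominus> c')"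
proof -
  interpret A: complex_banach "Arr C \<sigma> \<sigma>" "Add C" "Zero C \<sigma> \<sigma>" "Scale C" "Nrm C"
    using arr_banach[OF c(1)] .
  have cc: "arr \<sigma> \<sigma> (c \<cdot> c)" "arr \<sigma> \<sigma> (c' \<cdot> c')"
    using c by blast+
  have d: "arr \<sigma> \<sigma> (h \<ominus> h')" "arr \<sigma> \<sigma> (c \<cdot> c \<ominus> c' \<cdot> c')" "arr \<sigma> \<sigma> (c \<ominus> c')"
    using h c by blast+
  have V: "h \<in> Arr C \<sigma> \<sigma>" "h' \<in> Arr C \<sigma> \<sigma>" "c \<cdot> c \<in> Arr C \<sigma> \<sigma>" "c' \<cdot> c' \<in> Arr C \<sigma> \<sigma>"
    using h cc by (auto simp: arr_def)
  have "Scale C (1/2) (h \<oplus> c \<cdot> c) \<ominus> Scale C (1/2) (h' \<oplus> c' \<cdot> c')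
      = Scale C (1/2) ((h \<ominus> h') \<oplus> (c \<cdot> c \<ominus> c' \<cdot> c'))"
    using V by (simp add: A.scale_add_right A.scale_scale A.add_ac)
  then have "Nrm C (Scale C (1/2) (h \<oplus> c \<cdot> c) \<ominus> Scale C (1/2) (h' \<oplus> c' \<cdot> c'))
      = 1/2 * Nrm C ((h \<ominus> h') \<oplus> (c \<cdot> c \<ominus> c' \<cdot> c'))"
    using V by (simp add: A.norm_scale norm_divide)
  also have "\<dots> \<le> 1/2 * (Nrm C (h \<ominus> h') + Nrm C (c \<cdot> c \<ominus> c' \<cdot> c'))"
    using norm_add_le[OF d(1,2)] by simp
  also have "Nrm C (c \<cdot> c \<ominus> c' \<cdot> c') \<le> Nrm C (c \<ominus> c') * (1/2) + (1/2) * Nrm C (c \<ominus> c')"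
    using norm_cmp_diff_le[OF c c] mult_left_mono[OF le(1) norm_nonneg[OF d(3)]]
      mult_right_mono[OF le(2) norm_nonneg[OF d(3)]] by linarith
  finally show ?thesis
    by simp
qed

text \<open>
  The term \<open>1/2 * \<parallel>c - c'\<parallel>\<close> of the previous estimate is absorbed by the left-hand side.  For \<open>h = h'\<close> this is
  uniqueness of the solution.
\<close>

lemma sqrt_defect_lipschitz:
  assumes "arr \<sigma> \<sigma> h" "arr \<sigma> \<sigma> h'" "is_sqrt_defect \<sigma> h c" "is_sqrt_defect \<sigma> h' c'"
  shows "Nrm C (c \<ominus> c') \<le> Nrm C (h \<ominus> h')"
proof -
  have "Nrm C (c \<ominus> c') \<le> 1/2 * Nrm C (h \<ominus> h') + 1/2 * Nrm C (c \<ominus> c')"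
    using sqrt_step_diff_le[OF assms(1,2), of c c'] assms(3,4) unfolding is_sqrt_defect_def by metis
  then show ?thesis
    by simp
qed

lemma sqrt_defect_exists:
  assumes h: "arr \<sigma> \<sigma> h" "Nrm C h \<le> 1/2"
  obtains c where "is_sqrt_defect \<sigma> h c"
proof -
  interpret A: complex_banach "Arr C \<sigma> \<sigma>" "Add C" "Zero C \<sigma> \<sigma>" "Scale C" "Nrm C"
    using arr_banach[OF h(1)] .
  have \<sigma>: "\<sigma> \<in> Obj C" and hV: "h \<in> Arr C \<sigma> \<sigma>"
    using h by (auto simp: arr_def)
  have arrI: "arr \<sigma> \<sigma> x" if "x \<in> Arr C \<sigma> \<sigma>" for x
    using that \<sigma> by (simp add: arr_def)
  obtain c where "c \<in> Arr C \<sigma> \<sigma>" "Nrm C c \<le> 1/2" "Scale C (1/2) (h \<oplus> c \<cdot> c) = c"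
  proof (rule A.fixed_point_in_ball[where r = "1/2" and k = "1/2" and F = "\<lambda>c. Scale C (1/2) (h \<oplus> c \<cdot> c)"])
    fix x assume x: "x \<in> Arr C \<sigma> \<sigma>" "Nrm C x \<le> 1/2"
    have xx: "arr \<sigma> \<sigma> (x \<cdot> x)"
      using x arrI by blast
    have "Nrm C (x \<cdot> x) \<le> 1/2 * (1/2)"
      using norm_cmp_le[OF arrI arrI, OF x(1) x(1)] mult_mono[OF x(2) x(2)] norm_nonneg[OF arrI[OF x(1)]]
      by simp
    then have "Nrm C (h \<oplus> x \<cdot> x) \<le> 1"
      using norm_add_le[OF h(1) xx] h(2) by simp
    then show "Scale C (1/2) (h \<oplus> x \<cdot> x) \<in> Arr C \<sigma> \<sigma> \<and> Nrm C (Scale C (1/2) (h \<oplus> x \<cdot> x)) \<le> 1/2"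
      using xx hV by (auto simp: arr_def A.norm_scale norm_divide)
  next
    fix x y assume "x \<in> Arr C \<sigma> \<sigma>" "y \<in> Arr C \<sigma> \<sigma>" "Nrm C x \<le> 1/2" "Nrm C y \<le> 1/2"
    then show "Nrm C (Scale C (1/2) (h \<oplus> x \<cdot> x) \<ominus> Scale C (1/2) (h \<oplus> y \<cdot> y)) \<le> 1/2 * Nrm C (x \<ominus> y)"
      using sqrt_step_diff_le[OF h(1) h(1) arrI arrI] diff_cancel_iff[OF h(1) h(1)] by fastforce
  qed auto
  then show thesis
    using that \<sigma> by (metis arr_def is_sqrt_defect_def)
qed

text \<open>
  \<open>c\<^sup>\<star>\<close> solves the same equation, and the solution is unique.
\<close>

lemma sqrt_defect_self_adjoint:
  assumes h: "arr \<sigma> \<sigma> h" "h\<^sup>\<star> = h" and c: "is_sqrt_defect \<sigma> h c"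
  shows "c\<^sup>\<star> = c"
proof -
  have ac: "arr \<sigma> \<sigma> c" and eq: "c = Scale C (1/2) (h \<oplus> c \<cdot> c)" and le: "Nrm C c \<le> 1/2"
    using c unfolding is_sqrt_defect_def by blast+
  have cc: "arr \<sigma> \<sigma> (c \<cdot> c)"
    using ac by blast
  have "c\<^sup>\<star> = (Scale C (1/2) (h \<oplus> c \<cdot> c))\<^sup>\<star>"
    using eq by simp
  also have "\<dots> = Scale C (cnj (1/2)) (h\<^sup>\<star> \<oplus> (c \<cdot> c)\<^sup>\<star>)"
    by (simp only: adj_scale[OF arr_add[OF h(1) cc]] adj_add[OF h(1) cc])
  also have "\<dots> = Scale C (1/2) (h \<oplus> c\<^sup>\<star> \<cdot> c\<^sup>\<star>)"
    using h(2) adj_cmp[OF ac ac] by simp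
  finally have "is_sqrt_defect \<sigma> h (c\<^sup>\<star>)"
    using ac le norm_adj[OF ac] by (auto simp: is_sqrt_defect_def)
  from sqrt_defect_lipschitz[OF h(1) h(1) this c] have "Nrm C (c\<^sup>\<star> \<ominus> c) \<le> 0"
    using diff_cancel_iff[OF h(1) h(1)] by simp
  then show ?thesis
    using norm_nonneg diff_cancel_iff[OF arr_star[OF ac] ac] ac
    by (metis arr_add arr_scale arr_star nle_le)
qed

lemma sqrt_defect_square:
  assumes h: "arr \<sigma> \<sigma> h" and c: "is_sqrt_defect \<sigma> h c"
  shows "(\<iota> \<sigma> \<ominus> c) \<cdot> (\<iota> \<sigma> \<ominus> c) = \<iota> \<sigma> \<ominus> h"
proof -
  interpret A: complex_banach "Arr C \<sigma> \<sigma>" "Add C" "Zero C \<sigma> \<sigma>" "Scale C" "Nrm C"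
    using arr_banach[OF h(1)] .
  have ac: "arr \<sigma> \<sigma> c" and eq: "c = Scale C (1/2) (h \<oplus> c \<cdot> c)"
    using c unfolding is_sqrt_defect_def by blast+
  have one: "arr \<sigma> \<sigma> (\<iota> \<sigma>)"
    using h by (auto simp: arr_def intro: ident_closed)
  have b: "arr \<sigma> \<sigma> (\<iota> \<sigma> \<ominus> c)"
    using one ac by blast
  have V: "c \<in> Arr C \<sigma> \<sigma>" "c \<cdot> c \<in> Arr C \<sigma> \<sigma>" "h \<in> Arr C \<sigma> \<sigma>" "\<iota> \<sigma> \<in> Arr C \<sigma> \<sigma>"
    using ac one h arr_cmp[OF ac ac] by (auto simp: arr_def)
  have "Scale C 2 c = Scale C 2 (Scale C (1/2) (h \<oplus> c \<cdot> c))"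
    using eq by simp
  then have two: "Scale C 2 c = h \<oplus> c \<cdot> c"
    using V by (simp add: A.scale_scale A.scale_one)
  have "(\<iota> \<sigma> \<ominus> c) \<cdot> (\<iota> \<sigma> \<ominus> c) = (\<iota> \<sigma> \<ominus> c) \<ominus> (c \<ominus> c \<cdot> c)"
    using cmp_diff[OF one ac b] diff_cmp[OF ac one ac] ident_right[OF b] ident_left[OF ac] by simp
  also have "\<dots> = \<iota> \<sigma> \<oplus> ((Scale C (-1) c \<oplus> Scale C (-1) c) \<oplus> c \<cdot> c)"
    using V by (simp add: A.scale_add_right A.scale_scale A.scale_one A.add_ac)
  also have "Scale C (-1) c \<oplus> Scale C (-1) c = Scale C (-1) (Scale C 2 c)"
    using V by (simp add: A.scale_scale flip: A.scale_add_left)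
  also have "\<dots> \<oplus> c \<cdot> c = Scale C (-1) h \<oplus> (Scale C (-1) (c \<cdot> c) \<oplus> c \<cdot> c)"
    using V by (simp add: two A.scale_add_right A.add_assoc)
  also have "\<dots> = Scale C (-1) h"
    using V A.add_commute[of "Scale C (-1) (c \<cdot> c)" "c \<cdot> c"] by (simp add: A.add_inverse A.add_zero)
  finally show ?thesis .
qed

text \<open>
  The last equation says \<open>(1 - c) s = 1\<close>, so that \<open>s\<close> is an inverse of the square root \<open>1 - c\<close> of \<open>1 - h\<close>.
  The bound on \<open>s\<close> makes the Lipschitz constant below independent of \<open>h\<close>.
\<close>

definition is_inv_sqrt :: "'o \<Rightarrow> 'a \<Rightarrow> 'a \<Rightarrow> bool" where
  "is_inv_sqrt \<sigma> h s \<longleftrightarrow> arr \<sigma> \<sigma> s \<and> Nrm C s \<le> 2 \<and>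
     (\<exists>c. is_sqrt_defect \<sigma> h c \<and> s = \<iota> \<sigma> \<oplus> c \<cdot> s)"

text \<open>
  As \<open>\<parallel>c\<parallel> \<le> 1/2\<close>, the map \<open>s \<mapsto> 1 + c s\<close> contracts and preserves the ball of radius \<open>2\<close>.
\<close>

lemma inv_sqrt_exists:
  assumes h: "arr \<sigma> \<sigma> h" "Nrm C h \<le> 1/2"
  obtains s where "is_inv_sqrt \<sigma> h s"
proof -
  interpret A: complex_banach "Arr C \<sigma> \<sigma>" "Add C" "Zero C \<sigma> \<sigma>" "Scale C" "Nrm C"
    using arr_banach[OF h(1)] .
  have \<sigma>: "\<sigma> \<in> Obj C"
    using h by (auto simp: arr_def)
  have arrI: "arr \<sigma> \<sigma> x" if "x \<in> Arr C \<sigma> \<sigma>" for x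
    using that \<sigma> by (simp add: arr_def)
  obtain c where c: "is_sqrt_defect \<sigma> h c"
    using sqrt_defect_exists[OF h] .
  then have ac: "arr \<sigma> \<sigma> c" and le: "Nrm C c \<le> 1/2"
    by (auto simp: is_sqrt_defect_def)
  obtain s where "s \<in> Arr C \<sigma> \<sigma>" "Nrm C s \<le> 2" "\<iota> \<sigma> \<oplus> c \<cdot> s = s"
  proof (rule A.fixed_point_in_ball[where r = 2 and k = "1/2" and F = "\<lambda>s. \<iota> \<sigma> \<oplus> c \<cdot> s"])
    fix x assume x: "x \<in> Arr C \<sigma> \<sigma>" "Nrm C x \<le> 2"
    have cx: "arr \<sigma> \<sigma> (c \<cdot> x)"
      using x arrI ac by blast
    have "Nrm C (c \<cdot> x) \<le> 1/2 * 2"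
      using norm_cmp_le[OF arrI ac, OF x(1)] mult_mono[OF le x(2)] norm_nonneg[OF arrI[OF x(1)]]
      by simp
    then show "\<iota> \<sigma> \<oplus> c \<cdot> x \<in> Arr C \<sigma> \<sigma> \<and> Nrm C (\<iota> \<sigma> \<oplus> c \<cdot> x) \<le> 2"
      using norm_add_le[OF arr_ident cx] norm_ident_le_1 \<sigma> arr_add[OF arr_ident cx]
      by (fastforce simp: arr_def)
  next
    fix x y assume V: "x \<in> Arr C \<sigma> \<sigma>" "y \<in> Arr C \<sigma> \<sigma>"
    have d: "arr \<sigma> \<sigma> (x \<ominus> y)"
      using V arrI by blast
    have "(\<iota> \<sigma> \<oplus> c \<cdot> x) \<ominus> (\<iota> \<sigma> \<oplus> c \<cdot> y) = (\<iota> \<sigma> \<oplus> c \<cdot> x) \<ominus> (c \<cdot> y \<oplus> \<iota> \<sigma>)"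
      using V \<sigma> ac A.add_commute by (metis arr_def cmp_closed ident_closed)
    also have "\<dots> = (c \<cdot> x \<ominus> c \<cdot> y) \<oplus> (\<iota> \<sigma> \<ominus> \<iota> \<sigma>)"
      using arr_cmp[OF arrI[OF V(1)] ac] arr_cmp[OF arrI[OF V(2)] ac] ident_closed[OF \<sigma>]
      by (simp add: A.scale_add_right A.add_ac arr_def)
    also have "\<dots> = c \<cdot> (x \<ominus> y)"
      using arr_cmp[OF d ac] ident_closed[OF \<sigma>] cmp_diff[OF arrI[OF V(1)] arrI[OF V(2)] ac]
      by (simp add: A.add_inverse A.add_zero arr_def)
    finally show "Nrm C ((\<iota> \<sigma> \<oplus> c \<cdot> x) \<ominus> (\<iota> \<sigma> \<oplus> c \<cdot> y)) \<le> 1/2 * Nrm C (x \<ominus> y)"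
      using norm_cmp_le[OF d ac] mult_right_mono[OF le norm_nonneg[OF d]] by simp
  qed auto
  then show thesis
    using that \<sigma> c by (metis arr_def is_inv_sqrt_def)
qed

text \<open>
  Subtracting the two fixed point equations gives \<open>s - s' = (c - c') s + c' (s - s')\<close>, and the last term is at
  most half of the left-hand side.
\<close>

lemma inv_sqrt_lipschitz:
  assumes h: "arr \<sigma> \<sigma> h" "arr \<sigma> \<sigma> h'" and s: "is_inv_sqrt \<sigma> h s" "is_inv_sqrt \<sigma> h' s'"
  shows "Nrm C (s \<ominus> s') \<le> 4 * Nrm C (h \<ominus> h')"
proof -
  interpret A: complex_banach "Arr C \<sigma> \<sigma>" "Add C" "Zero C \<sigma> \<sigma>" "Scale C" "Nrm C"
    using arr_banach[OF h(1)] .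
  obtain c c' where c: "is_sqrt_defect \<sigma> h c" "is_sqrt_defect \<sigma> h' c'"
    and eq: "s = \<iota> \<sigma> \<oplus> c \<cdot> s" "s' = \<iota> \<sigma> \<oplus> c' \<cdot> s'"
    using s unfolding is_inv_sqrt_def by blast
  have ac: "arr \<sigma> \<sigma> c" "arr \<sigma> \<sigma> c'" and le: "Nrm C c' \<le> 1/2"
    using c unfolding is_sqrt_defect_def by blast+
  have as: "arr \<sigma> \<sigma> s" "arr \<sigma> \<sigma> s'" and s2: "Nrm C s \<le> 2"
    using s unfolding is_inv_sqrt_def by blast+
  have cs: "c \<cdot> s \<in> Arr C \<sigma> \<sigma>" "c' \<cdot> s' \<in> Arr C \<sigma> \<sigma>" and one: "\<iota> \<sigma> \<in> Arr C \<sigma> \<sigma>"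
    using arr_cmp[OF as(1) ac(1)] arr_cmp[OF as(2) ac(2)] ident_closed by (auto simp: arr_def)
  have d: "arr \<sigma> \<sigma> (s \<ominus> s')" "arr \<sigma> \<sigma> (c \<ominus> c')"
    using as ac by blast+
  have "s \<ominus> s' = (\<iota> \<sigma> \<oplus> c \<cdot> s) \<ominus> (c' \<cdot> s' \<oplus> \<iota> \<sigma>)"
    using eq A.add_commute[OF one cs(2)] by simp
  also have "\<dots> = (c \<cdot> s \<ominus> c' \<cdot> s') \<oplus> (\<iota> \<sigma> \<ominus> \<iota> \<sigma>)"
    using cs one by (simp add: A.scale_add_right A.add_ac)
  also have "\<dots> = c \<cdot> s \<ominus> c' \<cdot> s'"
    using cs one by (simp add: A.add_inverse A.add_zero)
  finally have "Nrm C (s \<ominus> s') \<le> Nrm C (c \<ominus> c') * Nrm C s + Nrm C c' * Nrm C (s \<ominus> s')"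
    using norm_cmp_diff_le[OF as ac] by simp
  also have "\<dots> \<le> Nrm C (h \<ominus> h') * 2 + 1/2 * Nrm C (s \<ominus> s')"
    using sqrt_defect_lipschitz[OF h c] s2 le norm_nonneg[OF d(1)] norm_nonneg[OF d(2)]
      norm_nonneg[OF as(1)] by (intro add_mono mult_mono) auto
  finally show ?thesis
    by simp
qed

text \<open>
  \<open>s\<close> is a right inverse of the self-adjoint \<open>1 - c\<close>, so \<open>s\<^sup>\<star>\<close> is a left inverse; the two coincide.
\<close>

lemma inv_sqrt_self_adjoint:
  assumes h: "arr \<sigma> \<sigma> h" "h\<^sup>\<star> = h" and s: "is_inv_sqrt \<sigma> h s"
  shows "s\<^sup>\<star> = s" and "s \<cdot> (\<iota> \<sigma> \<ominus> h) \<cdot> s = \<iota> \<sigma>"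
proof -
  interpret A: complex_banach "Arr C \<sigma> \<sigma>" "Add C" "Zero C \<sigma> \<sigma>" "Scale C" "Nrm C"
    using arr_banach[OF h(1)] .
  have \<sigma>: "\<sigma> \<in> Obj C"
    using h by (auto simp: arr_def)
  obtain c where c: "is_sqrt_defect \<sigma> h c" and eq: "s = \<iota> \<sigma> \<oplus> c \<cdot> s"
    using s unfolding is_inv_sqrt_def by blast
  have ac: "arr \<sigma> \<sigma> c" and as: "arr \<sigma> \<sigma> s"
    using c s unfolding is_sqrt_defect_def is_inv_sqrt_def by blast+
  note one = arr_ident[OF \<sigma>]
  define b where "b = \<iota> \<sigma> \<ominus> c"
  have ab: "arr \<sigma> \<sigma> b"
    using one ac unfolding b_def by blast
  have b_adj: "b\<^sup>\<star> = b"
    using adj_diff[OF one ac] adj_ident[OF \<sigma>] sqrt_defect_self_adjoint[OF h c] by (simp add: b_def)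
  have "b \<cdot> s = s \<ominus> c \<cdot> s"
    using diff_cmp[OF as one ac] ident_left[OF as] by (simp add: b_def)
  also have "\<dots> = (\<iota> \<sigma> \<oplus> c \<cdot> s) \<ominus> c \<cdot> s"
    using eq by simp
  also have "\<dots> = \<iota> \<sigma>"
    using one arr_cmp[OF as ac] by (simp add: A.add_assoc A.add_inverse A.add_zero arr_def)
  finally have bs: "b \<cdot> s = \<iota> \<sigma>" .
  then have sb: "s\<^sup>\<star> \<cdot> b = \<iota> \<sigma>"
    using adj_cmp[OF as ab] b_adj adj_ident[OF \<sigma>] by simp
  show s_adj: "s\<^sup>\<star> = s"
    using assoc[OF as ab arr_star[OF as]] bs sb ident_left[OF as] ident_right[OF arr_star[OF as]] by simp
  have "s \<cdot> (\<iota> \<sigma> \<ominus> h) \<cdot> s = s \<cdot> (b \<cdot> b) \<cdot> s"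
    using sqrt_defect_square[OF h(1) c] by (simp add: b_def)
  also have "\<dots> = s \<cdot> b \<cdot> b \<cdot> s"
    using assoc[OF as ab ab] by simp
  also have "\<dots> = \<iota> \<sigma>"
    using bs sb s_adj ident_right[OF ab] by simp
  finally show "s \<cdot> (\<iota> \<sigma> \<ominus> h) \<cdot> s = \<iota> \<sigma>" .
qed

end

section \<open>The groupoid of projections\<close>

context cstar_category
begin

text \<open>
  Isomorphisms of projections: \<open>a\<close> and \<open>b\<close> are pairs of an object and a projection of it, and \<open>v\<close> is a
  partial isometry with initial projection \<open>snd a\<close> and final projection \<open>snd b\<close>.  The last clause makes
  \<open>v\<close> an arrow of the category of projections, where \<open>snd a\<close> and \<open>snd b\<close> are the identities.
\<close>

definition piso :: "'o \<times> 'a \<Rightarrow> 'o \<times> 'a \<Rightarrow> 'a \<Rightarrow> bool" where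
  "piso a b v \<longleftrightarrow> arr (fst a) (fst b) v \<and> v\<^sup>\<star> \<cdot> v = snd a \<and> v \<cdot> v\<^sup>\<star> = snd b \<and> v \<cdot> snd a = v"

abbreviation full :: "'o \<Rightarrow> 'o \<times> 'a" where
  "full \<sigma> \<equiv> (\<sigma>, \<iota> \<sigma>)"

lemma piso_arr: "piso a b v \<Longrightarrow> arr (fst a) (fst b) v"
  by (simp add: piso_def)

lemma piso_source: "piso a b v \<Longrightarrow> v\<^sup>\<star> \<cdot> v = snd a"
  by (simp add: piso_def)

lemma piso_target: "piso a b v \<Longrightarrow> v \<cdot> v\<^sup>\<star> = snd b"
  by (simp add: piso_def)

lemma piso_ident_right: "piso a b v \<Longrightarrow> v \<cdot> snd a = v"
  by (simp add: piso_def)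

lemma piso_assoc:
  "piso a b x \<Longrightarrow> piso b c y \<Longrightarrow> piso c d z \<Longrightarrow> (z \<cdot> y) \<cdot> x = z \<cdot> y \<cdot> x"
  using assoc[OF piso_arr piso_arr piso_arr] .

lemma piso_ident_left:
  assumes v: "piso a b v"
  shows "snd b \<cdot> v = v"
  using assoc[OF piso_arr[OF v] arr_star[OF piso_arr[OF v]] piso_arr[OF v]]
  by (simp add: piso_source[OF v] piso_target[OF v] piso_ident_right[OF v])

lemma piso_adj_adj: "piso a b v \<Longrightarrow> v\<^sup>\<star>\<^sup>\<star> = v"
  using adj_adj[OF piso_arr] .

lemma piso_adj_cmp: "piso a b x \<Longrightarrow> piso b c y \<Longrightarrow> (y \<cdot> x)\<^sup>\<star> = x\<^sup>\<star> \<cdot> y\<^sup>\<star>"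
  using adj_cmp[OF piso_arr piso_arr] .

lemma piso_adj:
  assumes v: "piso a b v"
  shows "piso b a (v\<^sup>\<star>)"
proof -
  note av = piso_arr[OF v]
  have "v\<^sup>\<star> \<cdot> snd b = (v\<^sup>\<star> \<cdot> v) \<cdot> v\<^sup>\<star>"
    using assoc[OF arr_star[OF av] av arr_star[OF av]] piso_target[OF v] by simp
  also have "\<dots> = (v \<cdot> (v\<^sup>\<star> \<cdot> v))\<^sup>\<star>"
    using adj_cmp[OF arr_cmp[OF av arr_star[OF av]] av] adj_cmp[OF av arr_star[OF av]] adj_adj[OF av] by simp
  also have "\<dots> = v\<^sup>\<star>"
    using piso_source[OF v] piso_ident_right[OF v] by simp
  finally show ?thesis
    using v arr_star[OF av] adj_adj[OF av] by (simp add: piso_def)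
qed

lemma piso_isometry:
  "arr \<rho> \<sigma> v \<Longrightarrow> v\<^sup>\<star> \<cdot> v = \<iota> \<rho> \<Longrightarrow> piso (full \<rho>) (\<sigma>, v \<cdot> v\<^sup>\<star>) v"
  by (simp add: piso_def ident_right)

lemma piso_coisometry:
  assumes v: "arr \<rho> \<sigma> v" "v \<cdot> v\<^sup>\<star> = \<iota> \<sigma>"
  shows "piso (\<rho>, v\<^sup>\<star> \<cdot> v) (full \<sigma>) v"
  using piso_adj[OF piso_isometry[OF arr_star[OF v(1)]]] v by (simp add: adj_adj[OF v(1)])

lemma piso_cancel: "piso a b v \<Longrightarrow> piso z a x \<Longrightarrow> v\<^sup>\<star> \<cdot> v \<cdot> x = x"
  using piso_assoc[of z a x b v a "v\<^sup>\<star>"] piso_adj[of a b v] by (simp add: piso_source piso_ident_left)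

lemma piso_cancel': "piso a b v \<Longrightarrow> piso z b x \<Longrightarrow> v \<cdot> v\<^sup>\<star> \<cdot> x = x"
  using piso_cancel[of b a "v\<^sup>\<star>" z x] piso_adj[of a b v] by (simp add: piso_adj_adj)

lemma piso_cmp:
  assumes v: "piso a b v" and w: "piso b c w"
  shows "piso a c (w \<cdot> v)"
  unfolding piso_def
proof (intro conjI)
  note vs = piso_adj[OF v] and ws = piso_adj[OF w]
  have awv: "arr (fst a) (fst c) (w \<cdot> v)"
    by (rule arr_cmp[OF piso_arr[OF v] piso_arr[OF w]])
  then show "arr (fst a) (fst c) (w \<cdot> v)" .
  note av = piso_arr[OF v] and aw = piso_arr[OF w]
  have "(w \<cdot> v)\<^sup>\<star> \<cdot> w \<cdot> v = v\<^sup>\<star> \<cdot> w\<^sup>\<star> \<cdot> w \<cdot> v"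
    using assoc[OF awv arr_star[OF aw] arr_star[OF av]] piso_adj_cmp[OF v w] by simp
  then show "(w \<cdot> v)\<^sup>\<star> \<cdot> w \<cdot> v = snd a"
    using piso_cancel[OF w v] piso_source[OF v] by simp
  have "(w \<cdot> v) \<cdot> (w \<cdot> v)\<^sup>\<star> = w \<cdot> v \<cdot> v\<^sup>\<star> \<cdot> w\<^sup>\<star>"
    using assoc[OF arr_cmp[OF arr_star[OF aw] arr_star[OF av]] av aw] piso_adj_cmp[OF v w] by simp
  then show "(w \<cdot> v) \<cdot> (w \<cdot> v)\<^sup>\<star> = snd c"
    using piso_cancel'[OF v ws] piso_target[OF w] by simp
  have "arr (fst a) (fst a) (snd a)"
    using arr_cmp[OF av arr_star[OF av]] piso_source[OF v] by simp
  then show "(w \<cdot> v) \<cdot> snd a = w \<cdot> v"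
    using assoc[OF _ av aw] piso_ident_right[OF v] by simp
qed

lemma mem_unitary_group_iff:
  "\<sigma> \<in> Obj C \<Longrightarrow> u \<in> carrier (unitary_group C \<sigma>) \<longleftrightarrow> piso (full \<sigma>) (full \<sigma>) u"
  by (auto simp: unitary_group_def piso_def arr_def cmp_ident_right)

end

section \<open>Norm-continuous fields of arrows\<close>

context cstar_category
begin

lemma continuous_arr_iff:
  assumes "\<rho> \<in> Obj C" "\<sigma> \<in> Obj C"
  shows "continuous_map X (arr_topology C \<rho> \<sigma>) f \<longleftrightarrow>
     (\<forall>w \<in> topspace X. arr \<rho> \<sigma> (f w) \<and> ((\<lambda>y. Nrm C (f y \<ominus> f w)) \<longlongrightarrow> 0) (nhdsin X w))"
  using complex_banach.continuous_map_iff_tendsto[OF banach[OF assms]] assms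
  by (simp add: arr_topology_def arr_def)

lemma Hausdorff_arr_topology:
  "\<rho> \<in> Obj C \<Longrightarrow> \<sigma> \<in> Obj C \<Longrightarrow> Hausdorff_space (arr_topology C \<rho> \<sigma>)"
proof -
  assume "\<rho> \<in> Obj C" "\<sigma> \<in> Obj C"
  then interpret A: complex_banach "Arr C \<rho> \<sigma>" "Add C" "Zero C \<rho> \<sigma>" "Scale C" "Nrm C"
    by (rule banach)
  show ?thesis
    unfolding arr_topology_def by (rule A.metric.Hausdorff_space_mtopology)
qed

lemma topspace_arr_topology:
  "\<rho> \<in> Obj C \<Longrightarrow> \<sigma> \<in> Obj C \<Longrightarrow> topspace (arr_topology C \<rho> \<sigma>) = Arr C \<rho> \<sigma>"
proof -
  assume "\<rho> \<in> Obj C" "\<sigma> \<in> Obj C"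
  then interpret A: complex_banach "Arr C \<rho> \<sigma>" "Add C" "Zero C \<rho> \<sigma>" "Scale C" "Nrm C"
    by (rule banach)
  show ?thesis
    unfolding arr_topology_def by (rule A.metric.topspace_mtopology)
qed

lemma continuous_arrD:
  assumes "\<rho> \<in> Obj C" "\<sigma> \<in> Obj C" "continuous_map X (arr_topology C \<rho> \<sigma>) f" "w \<in> topspace X"
  shows "arr \<rho> \<sigma> (f w)"
  using assms(3,4) unfolding continuous_arr_iff[OF assms(1,2)] by blast

lemma openin_arr_ball:
  assumes "\<rho> \<in> Obj C" "\<sigma> \<in> Obj C" and f: "continuous_map X (arr_topology C \<rho> \<sigma>) f" and p: "p \<in> Arr C \<rho> \<sigma>"
  shows "openin X {w \<in> topspace X. Nrm C (p \<ominus> f w) < r}"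
    and "closedin X {w \<in> topspace X. Nrm C (p \<ominus> f w) \<le> r}"
proof -
  interpret A: complex_banach "Arr C \<rho> \<sigma>" "Add C" "Zero C \<rho> \<sigma>" "Scale C" "Nrm C"
    using assms(1,2) by (rule banach)
  have fV: "f w \<in> Arr C \<rho> \<sigma>" if "w \<in> topspace X" for w
    using continuous_arrD[OF assms(1-3) that] by (simp add: arr_def)
  have "openin X {w \<in> topspace X. f w \<in> A.metric.mball p r}"
    using openin_continuous_map_preimage[OF f] A.metric.openin_mball unfolding arr_topology_def by blast
  also have "{w \<in> topspace X. f w \<in> A.metric.mball p r} = {w \<in> topspace X. Nrm C (p \<ominus> f w) < r}"
    using p fV by (auto simp: norm_dist_def)
  finally show "openin X {w \<in> topspace X. Nrm C (p \<ominus> f w) < r}" .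
  have "closedin X {w \<in> topspace X. f w \<in> A.metric.mcball p r}"
    using closedin_continuous_map_preimage[OF f] A.metric.closedin_mcball unfolding arr_topology_def by blast
  also have "{w \<in> topspace X. f w \<in> A.metric.mcball p r} = {w \<in> topspace X. Nrm C (p \<ominus> f w) \<le> r}"
    using p fV by (auto simp: norm_dist_def)
  finally show "closedin X {w \<in> topspace X. Nrm C (p \<ominus> f w) \<le> r}" .
qed

lemma eventually_nhdsin_topspace: "eventually (\<lambda>y. y \<in> topspace X) (nhdsin X w)"
  by (metis eventually_nhdsin openin_topspace)

lemma continuous_cmp:
  assumes o: "\<rho> \<in> Obj C" "\<sigma> \<in> Obj C" "\<tau> \<in> Obj C"
    and x: "continuous_map X (arr_topology C \<rho> \<sigma>) x" and y: "continuous_map X (arr_topology C \<sigma> \<tau>) y"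
  shows "continuous_map X (arr_topology C \<rho> \<tau>) (\<lambda>w. y w \<cdot> x w)"
  unfolding continuous_arr_iff[OF o(1,3)]
proof (intro ballI conjI)
  fix w assume w: "w \<in> topspace X"
  have ax: "arr \<rho> \<sigma> (x z)" and ay: "arr \<sigma> \<tau> (y z)" if "z \<in> topspace X" for z
    using continuous_arrD[OF o(1,2) x that] continuous_arrD[OF o(2,3) y that] by simp_all
  show "arr \<rho> \<tau> (y w \<cdot> x w)"
    using arr_cmp[OF ax[OF w] ay[OF w]] .
  let ?A = "\<lambda>z. Nrm C (y z \<ominus> y w)" and ?B = "\<lambda>z. Nrm C (x z \<ominus> x w)"
  have A: "(?A \<longlongrightarrow> 0) (nhdsin X w)" and B: "(?B \<longlongrightarrow> 0) (nhdsin X w)"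
    using x y w unfolding continuous_arr_iff[OF o(1,2)] continuous_arr_iff[OF o(2,3)] by blast+
  have bound: "0 \<le> Nrm C (y z \<cdot> x z \<ominus> y w \<cdot> x w) \<and>
      Nrm C (y z \<cdot> x z \<ominus> y w \<cdot> x w) \<le> ?A z * (?B z + Nrm C (x w)) + Nrm C (y w) * ?B z"
    if z: "z \<in> topspace X" for z
  proof
    have "x z = (x z \<ominus> x w) \<oplus> x w"
      using complex_banach.dif_add_cancel[OF banach[OF o(1,2)]] ax w z by (simp add: arr_def)
    then have "Nrm C (x z) \<le> ?B z + Nrm C (x w)"
      using norm_add_le[OF arr_add[OF ax[OF z] arr_scale[OF ax[OF w]]] ax[OF w]] by metis
    moreover have "0 \<le> ?A z"
      using norm_nonneg[OF arr_add[OF ay[OF z] arr_scale[OF ay[OF w]]]] .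
    ultimately have "?A z * Nrm C (x z) \<le> ?A z * (?B z + Nrm C (x w))"
      by (rule mult_left_mono)
    then show "Nrm C (y z \<cdot> x z \<ominus> y w \<cdot> x w) \<le> ?A z * (?B z + Nrm C (x w)) + Nrm C (y w) * ?B z"
      using norm_cmp_diff_le[OF ax[OF z] ax[OF w] ay[OF z] ay[OF w]] by linarith
    show "0 \<le> Nrm C (y z \<cdot> x z \<ominus> y w \<cdot> x w)"
      using norm_nonneg[OF arr_add[OF arr_cmp[OF ax[OF z] ay[OF z]] arr_scale[OF arr_cmp[OF ax[OF w] ay[OF w]]]]] .
  qed
  have "((\<lambda>z. ?A z * (?B z + Nrm C (x w)) + Nrm C (y w) * ?B z) \<longlongrightarrow>
      0 * (0 + Nrm C (x w)) + Nrm C (y w) * 0) (nhdsin X w)"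
    by (intro tendsto_intros A B)
  then have lim: "((\<lambda>z. ?A z * (?B z + Nrm C (x w)) + Nrm C (y w) * ?B z) \<longlongrightarrow> 0) (nhdsin X w)"
    by simp
  show "((\<lambda>z. Nrm C (y z \<cdot> x z \<ominus> y w \<cdot> x w)) \<longlongrightarrow> 0) (nhdsin X w)"
    by (rule tendsto_sandwich[OF _ _ tendsto_const lim])
      (rule eventually_mono[OF eventually_nhdsin_topspace], use bound in blast)+
qed

lemma continuous_lipschitz:
  assumes o: "\<rho> \<in> Obj C" "\<sigma> \<in> Obj C" "\<rho>' \<in> Obj C" "\<sigma>' \<in> Obj C"
    and f: "continuous_map X (arr_topology C \<rho> \<sigma>) f"
    and g: "\<And>w. w \<in> topspace X \<Longrightarrow> arr \<rho>' \<sigma>' (g w)"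
    and le: "\<And>y w. y \<in> topspace X \<Longrightarrow> w \<in> topspace X \<Longrightarrow>
      Nrm C (g y \<ominus> g w) \<le> K * Nrm C (f y \<ominus> f w)"
  shows "continuous_map X (arr_topology C \<rho>' \<sigma>') g"
  unfolding continuous_arr_iff[OF o(3,4)]
proof (intro ballI conjI)
  fix w assume w: "w \<in> topspace X"
  then show "arr \<rho>' \<sigma>' (g w)"
    by (rule g)
  have "((\<lambda>y. K * Nrm C (f y \<ominus> f w)) \<longlongrightarrow> K * 0) (nhdsin X w)"
    using f w unfolding continuous_arr_iff[OF o(1,2)] by (intro tendsto_intros) blast
  then have lim: "((\<lambda>y. K * Nrm C (f y \<ominus> f w)) \<longlongrightarrow> 0) (nhdsin X w)"
    by simp
  have "0 \<le> Nrm C (g y \<ominus> g w)" if "y \<in> topspace X" for y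
    using norm_nonneg g w that by (metis arr_add arr_scale)
  then show "((\<lambda>y. Nrm C (g y \<ominus> g w)) \<longlongrightarrow> 0) (nhdsin X w)"
    by (intro tendsto_sandwich[OF _ _ tendsto_const lim])
      (rule eventually_mono[OF eventually_nhdsin_topspace], use le w in blast)+
qed

lemma continuous_adj:
  assumes o: "\<rho> \<in> Obj C" "\<sigma> \<in> Obj C" and f: "continuous_map X (arr_topology C \<rho> \<sigma>) f"
  shows "continuous_map X (arr_topology C \<sigma> \<rho>) (\<lambda>w. (f w)\<^sup>\<star>)"
proof (rule continuous_lipschitz[OF o o(2,1) f, where K = 1])
  fix w assume w: "w \<in> topspace X"
  have aw: "arr \<rho> \<sigma> (f w)"
    using continuous_arrD[OF o f w] .
  then show "arr \<sigma> \<rho> ((f w)\<^sup>\<star>)" ..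
  fix y assume y: "y \<in> topspace X"
  have ay: "arr \<rho> \<sigma> (f y)"
    using continuous_arrD[OF o f y] .
  have "Nrm C ((f y)\<^sup>\<star> \<ominus> (f w)\<^sup>\<star>) = Nrm C ((f y \<ominus> f w)\<^sup>\<star>)"
    using adj_diff[OF ay aw] by simp
  also have "\<dots> = Nrm C (f y \<ominus> f w)"
    using norm_adj ay aw by (metis arr_add arr_scale)
  finally show "Nrm C ((f y)\<^sup>\<star> \<ominus> (f w)\<^sup>\<star>) \<le> 1 * Nrm C (f y \<ominus> f w)"
    by simp
qed

lemma continuous_diff_const:
  assumes o: "\<rho> \<in> Obj C" "\<sigma> \<in> Obj C" and f: "continuous_map X (arr_topology C \<rho> \<sigma>) f"
    and p: "arr \<rho> \<sigma> p"
  shows "continuous_map X (arr_topology C \<rho> \<sigma>) (\<lambda>w. p \<ominus> f w)"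
proof (rule continuous_lipschitz[OF o o f, where K = 1])
  fix w assume w: "w \<in> topspace X"
  have aw: "arr \<rho> \<sigma> (f w)"
    using continuous_arrD[OF o f w] .
  then show "arr \<rho> \<sigma> (p \<ominus> f w)"
    using p by blast
  fix y assume y: "y \<in> topspace X"
  have ay: "arr \<rho> \<sigma> (f y)"
    using continuous_arrD[OF o f y] .
  interpret A: complex_banach "Arr C \<rho> \<sigma>" "Add C" "Zero C \<rho> \<sigma>" "Scale C" "Nrm C"
    using o by (rule banach)
  have V: "p \<in> Arr C \<rho> \<sigma>" "f y \<in> Arr C \<rho> \<sigma>" "f w \<in> Arr C \<rho> \<sigma>"
    using p ay aw by (auto simp: arr_def)
  have "(p \<ominus> f y) \<ominus> (p \<ominus> f w) = (f w \<ominus> p) \<oplus> (p \<ominus> f y)"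
    using V by (subst A.dif_swap) (simp_all add: A.add_commute)
  also have "\<dots> = f w \<ominus> f y"
    using V by (simp add: A.dif_telescope)
  finally show "Nrm C ((p \<ominus> f y) \<ominus> (p \<ominus> f w)) \<le> 1 * Nrm C (f y \<ominus> f w)"
    using norm_diff_commute[OF ay aw] by simp
qed

end

section \<open>Moving an isomorphism to a nearby projection\<close>

context cstar_category
begin

text \<open>
  Put \<open>y = v e\<close> and \<open>k = y y\<^sup>\<star>\<close>; since \<open>v p v\<^sup>\<star> = 1\<close>, the defect \<open>h = v (p - e) v\<^sup>\<star>\<close> is \<open>1 - k\<close>, so \<open>s = k\<^bsup>-1/2\<^esup>\<close>
  and \<open>u = s y\<close> has \<open>u u\<^sup>\<star> = s k s = 1\<close>.  Hence \<open>q = u\<^sup>\<star> u\<close> is a subprojection of \<open>e\<close>, and it remains to see that it is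
  all of \<open>e\<close>.  The difference \<open>r = e - q\<close> kills \<open>y\<^sup>\<star>\<close>, so \<open>r = r (e - y\<^sup>\<star> y)\<close>; but \<open>e - y\<^sup>\<star> y = e (e - p) e\<close> has norm at
  most \<open>1/2\<close>, which forces \<open>r = 0\<close>.
\<close>

lemma local_lift:
  assumes v: "piso (\<rho>, p) (full \<sigma>) v"
    and e: "arr \<rho> \<rho> e" "e \<cdot> e = e" "e\<^sup>\<star> = e"
    and close: "Nrm C (p \<ominus> e) \<le> 1/2"
    and s: "is_inv_sqrt \<sigma> (v \<cdot> (p \<ominus> e) \<cdot> v\<^sup>\<star>) s"
  shows "piso (\<rho>, e) (full \<sigma>) (s \<cdot> v \<cdot> e)"
proof -
  have av: "arr \<rho> \<sigma> v" and vv: "v\<^sup>\<star> \<cdot> v = p" "v \<cdot> v\<^sup>\<star> = \<iota> \<sigma>"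
    using v by (simp_all add: piso_def)
  note avs = arr_star[OF av]
  have \<sigma>: "\<sigma> \<in> Obj C"
    using av by (simp add: arr_def)
  have ap: "arr \<rho> \<rho> p" and p_adj: "p\<^sup>\<star> = p"
    using arr_cmp[OF av avs] adj_cmp[OF av avs] vv adj_adj[OF av] by simp_all
  have d: "arr \<rho> \<rho> (p \<ominus> e)"
    using ap e by blast
  have d_adj: "(p \<ominus> e)\<^sup>\<star> = p \<ominus> e"
    using adj_diff[OF ap e(1)] p_adj e(3) by simp
  define h where "h = v \<cdot> (p \<ominus> e) \<cdot> v\<^sup>\<star>"
  define y where "y = v \<cdot> e"
  define k where "k = y \<cdot> y\<^sup>\<star>"
  have ah: "arr \<sigma> \<sigma> h" and ay: "arr \<rho> \<sigma> y" and as: "arr \<sigma> \<sigma> s"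
    using av d e s unfolding h_def y_def is_inv_sqrt_def by blast+
  note ays = arr_star[OF ay]
  have ak: "arr \<sigma> \<sigma> k"
    using ay ays unfolding k_def by blast
  have h_adj: "h\<^sup>\<star> = h"
    using adj_cmp[OF arr_cmp[OF avs d] av] adj_cmp[OF avs d] d_adj adj_adj[OF av] assoc[OF avs d av]
    by (simp add: h_def)
  have y_adj: "y\<^sup>\<star> = e \<cdot> v\<^sup>\<star>"
    using adj_cmp[OF e(1) av] e(3) by (simp add: y_def)
  have e_y_adj: "e \<cdot> y\<^sup>\<star> = y\<^sup>\<star>"
    using assoc[OF avs e(1) e(1)] e(2) by (simp add: y_adj)
  have k: "k = v \<cdot> e \<cdot> v\<^sup>\<star>"
    using assoc[OF arr_cmp[OF avs e(1)] e(1) av] e_y_adj by (simp add: k_def y_def[symmetric] y_adj)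
  have "v \<cdot> p \<cdot> v\<^sup>\<star> = \<iota> \<sigma>"
    using piso_ident_left[OF piso_adj[OF v]] vv by simp
  then have h: "h = \<iota> \<sigma> \<ominus> k"
    using diff_cmp[OF avs ap e(1)] cmp_diff[OF arr_cmp[OF avs ap] arr_cmp[OF avs e(1)] av]
    by (simp add: h_def k)
  interpret A: complex_banach "Arr C \<sigma> \<sigma>" "Add C" "Zero C \<sigma> \<sigma>" "Scale C" "Nrm C"
    using arr_banach[OF ah] .
  have "\<iota> \<sigma> \<in> Arr C \<sigma> \<sigma>" "k \<in> Arr C \<sigma> \<sigma>"
    using ak ident_closed[OF \<sigma>] by (simp_all add: arr_def)
  then have "\<iota> \<sigma> \<ominus> h = k"
    using A.dif_add_cancel[of k "\<iota> \<sigma>"] A.dif_swap[of "\<iota> \<sigma>" k]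
      A.add_commute[of "\<iota> \<sigma>" "k \<ominus> \<iota> \<sigma>"] by (simp add: h)
  then have s_adj: "s\<^sup>\<star> = s" and sks: "s \<cdot> k \<cdot> s = \<iota> \<sigma>"
    using inv_sqrt_self_adjoint[OF ah h_adj] s by (simp_all add: h_def)
  \<comment> \<open>The identity \<open>s k s = 1\<close> alone makes \<open>s\<close> commute with \<open>k\<close>.\<close>
  have "s \<cdot> k = (s \<cdot> k) \<cdot> (s \<cdot> k \<cdot> s)"
    using ident_right[OF arr_cmp[OF ak as]] sks by simp
  also have "\<dots> = (s \<cdot> k \<cdot> s) \<cdot> k \<cdot> s"
    using as ak by (simp add: assoc[of \<sigma> \<sigma> _ \<sigma> _ \<sigma>] arr_cmp[of \<sigma> \<sigma> _ \<sigma>])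
  also have "\<dots> = k \<cdot> s"
    using ident_left[OF arr_cmp[OF as ak]] sks by simp
  finally have ssk: "s \<cdot> s \<cdot> k = \<iota> \<sigma>"
    using sks by simp
  define u where "u = s \<cdot> y"
  have au: "arr \<rho> \<sigma> u"
    using as ay unfolding u_def by blast
  note aus = arr_star[OF au]
  have u_adj: "u\<^sup>\<star> = y\<^sup>\<star> \<cdot> s"
    using adj_cmp[OF ay as] s_adj by (simp add: u_def)
  have "u \<cdot> u\<^sup>\<star> = s \<cdot> y \<cdot> y\<^sup>\<star> \<cdot> s"
    using assoc[OF arr_cmp[OF as ays] ay as] by (simp add: u_def u_adj[unfolded u_def])
  also have "\<dots> = \<iota> \<sigma>"
    using assoc[OF as ays ay] sks by (simp add: k_def)
  finally have uu: "u \<cdot> u\<^sup>\<star> = \<iota> \<sigma>" .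
  define q where "q = u\<^sup>\<star> \<cdot> u"
  have aq: "arr \<rho> \<rho> q"
    using au aus unfolding q_def by blast
  have qy: "q \<cdot> y\<^sup>\<star> = y\<^sup>\<star>"
  proof -
    have "q \<cdot> y\<^sup>\<star> = u\<^sup>\<star> \<cdot> u \<cdot> y\<^sup>\<star>"
      using assoc[OF ays au aus] by (simp add: q_def)
    also have "\<dots> = u\<^sup>\<star> \<cdot> s \<cdot> k"
      using assoc[OF ays ay as] by (simp add: u_def k_def)
    also have "\<dots> = y\<^sup>\<star> \<cdot> s \<cdot> s \<cdot> k"
      using assoc[OF arr_cmp[OF ak as] as ays] by (simp add: u_adj)
    finally show ?thesis
      using ssk ident_right[OF ays] by simp
  qed
  have ye: "y \<cdot> e = y"
    using assoc[OF e(1) e(1) av] e(2) by (simp add: y_def)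
  have qe: "q \<cdot> e = q"
    using assoc[OF e(1) au aus] assoc[OF e(1) ay as] ye by (simp add: q_def u_def)
  define r where "r = e \<ominus> q"
  have ar: "arr \<rho> \<rho> r"
    using e aq unfolding r_def by blast
  have yy: "y\<^sup>\<star> \<cdot> y = e \<cdot> p \<cdot> e"
    using assoc[OF ay avs e(1)] assoc[OF e(1) av avs] vv by (simp add: y_adj) (simp add: y_def)
  have ayy: "arr \<rho> \<rho> (y\<^sup>\<star> \<cdot> y)"
    using ay ays by blast
  have re: "r \<cdot> e = r"
    using diff_cmp[OF e(1) e(1) aq] e(2) qe by (simp add: r_def)
  interpret R: complex_banach "Arr C \<rho> \<rho>" "Add C" "Zero C \<rho> \<rho>" "Scale C" "Nrm C"
    using arr_banach[OF ar] .
  have "r \<cdot> y\<^sup>\<star> \<cdot> y = (e \<ominus> q) \<cdot> y\<^sup>\<star> \<cdot> y"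
    by (simp add: r_def)
  also have "\<dots> = e \<cdot> y\<^sup>\<star> \<cdot> y \<ominus> q \<cdot> y\<^sup>\<star> \<cdot> y"
    using diff_cmp[OF ayy e(1) aq] .
  also have "\<dots> = y\<^sup>\<star> \<cdot> y \<ominus> y\<^sup>\<star> \<cdot> y"
    using assoc[OF ay ays e(1)] assoc[OF ay ays aq] e_y_adj qy by simp
  also have "\<dots> = Zero C \<rho> \<rho>"
    using ayy R.add_inverse by (simp add: arr_def)
  finally have ryy: "r \<cdot> y\<^sup>\<star> \<cdot> y = Zero C \<rho> \<rho>" .
  have zero: "Scale C (-1) (Zero C \<rho> \<rho>) = Zero C \<rho> \<rho>"
    using R.dif_eq_zero_iff R.zero_add by (metis R.scale_closed R.zero_closed)
  have m: "arr \<rho> \<rho> (e \<ominus> y\<^sup>\<star> \<cdot> y)"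
    using e ayy by blast
  have "r \<cdot> (e \<ominus> y\<^sup>\<star> \<cdot> y) = r"
    using cmp_diff[OF e(1) ayy ar] re ryy zero R.add_zero ar by (simp add: arr_def)
  then have r_le: "Nrm C r \<le> Nrm C r * Nrm C (e \<ominus> y\<^sup>\<star> \<cdot> y)"
    using norm_cmp_le[OF m ar] by simp
  have "e \<ominus> y\<^sup>\<star> \<cdot> y = e \<cdot> (e \<ominus> p) \<cdot> e"
    using diff_cmp[OF e(1) e(1) ap] cmp_diff[OF e(1) arr_cmp[OF e(1) ap] e(1)] e(2)
    by (simp add: yy)
  moreover have "Nrm C (e \<cdot> (e \<ominus> p) \<cdot> e) \<le> 1 * (Nrm C (e \<ominus> p) * 1)"
  proof -
    have d': "arr \<rho> \<rho> (e \<ominus> p)"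
      using ap e by blast
    have e1: "Nrm C e \<le> 1"
      using norm_projection_le_1[OF e(1)] e by simp
    have "Nrm C (e \<cdot> (e \<ominus> p) \<cdot> e) \<le> Nrm C e * (Nrm C (e \<ominus> p) * Nrm C e)"
      using norm_cmp_le[OF arr_cmp[OF e(1) d'] e(1)] norm_cmp_le[OF e(1) d'] norm_nonneg[OF e(1)]
      by (meson mult_left_mono order_trans)
    also have "\<dots> \<le> 1 * (Nrm C (e \<ominus> p) * 1)"
      using e1 norm_nonneg[OF e(1)] norm_nonneg[OF d'] by (intro mult_mono) auto
    finally show ?thesis .
  qed
  ultimately have "Nrm C (e \<ominus> y\<^sup>\<star> \<cdot> y) \<le> 1/2"
    using close norm_diff_commute[OF ap e(1)] by simp
  then have "Nrm C r * Nrm C (e \<ominus> y\<^sup>\<star> \<cdot> y) \<le> Nrm C r * (1/2)"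
    using norm_nonneg[OF ar] by (rule mult_left_mono)
  then have "Nrm C r = 0"
    using r_le norm_nonneg[OF ar] by linarith
  then have "q = e"
    using diff_cancel_iff[OF e(1) aq] by (simp add: r_def)
  moreover have "u \<cdot> e = u"
    using assoc[OF e(1) ay as] ye by (simp add: u_def)
  ultimately have "piso (\<rho>, e) (full \<sigma>) u"
    using au uu by (simp add: piso_def q_def)
  then show ?thesis
    by (simp add: u_def y_def)
qed

text \<open>
  The polar part \<open>k\<^bsup>-1/2\<^esup> v e\<close> of \<open>v e\<close>, where \<open>k = (v e) (v e)\<^sup>\<star>\<close>.
\<close>

definition lift :: "'o \<Rightarrow> 'a \<Rightarrow> 'a \<Rightarrow> 'a \<Rightarrow> 'a" where
  "lift \<sigma> v p e = (SOME s. is_inv_sqrt \<sigma> (v \<cdot> (p \<ominus> e) \<cdot> v\<^sup>\<star>) s) \<cdot> v \<cdot> e"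

lemma lift_defect:
  assumes v: "piso (\<rho>, p) (full \<sigma>) v" and e: "arr \<rho> \<rho> e" and close: "Nrm C (p \<ominus> e) \<le> 1/2"
  shows "arr \<sigma> \<sigma> (v \<cdot> (p \<ominus> e) \<cdot> v\<^sup>\<star>)"
    and "is_inv_sqrt \<sigma> (v \<cdot> (p \<ominus> e) \<cdot> v\<^sup>\<star>) (SOME s. is_inv_sqrt \<sigma> (v \<cdot> (p \<ominus> e) \<cdot> v\<^sup>\<star>) s)"
proof -
  have av: "arr \<rho> \<sigma> v" and vv: "v\<^sup>\<star> \<cdot> v = p" "v \<cdot> v\<^sup>\<star> = \<iota> \<sigma>"
    using v by (simp_all add: piso_def)
  have d: "arr \<rho> \<rho> (p \<ominus> e)"
    using av e vv(1) arr_cmp[OF av arr_star[OF av]] by blast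
  note avs = arr_star[OF av]
  show h: "arr \<sigma> \<sigma> (v \<cdot> (p \<ominus> e) \<cdot> v\<^sup>\<star>)"
    using arr_cmp[OF arr_cmp[OF avs d] av] .
  have "Nrm C (v \<cdot> (p \<ominus> e) \<cdot> v\<^sup>\<star>) \<le> Nrm C v * (Nrm C (p \<ominus> e) * Nrm C (v\<^sup>\<star>))"
    using norm_cmp_le[OF arr_cmp[OF avs d] av] norm_cmp_le[OF avs d] norm_nonneg[OF av]
    by (meson mult_left_mono order_trans)
  also have "\<dots> \<le> 1 * (1/2 * 1)"
    using norm_coisometry_le_1[OF av vv(2)] close norm_nonneg[OF av] norm_nonneg[OF avs] norm_nonneg[OF d]
    by (intro mult_mono) auto
  finally obtain s where "is_inv_sqrt \<sigma> (v \<cdot> (p \<ominus> e) \<cdot> v\<^sup>\<star>) s"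
    using inv_sqrt_exists[OF h] by auto
  then show "is_inv_sqrt \<sigma> (v \<cdot> (p \<ominus> e) \<cdot> v\<^sup>\<star>) (SOME s. is_inv_sqrt \<sigma> (v \<cdot> (p \<ominus> e) \<cdot> v\<^sup>\<star>) s)"
    by (rule someI)
qed

lemma piso_lift:
  assumes "piso (\<rho>, p) (full \<sigma>) v" and "arr \<rho> \<rho> e" "e \<cdot> e = e" "e\<^sup>\<star> = e" and "Nrm C (p \<ominus> e) \<le> 1/2"
  shows "piso (\<rho>, e) (full \<sigma>) (lift \<sigma> v p e)"
  unfolding lift_def using assms local_lift lift_defect(2) by blast

text \<open>
  A fixed \<open>v\<close> thus trivializes the whole part of a field \<open>e\<close> that stays within \<open>1/2\<close> of \<open>p\<close>.  Fixing one choice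
  of \<open>s\<close> is harmless, because the Lipschitz estimate compares arbitrary choices.
\<close>

lemma continuous_lift:
  assumes v: "piso (\<rho>, p) (full \<sigma>) v"
    and e: "continuous_map X (arr_topology C \<rho> \<rho>) e"
    and close: "\<And>w. w \<in> topspace X \<Longrightarrow> Nrm C (p \<ominus> e w) \<le> 1/2"
  shows "continuous_map X (arr_topology C \<rho> \<sigma>) (\<lambda>w. lift \<sigma> v p (e w))"
proof -
  have av: "arr \<rho> \<sigma> v" and vv: "v\<^sup>\<star> \<cdot> v = p"
    using v by (simp_all add: piso_def)
  have o: "\<rho> \<in> Obj C" "\<sigma> \<in> Obj C"
    using av by (auto simp: arr_def)
  have ap: "arr \<rho> \<rho> p"
    using arr_cmp[OF av arr_star[OF av]] vv by simp
  have const: "continuous_map X (arr_topology C \<tau> \<upsilon>) (\<lambda>_. x)" if "arr \<tau> \<upsilon> x" for \<tau> \<upsilon> x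
    using that by (simp add: topspace_arr_topology arr_def)
  let ?h = "\<lambda>w. v \<cdot> (p \<ominus> e w) \<cdot> v\<^sup>\<star>"
  have h: "continuous_map X (arr_topology C \<sigma> \<sigma>) ?h"
    by (intro continuous_cmp[of _ \<rho>] o continuous_diff_const e ap const av arr_star)
  have ae: "arr \<rho> \<rho> (e w)" if "w \<in> topspace X" for w
    using continuous_arrD[OF o(1) o(1) e that] .
  have s: "continuous_map X (arr_topology C \<sigma> \<sigma>) (\<lambda>w. SOME s. is_inv_sqrt \<sigma> (?h w) s)"
  proof (rule continuous_lipschitz[OF o(2) o(2) o(2) o(2) h, where K = 4])
    fix w assume w: "w \<in> topspace X"
    note Sw = lift_defect[OF v ae[OF w] close[OF w]]
    then show "arr \<sigma> \<sigma> (SOME s. is_inv_sqrt \<sigma> (?h w) s)"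
      unfolding is_inv_sqrt_def by blast
    fix y assume y: "y \<in> topspace X"
    show "Nrm C ((SOME s. is_inv_sqrt \<sigma> (?h y) s) \<ominus> (SOME s. is_inv_sqrt \<sigma> (?h w) s)) \<le> 4 * Nrm C (?h y \<ominus> ?h w)"
      using lift_defect[OF v ae[OF y] close[OF y]] Sw inv_sqrt_lipschitz by blast
  qed
  show ?thesis
    unfolding lift_def
    by (intro continuous_cmp[OF o(1) o(2) o(2) _ s] continuous_cmp[OF o(1) o(1) o(2) e] const av)
qed

end

section \<open>Cocycles in a topological group\<close>

text \<open>
  Equivalence of cocycles is studied over an arbitrary such group: symmetry needs continuous inverses, and
  transitivity continuous products.
\<close>

locale topological_group = group G for G :: "'g monoid" (structure) +
  fixes T :: "'g topology"
  assumes topspace_eq: "topspace T = carrier G"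
    and continuous_mult: "continuous_map (prod_topology T T) T (\<lambda>(x, y). x \<otimes> y)"
    and continuous_inv: "continuous_map T T (\<lambda>x. inv x)"
begin

lemma continuous_map_closed: "continuous_map X T f \<Longrightarrow> w \<in> topspace X \<Longrightarrow> f w \<in> carrier G"
  using continuous_map_image_subset_topspace[of X T f] by (auto simp: topspace_eq)

lemma continuous_map_mult:
  assumes "continuous_map X T f" "continuous_map X T g"
  shows "continuous_map X T (\<lambda>w. f w \<otimes> g w)"
  using continuous_map_compose[OF _ continuous_mult, of X "\<lambda>w. (f w, g w)"] assms
  by (simp add: continuous_map_paired o_def)

lemma continuous_map_inv:
  "continuous_map X T f \<Longrightarrow> continuous_map X T (\<lambda>w. inv (f w))"
  using continuous_map_compose[OF _ continuous_inv, of X f] by (simp add: o_def)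

lemma cocycles_closed:
  assumes "(I, U, \<alpha>) \<in> cocycles \<Omega> G T" "i \<in> I" "j \<in> I" "w \<in> U i" "w \<in> U j"
  shows "\<alpha> i j w \<in> carrier G"
proof -
  have "w \<in> topspace (subtopology \<Omega> (U i \<inter> U j))"
    using assms by (auto simp: cocycles_def open_cover_def)
  moreover have "continuous_map (subtopology \<Omega> (U i \<inter> U j)) T (\<alpha> i j)"
    using assms(1-3) by (simp add: cocycles_def)
  ultimately show ?thesis
    by (intro continuous_map_closed)
qed

lemma cocycles_mult:
  assumes "(I, U, \<alpha>) \<in> cocycles \<Omega> G T" "i \<in> I" "j \<in> I" "k \<in> I" "w \<in> U i" "w \<in> U j" "w \<in> U k"
  shows "\<alpha> i j w \<otimes> \<alpha> j k w = \<alpha> i k w"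
  using assms by (auto simp: cocycles_def)

lemma cocycles_diag:
  assumes "(I, U, \<alpha>) \<in> cocycles \<Omega> G T" "i \<in> I" "w \<in> U i"
  shows "\<alpha> i i w = \<one>"
  using cocycles_mult[OF assms(1), of i i i w] cocycles_closed[OF assms(1), of i i w] assms
  by simp

lemma cocycles_inv:
  assumes "(I, U, \<alpha>) \<in> cocycles \<Omega> G T" "i \<in> I" "j \<in> I" "w \<in> U i" "w \<in> U j"
  shows "inv (\<alpha> i j w) = \<alpha> j i w"
  using cocycles_mult[OF assms(1), of j i j w] cocycles_diag[OF assms(1), of j w]
    cocycles_closed[OF assms(1), of i j w] cocycles_closed[OF assms(1), of j i w] assms
  by (simp add: inv_equality)

lemma cocycle_rel_iff:
  "((I, U, \<alpha>), (I', U', \<alpha>')) \<in> cocycle_rel \<Omega> G T \<longleftrightarrow>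
     (I, U, \<alpha>) \<in> cocycles \<Omega> G T \<and> (I', U', \<alpha>') \<in> cocycles \<Omega> G T \<and>
     (\<exists>u. (\<forall>i \<in> I. \<forall>l \<in> I'. continuous_map (subtopology \<Omega> (U i \<inter> U' l)) T (u i l)) \<and>
          (\<forall>i \<in> I. \<forall>j \<in> I. \<forall>l \<in> I'. \<forall>m \<in> I'. \<forall>w \<in> U i \<inter> U j \<inter> U' l \<inter> U' m.
             \<alpha> i j w = u i l w \<otimes> \<alpha>' l m w \<otimes> inv (u j m w)))"
  by (simp add: cocycle_rel_def)

lemma openin_cocycle_cover:
  "(I, U, \<alpha>) \<in> cocycles \<Omega> G T \<Longrightarrow> i \<in> I \<Longrightarrow> openin \<Omega> (U i)"
  by (auto simp: cocycles_def open_cover_def)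

text \<open>
  A cocycle \<open>\<alpha>\<close> is related to itself through the family \<open>\<alpha>\<close>; this sees only values on overlaps, so it also
  relates cocycles that differ as functions elsewhere.
\<close>

lemma cocycle_rel_cong:
  assumes a: "(I, U, \<alpha>) \<in> cocycles \<Omega> G T" and b: "(I, U, \<beta>) \<in> cocycles \<Omega> G T"
    and eq: "\<And>i j w. i \<in> I \<Longrightarrow> j \<in> I \<Longrightarrow> w \<in> U i \<Longrightarrow> w \<in> U j \<Longrightarrow> \<beta> i j w = \<alpha> i j w"
  shows "((I, U, \<alpha>), (I, U, \<beta>)) \<in> cocycle_rel \<Omega> G T"
  unfolding cocycle_rel_iff
proof (intro conjI a b exI[of _ \<alpha>] ballI)
  show "continuous_map (subtopology \<Omega> (U i \<inter> U l)) T (\<alpha> i l)" if "i \<in> I" "l \<in> I" for i l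
    using a that by (auto simp: cocycles_def)
  fix i j l m w assume "i \<in> I" "j \<in> I" "l \<in> I" "m \<in> I" "w \<in> U i \<inter> U j \<inter> U l \<inter> U m"
  then show "\<alpha> i j w = \<alpha> i l w \<otimes> \<beta> l m w \<otimes> inv (\<alpha> j m w)"
    using a by (simp add: eq cocycles_inv cocycles_mult)
qed

lemma cocycle_rel_refl: "a \<in> cocycles \<Omega> G T \<Longrightarrow> (a, a) \<in> cocycle_rel \<Omega> G T"
  by (cases a) (auto intro: cocycle_rel_cong)

lemma cocycle_rel_sym:
  assumes "(a, b) \<in> cocycle_rel \<Omega> G T"
  shows "(b, a) \<in> cocycle_rel \<Omega> G T"
proof -
  obtain I U \<alpha> I' U' \<alpha>' where ab: "a = (I, U, \<alpha>)" "b = (I', U', \<alpha>')"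
    by (metis prod_cases3)
  obtain u where a: "(I, U, \<alpha>) \<in> cocycles \<Omega> G T" and b: "(I', U', \<alpha>') \<in> cocycles \<Omega> G T"
    and u: "\<And>i l. i \<in> I \<Longrightarrow> l \<in> I' \<Longrightarrow> continuous_map (subtopology \<Omega> (U i \<inter> U' l)) T (u i l)"
    and eq: "\<And>i j l m w. i \<in> I \<Longrightarrow> j \<in> I \<Longrightarrow> l \<in> I' \<Longrightarrow> m \<in> I' \<Longrightarrow> w \<in> U i \<inter> U j \<inter> U' l \<inter> U' m \<Longrightarrow>
      \<alpha> i j w = u i l w \<otimes> \<alpha>' l m w \<otimes> inv (u j m w)"
    using assms unfolding ab cocycle_rel_iff by blast
  have uG: "u i l w \<in> carrier G" if "i \<in> I" "l \<in> I'" "w \<in> U i" "w \<in> U' l" for i l w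
    using continuous_map_closed[OF u[OF that(1,2)]] openin_cocycle_cover[OF a that(1)] that(3,4)
      openin_subset by fastforce
  show ?thesis
    unfolding ab cocycle_rel_iff
  proof (intro conjI a b exI[of _ "\<lambda>l i w. inv (u i l w)"] ballI)
    show "continuous_map (subtopology \<Omega> (U' l \<inter> U i)) T (\<lambda>w. inv (u i l w))" if "l \<in> I'" "i \<in> I" for l i
      using continuous_map_inv[OF u] that by (simp add: Int_commute)
    fix l m i j w assume I: "l \<in> I'" "m \<in> I'" "i \<in> I" "j \<in> I" and w: "w \<in> U' l \<inter> U' m \<inter> U i \<inter> U j"
    have G: "u i l w \<in> carrier G" "u j m w \<in> carrier G" "\<alpha>' l m w \<in> carrier G"
      using I w uG cocycles_closed[OF b] by auto
    have "\<alpha> i j w = u i l w \<otimes> \<alpha>' l m w \<otimes> inv (u j m w)"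
      using eq I w by blast
    then show "\<alpha>' l m w = inv (u i l w) \<otimes> \<alpha> i j w \<otimes> inv (inv (u j m w))"
      using G by (simp add: m_assoc) (simp flip: m_assoc)
  qed
qed

text \<open>
  On \<open>U i \<inter> U' l \<inter> U'' r\<close> the composite relation is given by \<open>u i l \<otimes> v l r\<close>.  This is independent of \<open>l\<close>: the
  two relations with a repeated index give \<open>u i m = u i l \<otimes> \<alpha>' l m\<close> and \<open>\<alpha>' l m = v l r \<otimes> inv (v m r)\<close>.  So the
  functions glue over the cover \<open>U'\<close>.
\<close>

lemma cocycle_rel_trans:
  assumes "(a, b) \<in> cocycle_rel \<Omega> G T" "(b, c) \<in> cocycle_rel \<Omega> G T"
  shows "(a, c) \<in> cocycle_rel \<Omega> G T"
proof -
  obtain I U \<alpha> I' U' \<alpha>' I'' U'' \<alpha>''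
    where abc: "a = (I, U, \<alpha>)" "b = (I', U', \<alpha>')" "c = (I'', U'', \<alpha>'')"
    by (metis prod_cases3)
  obtain u where a: "(I, U, \<alpha>) \<in> cocycles \<Omega> G T" and b: "(I', U', \<alpha>') \<in> cocycles \<Omega> G T"
    and u: "\<And>i l. i \<in> I \<Longrightarrow> l \<in> I' \<Longrightarrow> continuous_map (subtopology \<Omega> (U i \<inter> U' l)) T (u i l)"
    and equ: "\<And>i j l m w. i \<in> I \<Longrightarrow> j \<in> I \<Longrightarrow> l \<in> I' \<Longrightarrow> m \<in> I' \<Longrightarrow> w \<in> U i \<inter> U j \<inter> U' l \<inter> U' m \<Longrightarrow>
      \<alpha> i j w = u i l w \<otimes> \<alpha>' l m w \<otimes> inv (u j m w)"
    using assms(1) unfolding abc cocycle_rel_iff by blast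
  obtain v where c: "(I'', U'', \<alpha>'') \<in> cocycles \<Omega> G T"
    and v: "\<And>l r. l \<in> I' \<Longrightarrow> r \<in> I'' \<Longrightarrow> continuous_map (subtopology \<Omega> (U' l \<inter> U'' r)) T (v l r)"
    and eqv: "\<And>l m r s w. l \<in> I' \<Longrightarrow> m \<in> I' \<Longrightarrow> r \<in> I'' \<Longrightarrow> s \<in> I'' \<Longrightarrow> w \<in> U' l \<inter> U' m \<inter> U'' r \<inter> U'' s \<Longrightarrow>
      \<alpha>' l m w = v l r w \<otimes> \<alpha>'' r s w \<otimes> inv (v m s w)"
    using assms(2) unfolding abc cocycle_rel_iff by blast
  have uG: "u i l w \<in> carrier G" if "i \<in> I" "l \<in> I'" "w \<in> U i" "w \<in> U' l" for i l w
    using continuous_map_closed[OF u[OF that(1,2)]] openin_cocycle_cover[OF a that(1)] that(3,4)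
      openin_subset by fastforce
  have vG: "v l r w \<in> carrier G" if "l \<in> I'" "r \<in> I''" "w \<in> U' l" "w \<in> U'' r" for l r w
    using continuous_map_closed[OF v[OF that(1,2)]] openin_cocycle_cover[OF b that(1)] that(3,4)
      openin_subset by fastforce
  have consistent: "u i l w \<otimes> v l r w = u i m w \<otimes> v m r w"
    if I: "i \<in> I" "l \<in> I'" "m \<in> I'" "r \<in> I''" and w: "w \<in> U i" "w \<in> U' l" "w \<in> U' m" "w \<in> U'' r"
    for i l m r w
  proof -
    have G: "u i l w \<in> carrier G" "u i m w \<in> carrier G" "v l r w \<in> carrier G" "v m r w \<in> carrier G"
      "\<alpha>' l m w \<in> carrier G"
      using I w uG vG cocycles_closed[OF b] by auto
    have "\<one> = u i l w \<otimes> \<alpha>' l m w \<otimes> inv (u i m w)"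
      using equ[of i i l m w] I w cocycles_diag[OF a] by simp
    then have "u i m w = u i l w \<otimes> \<alpha>' l m w"
      using G by (metis inv_solve_right l_one m_closed one_closed)
    moreover have "\<alpha>' l m w = v l r w \<otimes> inv (v m r w)"
      using eqv[of l m r r w] I w cocycles_diag[OF c] G by simp
    ultimately show ?thesis
      using G by (simp add: m_assoc)
  qed
  have cover: "\<exists>l \<in> I'. w \<in> U' l" if "w \<in> topspace \<Omega>" for w
    using b that by (auto simp: cocycles_def open_cover_def)
  have "\<exists>g. continuous_map (subtopology \<Omega> (U i \<inter> U'' r)) T g \<and>
      (\<forall>l \<in> I'. \<forall>w \<in> U i \<inter> U' l \<inter> U'' r. g w = u i l w \<otimes> v l r w)" if I: "i \<in> I" "r \<in> I''" for i r
  proof -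
    let ?X = "subtopology \<Omega> (U i \<inter> U'' r)"
    have X: "topspace ?X = U i \<inter> U'' r"
      using openin_cocycle_cover[OF a I(1)] openin_subset by fastforce
    obtain g where "continuous_map ?X T g"
      and "\<And>w l. l \<in> I' \<Longrightarrow> w \<in> topspace ?X \<inter> (U i \<inter> U' l \<inter> U'' r) \<Longrightarrow> g w = u i l w \<otimes> v l r w"
    proof (rule pasting_lemma_exists[where X = ?X and I = I' and T = "\<lambda>l. U i \<inter> U' l \<inter> U'' r"
          and Y = T and f = "\<lambda>l w. u i l w \<otimes> v l r w"])
      show "topspace ?X \<subseteq> (\<Union>l\<in>I'. U i \<inter> U' l \<inter> U'' r)"
        using cover by fastforce
      fix l assume l: "l \<in> I'"
      have "U i \<inter> U' l \<inter> U'' r = U' l \<inter> (U i \<inter> U'' r)"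
        by blast
      then show "openin ?X (U i \<inter> U' l \<inter> U'' r)"
        using openin_cocycle_cover[OF b l] by (auto simp: openin_subtopology)
      have S: "subtopology ?X (U i \<inter> U' l \<inter> U'' r) = subtopology \<Omega> (U i \<inter> U' l \<inter> U'' r)"
        by (simp add: subtopology_subtopology Int_ac)
      show "continuous_map (subtopology ?X (U i \<inter> U' l \<inter> U'' r)) T (\<lambda>w. u i l w \<otimes> v l r w)"
        unfolding S
        by (intro continuous_map_mult continuous_map_from_subtopology_mono[OF u[OF I(1) l]]
            continuous_map_from_subtopology_mono[OF v[OF l I(2)]]) auto
    next
      fix l m w assume "l \<in> I'" "m \<in> I'"
        and "w \<in> topspace ?X \<inter> (U i \<inter> U' l \<inter> U'' r) \<inter> (U i \<inter> U' m \<inter> U'' r)"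
      then show "u i l w \<otimes> v l r w = u i m w \<otimes> v m r w"
        by (intro consistent I) auto
    qed auto
    then show ?thesis
      unfolding X by (intro exI[of _ g]) blast
  qed
  then obtain g where g: "\<And>i r. i \<in> I \<Longrightarrow> r \<in> I'' \<Longrightarrow> continuous_map (subtopology \<Omega> (U i \<inter> U'' r)) T (g i r)"
    and g_eq: "\<And>i r l w. i \<in> I \<Longrightarrow> r \<in> I'' \<Longrightarrow> l \<in> I' \<Longrightarrow> w \<in> U i \<inter> U' l \<inter> U'' r \<Longrightarrow>
      g i r w = u i l w \<otimes> v l r w"
    by metis
  show ?thesis
    unfolding abc cocycle_rel_iff
  proof (intro conjI a c exI[of _ g] ballI)
    show "continuous_map (subtopology \<Omega> (U i \<inter> U'' r)) T (g i r)" if "i \<in> I" "r \<in> I''" for i r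
      using g that .
    fix i j r s w assume I: "i \<in> I" "j \<in> I" "r \<in> I''" "s \<in> I''" and w: "w \<in> U i \<inter> U j \<inter> U'' r \<inter> U'' s"
    obtain l where l: "l \<in> I'" "w \<in> U' l"
      using cover openin_subset[OF openin_cocycle_cover[OF a I(1)]] w by blast
    have G: "u i l w \<in> carrier G" "u j l w \<in> carrier G" "v l r w \<in> carrier G" "v l s w \<in> carrier G"
      "\<alpha>'' r s w \<in> carrier G"
      using I l w uG vG cocycles_closed[OF c] by auto
    have "\<alpha> i j w = u i l w \<otimes> (v l r w \<otimes> \<alpha>'' r s w \<otimes> inv (v l s w)) \<otimes> inv (u j l w)"
      using equ[of i j l l w] eqv[of l l r s w] I l w by simp
    also have "\<dots> = (u i l w \<otimes> v l r w) \<otimes> \<alpha>'' r s w \<otimes> inv (u j l w \<otimes> v l s w)"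
      using G by (simp add: m_assoc inv_mult_group)
    also have "\<dots> = g i r w \<otimes> \<alpha>'' r s w \<otimes> inv (g j s w)"
      using g_eq[of i r l w] g_eq[of j s l w] I l w by simp
    finally show "\<alpha> i j w = g i r w \<otimes> \<alpha>'' r s w \<otimes> inv (g j s w)" .
  qed
qed

lemma cocycle_class_eq_iff:
  assumes "a \<in> cocycles \<Omega> G T" "b \<in> cocycles \<Omega> G T"
  shows "cocycle_class \<Omega> G T a = cocycle_class \<Omega> G T b \<longleftrightarrow> (a, b) \<in> cocycle_rel \<Omega> G T"
proof
  assume "cocycle_class \<Omega> G T a = cocycle_class \<Omega> G T b"
  then show "(a, b) \<in> cocycle_rel \<Omega> G T"
    using cocycle_rel_refl[OF assms(2)] unfolding cocycle_class_def by blast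
next
  assume ab: "(a, b) \<in> cocycle_rel \<Omega> G T"
  then show "cocycle_class \<Omega> G T a = cocycle_class \<Omega> G T b"
    unfolding cocycle_class_def using cocycle_rel_trans[OF ab] cocycle_rel_trans[OF cocycle_rel_sym[OF ab]]
    by blast
qed

end

section \<open>The unitary groups as topological groups\<close>

context cstar_category
begin

lemma unitary_topology_continuous_iff:
  assumes \<sigma>: "\<sigma> \<in> Obj C"
  shows "continuous_map X (unitary_topology C \<sigma>) u \<longleftrightarrow>
    continuous_map X (arr_topology C \<sigma> \<sigma>) u \<and> (\<forall>w \<in> topspace X. piso (full \<sigma>) (full \<sigma>) (u w))"
  by (auto simp: unitary_topology_def continuous_map_in_subtopology mem_unitary_group_iff[OF \<sigma>])

lemma group_unitary_group:
  assumes \<sigma>: "\<sigma> \<in> Obj C"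
  shows "group (unitary_group C \<sigma>)"
proof (rule groupI)
  have m [simp]: "mult (unitary_group C \<sigma>) = Cmp C" "one (unitary_group C \<sigma>) = \<iota> \<sigma>"
    by (simp_all add: unitary_group_def)
  note mem = mem_unitary_group_iff[OF \<sigma>]
  have "arr \<sigma> \<sigma> (\<iota> \<sigma>)"
    using \<sigma> by blast
  then show "\<one>\<^bsub>unitary_group C \<sigma>\<^esub> \<in> carrier (unitary_group C \<sigma>)"
    using \<sigma> by (simp add: mem piso_def adj_ident ident_right)
  fix x assume x: "x \<in> carrier (unitary_group C \<sigma>)"
  then show "\<one>\<^bsub>unitary_group C \<sigma>\<^esub> \<otimes>\<^bsub>unitary_group C \<sigma>\<^esub> x = x"
    using piso_ident_left[of "full \<sigma>" "full \<sigma>" x] by (simp add: mem)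
  show "\<exists>y\<in>carrier (unitary_group C \<sigma>). y \<otimes>\<^bsub>unitary_group C \<sigma>\<^esub> x = \<one>\<^bsub>unitary_group C \<sigma>\<^esub>"
    using x piso_source[of "full \<sigma>" "full \<sigma>" x] piso_adj[of "full \<sigma>" "full \<sigma>" x]
    by (intro bexI[of _ "x\<^sup>\<star>"]) (simp_all add: mem)
  fix y assume y: "y \<in> carrier (unitary_group C \<sigma>)"
  show "x \<otimes>\<^bsub>unitary_group C \<sigma>\<^esub> y \<in> carrier (unitary_group C \<sigma>)"
    using x y by (simp add: mem piso_cmp[of _ "full \<sigma>"])
  fix z assume z: "z \<in> carrier (unitary_group C \<sigma>)"
  show "x \<otimes>\<^bsub>unitary_group C \<sigma>\<^esub> y \<otimes>\<^bsub>unitary_group C \<sigma>\<^esub> z =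
      x \<otimes>\<^bsub>unitary_group C \<sigma>\<^esub> (y \<otimes>\<^bsub>unitary_group C \<sigma>\<^esub> z)"
    using x y z by (simp add: mem piso_assoc[of _ "full \<sigma>" _ "full \<sigma>" _ "full \<sigma>"])
qed

lemma inv_unitary_group:
  assumes \<sigma>: "\<sigma> \<in> Obj C" and u: "piso (full \<sigma>) (full \<sigma>) u"
  shows "inv\<^bsub>unitary_group C \<sigma>\<^esub> u = u\<^sup>\<star>"
proof (rule group.inv_equality[OF group_unitary_group[OF \<sigma>]])
  show "u\<^sup>\<star> \<otimes>\<^bsub>unitary_group C \<sigma>\<^esub> u = \<one>\<^bsub>unitary_group C \<sigma>\<^esub>"
    using piso_source[OF u] by (simp add: unitary_group_def)
  show "u \<in> carrier (unitary_group C \<sigma>)" "u\<^sup>\<star> \<in> carrier (unitary_group C \<sigma>)"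
    using u piso_adj[OF u] by (simp_all add: mem_unitary_group_iff[OF \<sigma>])
qed

lemma topspace_unitary_topology:
  "\<sigma> \<in> Obj C \<Longrightarrow> topspace (unitary_topology C \<sigma>) = carrier (unitary_group C \<sigma>)"
  by (auto simp: unitary_topology_def topspace_arr_topology unitary_group_def)

lemma topological_group_unitary:
  assumes \<sigma>: "\<sigma> \<in> Obj C"
  shows "topological_group (unitary_group C \<sigma>) (unitary_topology C \<sigma>)"
proof (intro topological_group.intro topological_group_axioms.intro)
  let ?T = "unitary_topology C \<sigma>"
  show "group (unitary_group C \<sigma>)"
    using \<sigma> by (rule group_unitary_group)
  show top: "topspace ?T = carrier (unitary_group C \<sigma>)"
    using \<sigma> by (rule topspace_unitary_topology)
  note cont = unitary_topology_continuous_iff[OF \<sigma>] and mem = mem_unitary_group_iff[OF \<sigma>]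
  have "continuous_map (prod_topology ?T ?T) ?T fst" "continuous_map (prod_topology ?T ?T) ?T snd"
    by (rule continuous_map_fst continuous_map_snd)+
  then have "continuous_map (prod_topology ?T ?T) ?T (\<lambda>p. fst p \<cdot> snd p)"
    unfolding cont by (auto intro: continuous_cmp[OF \<sigma> \<sigma> \<sigma>] piso_cmp)
  then show "continuous_map (prod_topology ?T ?T) ?T (\<lambda>(x, y). x \<otimes>\<^bsub>unitary_group C \<sigma>\<^esub> y)"
    by (simp add: unitary_group_def case_prod_beta')
  have "continuous_map ?T ?T (\<lambda>u. u)"
    by simp
  then have "continuous_map ?T ?T (\<lambda>u. u\<^sup>\<star>)"
    unfolding cont by (auto intro: continuous_adj[OF \<sigma> \<sigma>] piso_adj)
  then show "continuous_map ?T ?T (\<lambda>u. inv\<^bsub>unitary_group C \<sigma>\<^esub> u)"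
    by (rule continuous_map_eq) (simp add: top mem inv_unitary_group[OF \<sigma>])
qed

end

section \<open>The extension category in terms of the groupoid\<close>

lemma restrict_eq_iff:
  "e \<in> extensional A \<Longrightarrow> restrict f A = e \<longleftrightarrow> (\<forall>w \<in> A. f w = e w)"
  by (auto simp: fun_eq_iff restrict_def extensional_def)

lemma continuous_map_restrict_iff:
  "topspace X = S \<Longrightarrow> continuous_map X Y (restrict f S) \<longleftrightarrow> continuous_map X Y f"
  using continuous_map_eq[of X Y f "restrict f S"] continuous_map_eq[of X Y "restrict f S" f] by auto

context cstar_category
begin

lemma extension_object_iff:
  "(\<rho>, e) \<in> Obj (extension_category C \<Omega>) \<longleftrightarrow>
     \<rho> \<in> Obj C \<and> e \<in> extensional (topspace \<Omega>) \<and> continuous_map \<Omega> (arr_topology C \<rho> \<rho>) e \<and>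
     (\<forall>w \<in> topspace \<Omega>. e w \<cdot> e w = e w \<and> (e w)\<^sup>\<star> = e w)"
  by (auto simp: extension_category_def projection_category_def function_category_def
      is_projection_def restrict_eq_iff)

lemma extension_unitary_iff:
  assumes e: "(\<rho>, e) \<in> Obj (extension_category C \<Omega>)" and f: "(\<sigma>, f) \<in> Obj (extension_category C \<Omega>)"
  shows "unitarily_equivalent (extension_category C \<Omega>) (\<rho>, e) (\<sigma>, f) \<longleftrightarrow>
    (\<exists>u. continuous_map \<Omega> (arr_topology C \<rho> \<sigma>) u \<and>
         (\<forall>w \<in> topspace \<Omega>. piso (\<rho>, e w) (\<sigma>, f w) (u w)))"
proof
  have o: "\<rho> \<in> Obj C" "\<sigma> \<in> Obj C" and ext: "e \<in> extensional (topspace \<Omega>)" "f \<in> extensional (topspace \<Omega>)"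
    using e f by (auto simp: extension_object_iff)
  {
    assume "unitarily_equivalent (extension_category C \<Omega>) (\<rho>, e) (\<sigma>, f)"
    then obtain u where u: "u \<in> extensional (topspace \<Omega>)" "continuous_map \<Omega> (arr_topology C \<rho> \<sigma>) u"
      and "\<And>w. w \<in> topspace \<Omega> \<Longrightarrow> u w \<cdot> e w = u w"
      and "\<And>w. w \<in> topspace \<Omega> \<Longrightarrow> (u w)\<^sup>\<star> \<cdot> u w = e w"
      and "\<And>w. w \<in> topspace \<Omega> \<Longrightarrow> u w \<cdot> (u w)\<^sup>\<star> = f w"
      using ext by (auto simp: unitarily_equivalent_def extension_category_def projection_category_def
          function_category_def restrict_eq_iff)
    then show "\<exists>u. continuous_map \<Omega> (arr_topology C \<rho> \<sigma>) u \<and>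
         (\<forall>w \<in> topspace \<Omega>. piso (\<rho>, e w) (\<sigma>, f w) (u w))"
      using continuous_arrD[OF o u(2)] by (intro exI[of _ u]) (simp add: piso_def)
  next
    assume "\<exists>u. continuous_map \<Omega> (arr_topology C \<rho> \<sigma>) u \<and>
         (\<forall>w \<in> topspace \<Omega>. piso (\<rho>, e w) (\<sigma>, f w) (u w))"
    then obtain u where u: "continuous_map \<Omega> (arr_topology C \<rho> \<sigma>) u"
      and p: "\<And>w. w \<in> topspace \<Omega> \<Longrightarrow> piso (\<rho>, e w) (\<sigma>, f w) (u w)"
      by blast
    have "continuous_map \<Omega> (arr_topology C \<rho> \<sigma>) (restrict u (topspace \<Omega>))"
      using u by (rule continuous_map_eq) simp
    moreover have "u w \<cdot> e w = u w" "f w \<cdot> u w = u w" "(u w)\<^sup>\<star> \<cdot> u w = e w" "u w \<cdot> (u w)\<^sup>\<star> = f w"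
      if "w \<in> topspace \<Omega>" for w
      using p[OF that] piso_ident_left[OF p[OF that]] by (simp_all add: piso_def)
    ultimately show "unitarily_equivalent (extension_category C \<Omega>) (\<rho>, e) (\<sigma>, f)"
      using ext unfolding unitarily_equivalent_def
      by (intro bexI[of _ "restrict u (topspace \<Omega>)"])
        (auto simp: extension_category_def projection_category_def function_category_def restrict_eq_iff)
  }
qed

text \<open>
  The definition asks for \<open>e w = (v i w)\<^sup>\<star> v i w\<close> on \<open>U i\<close> only.  Both sides are continuous on the closure and the
  norm topology is Hausdorff, so the equation persists there.
\<close>

lemma trivializations_iff:
  assumes e: "(\<rho>, e) \<in> Obj (extension_category C \<Omega>)"
  shows "(I, U, v) \<in> trivializations C \<Omega> (\<rho>, e) \<rho>\<^sub>0 \<longleftrightarrow>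
    \<rho>\<^sub>0 \<in> Obj C \<and> open_cover \<Omega> I U \<and>
    (\<forall>i \<in> I. v i \<in> extensional (\<Omega> closure_of U i) \<and>
       continuous_map (subtopology \<Omega> (\<Omega> closure_of U i)) (arr_topology C \<rho> \<rho>\<^sub>0) (v i) \<and>
       (\<forall>w \<in> \<Omega> closure_of U i. piso (\<rho>, e w) (full \<rho>\<^sub>0) (v i w)))"
proof -
  have \<rho>: "\<rho> \<in> Obj C" and ec: "continuous_map \<Omega> (arr_topology C \<rho> \<rho>) e"
    using e by (auto simp: extension_object_iff)
  have top: "topspace (subtopology \<Omega> (\<Omega> closure_of S)) = \<Omega> closure_of S" for S
    by (rule topspace_subtopology_subset[OF closure_of_subset_topspace])
  have key: "(\<forall>w\<in>S. e w = (x w)\<^sup>\<star> \<cdot> x w) \<and> (\<forall>w\<in>\<Omega> closure_of S. x w \<cdot> (x w)\<^sup>\<star> = \<iota> \<rho>\<^sub>0) \<longleftrightarrow>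
      (\<forall>w \<in> \<Omega> closure_of S. piso (\<rho>, e w) (full \<rho>\<^sub>0) (x w))"
    if \<rho>\<^sub>0: "\<rho>\<^sub>0 \<in> Obj C" and S: "openin \<Omega> S"
      and x: "continuous_map (subtopology \<Omega> (\<Omega> closure_of S)) (arr_topology C \<rho> \<rho>\<^sub>0) x" for S x
  proof (intro iffI conjI ballI)
    let ?X = "subtopology \<Omega> (\<Omega> closure_of S)"
    have sub: "S \<subseteq> \<Omega> closure_of S"
      using S by (simp add: closure_of_subset openin_subset)
    fix w assume w: "w \<in> \<Omega> closure_of S"
      and tr: "(\<forall>w\<in>S. e w = (x w)\<^sup>\<star> \<cdot> x w) \<and> (\<forall>w\<in>\<Omega> closure_of S. x w \<cdot> (x w)\<^sup>\<star> = \<iota> \<rho>\<^sub>0)"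
    have "w \<in> ?X closure_of S"
      using w sub by (simp add: closure_of_subtopology_open)
    then have "e w = (x w)\<^sup>\<star> \<cdot> x w"
    proof (rule forall_in_closure_of_eq)
      show "Hausdorff_space (arr_topology C \<rho> \<rho>)"
        using \<rho> by (simp add: Hausdorff_arr_topology)
      show "continuous_map ?X (arr_topology C \<rho> \<rho>) e"
        using ec by (rule continuous_map_from_subtopology)
      show "continuous_map ?X (arr_topology C \<rho> \<rho>) (\<lambda>w. (x w)\<^sup>\<star> \<cdot> x w)"
        by (intro continuous_cmp[OF \<rho> \<rho>\<^sub>0 \<rho> x] continuous_adj[OF \<rho> \<rho>\<^sub>0 x])
    qed (use tr in blast)
    moreover have "arr \<rho> \<rho>\<^sub>0 (x w)"
      using continuous_arrD[OF \<rho> \<rho>\<^sub>0 x] w top by blast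
    ultimately show "piso (\<rho>, e w) (full \<rho>\<^sub>0) (x w)"
      using piso_coisometry tr w by simp
  next
    assume "\<forall>w \<in> \<Omega> closure_of S. piso (\<rho>, e w) (full \<rho>\<^sub>0) (x w)"
    then have p: "\<And>w. w \<in> \<Omega> closure_of S \<Longrightarrow> piso (\<rho>, e w) (full \<rho>\<^sub>0) (x w)"
      by blast
    show "x w \<cdot> (x w)\<^sup>\<star> = \<iota> \<rho>\<^sub>0" if "w \<in> \<Omega> closure_of S" for w
      using piso_target[OF p[OF that]] by simp
    show "e w = (x w)\<^sup>\<star> \<cdot> x w" if "w \<in> S" for w
      using piso_source[OF p, of w] that closure_of_subset[OF openin_subset[OF S]] by auto
  qed
  have absorb: "topspace \<Omega> \<inter> \<Omega> closure_of S = \<Omega> closure_of S" for S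
    using closure_of_subset_topspace[of \<Omega> S] by blast
  have "(let D = function_category C (subtopology \<Omega> (\<Omega> closure_of U i))
       in v i \<in> Arr D \<rho> \<rho>\<^sub>0 \<and> (\<forall>w \<in> U i. e w = Cmp C (Star C (v i w)) (v i w)) \<and>
          Cmp D (v i) (Star D (v i)) = Ident D \<rho>\<^sub>0) \<longleftrightarrow>
      v i \<in> extensional (\<Omega> closure_of U i) \<and>
      continuous_map (subtopology \<Omega> (\<Omega> closure_of U i)) (arr_topology C \<rho> \<rho>\<^sub>0) (v i) \<and>
      (\<forall>w \<in> \<Omega> closure_of U i. piso (\<rho>, e w) (full \<rho>\<^sub>0) (v i w))"
    if "\<rho>\<^sub>0 \<in> Obj C" "openin \<Omega> (U i)" for i
    using key[OF that, of "v i"] by (auto simp: Let_def function_category_def absorb restrict_eq_iff)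
  then show ?thesis
    unfolding trivializations_def open_cover_def prod.case mem_Collect_eq by meson
qed

text \<open>
  On the open charts, where cocycles live, the closures can be forgotten.
\<close>

lemma trivialization_piso:
  assumes e: "(\<rho>, e) \<in> Obj (extension_category C \<Omega>)"
    and t: "(I, U, v) \<in> trivializations C \<Omega> (\<rho>, e) \<rho>\<^sub>0"
    and i: "i \<in> I"
  shows "w \<in> U i \<Longrightarrow> piso (\<rho>, e w) (full \<rho>\<^sub>0) (v i w)"
    and "openin \<Omega> (U i)"
    and "S \<subseteq> U i \<Longrightarrow> continuous_map (subtopology \<Omega> S) (arr_topology C \<rho> \<rho>\<^sub>0) (v i)"
proof -
  show U: "openin \<Omega> (U i)"
    using t i unfolding trivializations_iff[OF e] open_cover_def by blast
  have sub: "U i \<subseteq> \<Omega> closure_of U i"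
    using closure_of_subset[OF openin_subset[OF U]] .
  show "w \<in> U i \<Longrightarrow> piso (\<rho>, e w) (full \<rho>\<^sub>0) (v i w)"
    using t i sub unfolding trivializations_iff[OF e] by blast
  have "continuous_map (subtopology \<Omega> (\<Omega> closure_of U i)) (arr_topology C \<rho> \<rho>\<^sub>0) (v i)"
    using t i unfolding trivializations_iff[OF e] by blast
  then show "S \<subseteq> U i \<Longrightarrow> continuous_map (subtopology \<Omega> S) (arr_topology C \<rho> \<rho>\<^sub>0) (v i)"
    using sub by (blast intro: continuous_map_from_subtopology_mono)
qed

lemma trivialization_base:
  assumes e: "(\<rho>, e) \<in> Obj (extension_category C \<Omega>)"
    and t: "(I, U, v) \<in> trivializations C \<Omega> (\<rho>, e) \<rho>\<^sub>0"
  shows "\<rho>\<^sub>0 \<in> Obj C" and "open_cover \<Omega> I U"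
    and "w \<in> topspace \<Omega> \<Longrightarrow> \<exists>i \<in> I. w \<in> U i"
proof -
  show "\<rho>\<^sub>0 \<in> Obj C" and "open_cover \<Omega> I U"
    using t unfolding trivializations_iff[OF e] by blast+
  then show "w \<in> topspace \<Omega> \<Longrightarrow> \<exists>i \<in> I. w \<in> U i"
    unfolding open_cover_def by blast
qed

text \<open>
  With \<open>x = e\<close> this changes the model object; with \<open>y = 1\<close> it carries trivializations between unitarily
  equivalent objects of the extension category.
\<close>

lemma trivialization_transport:
  assumes e: "(\<rho>, e) \<in> Obj (extension_category C \<Omega>)" and f: "(\<sigma>, f) \<in> Obj (extension_category C \<Omega>)"
    and t: "(I, U, v) \<in> trivializations C \<Omega> (\<rho>, e) \<rho>\<^sub>0"
    and x: "continuous_map \<Omega> (arr_topology C \<sigma> \<rho>) x"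
      "\<And>w. w \<in> topspace \<Omega> \<Longrightarrow> piso (\<sigma>, f w) (\<rho>, e w) (x w)"
    and y: "piso (full \<rho>\<^sub>0) (full \<rho>\<^sub>1) y"
  shows "(I, U, \<lambda>i. \<lambda>w \<in> \<Omega> closure_of U i. y \<cdot> v i w \<cdot> x w) \<in> trivializations C \<Omega> (\<sigma>, f) \<rho>\<^sub>1"
proof -
  have o: "\<rho> \<in> Obj C" "\<sigma> \<in> Obj C" "\<rho>\<^sub>0 \<in> Obj C" "\<rho>\<^sub>1 \<in> Obj C"
    using e f t y by (auto simp: extension_object_iff trivializations_iff[OF e] arr_def dest: piso_arr)
  have "continuous_map (subtopology \<Omega> (\<Omega> closure_of U i)) (arr_topology C \<sigma> \<rho>\<^sub>1) (\<lambda>w. y \<cdot> v i w \<cdot> x w)"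
    if i: "i \<in> I" for i
  proof (intro continuous_cmp[OF o(2,3,4)] continuous_cmp[OF o(2,1,3)])
    show "continuous_map (subtopology \<Omega> (\<Omega> closure_of U i)) (arr_topology C \<rho>\<^sub>0 \<rho>\<^sub>1) (\<lambda>w. y)"
      using piso_arr[OF y] by (simp add: topspace_arr_topology arr_def)
    show "continuous_map (subtopology \<Omega> (\<Omega> closure_of U i)) (arr_topology C \<rho> \<rho>\<^sub>0) (v i)"
      using t i unfolding trivializations_iff[OF e] by blast
  qed (rule continuous_map_from_subtopology[OF x(1)])
  moreover have "piso (\<sigma>, f w) (full \<rho>\<^sub>1) (y \<cdot> v i w \<cdot> x w)" if "i \<in> I" "w \<in> \<Omega> closure_of U i" for i w
  proof (rule piso_cmp[OF piso_cmp[OF x(2)] y])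
    show "w \<in> topspace \<Omega>"
      using that closure_of_subset_topspace[of \<Omega> "U i"] by blast
    show "piso (\<rho>, e w) (full \<rho>\<^sub>0) (v i w)"
      using t that unfolding trivializations_iff[OF e] by blast
  qed
  moreover have "topspace (subtopology \<Omega> (\<Omega> closure_of U i)) = \<Omega> closure_of U i" for i
    by (rule topspace_subtopology_subset[OF closure_of_subset_topspace])
  ultimately show ?thesis
    using o trivialization_base(2)[OF e t] unfolding trivializations_iff[OF f]
    by (simp add: continuous_map_restrict_iff)
qed

end

section \<open>Existence of trivializations\<close>

context cstar_category
begin

text \<open>
  By \<open>piso_lift\<close> the set of points whose fibre is isomorphic to \<open>\<sigma>\<close> contains the \<open>1/2\<close>-neighbourhood of each of
  its points; as nearness is symmetric, so does its complement.
\<close>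

lemma fibres_isomorphic:
  assumes e: "(\<rho>, e) \<in> Obj (extension_category C \<Omega>)" and conn: "connected_space \<Omega>"
    and w0: "w0 \<in> topspace \<Omega>" "piso (\<rho>, e w0) (full \<sigma>) v0" and w: "w \<in> topspace \<Omega>"
  shows "\<exists>v. piso (\<rho>, e w) (full \<sigma>) v"
proof -
  have \<rho>: "\<rho> \<in> Obj C" and ec: "continuous_map \<Omega> (arr_topology C \<rho> \<rho>) e"
    and proj: "\<And>w. w \<in> topspace \<Omega> \<Longrightarrow> e w \<cdot> e w = e w \<and> (e w)\<^sup>\<star> = e w"
    using e by (auto simp: extension_object_iff)
  note ae = continuous_arrD[OF \<rho> \<rho> ec]
  define S where "S = {w \<in> topspace \<Omega>. \<exists>v. piso (\<rho>, e w) (full \<sigma>) v}"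
  define B where "B = (\<lambda>w. {w' \<in> topspace \<Omega>. Nrm C (e w \<ominus> e w') < 1/2})"
  have B_open: "openin \<Omega> (B w)" and B_self: "w \<in> B w" if "w \<in> topspace \<Omega>" for w
    unfolding B_def using openin_arr_ball(1)[OF \<rho> \<rho> ec, of "e w" "1/2"] ae[OF that] that
      diff_cancel_iff[OF ae[OF that] ae[OF that]]
    by (simp_all add: arr_def)
  have step: "w' \<in> S" if "w \<in> S" "w' \<in> topspace \<Omega>" "Nrm C (e w \<ominus> e w') < 1/2" for w w'
    using that piso_lift[of \<rho> "e w" \<sigma> _ "e w'"] ae[of w'] proj[of w'] unfolding S_def by fastforce
  have "openin \<Omega> S"
  proof (subst openin_subopen, intro ballI exI conjI)
    fix w assume w: "w \<in> S"
    then show "openin \<Omega> (B w)" "w \<in> B w"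
      using B_open B_self by (auto simp: S_def)
    show "B w \<subseteq> S"
      using step[OF w] by (auto simp: B_def)
  qed
  moreover have "openin \<Omega> (topspace \<Omega> - S)"
  proof (subst openin_subopen, intro ballI exI conjI)
    fix w assume w: "w \<in> topspace \<Omega> - S"
    then show "openin \<Omega> (B w)" "w \<in> B w"
      using B_open B_self by auto
    have "w' \<notin> S" if "w' \<in> B w" for w'
      using that w step[of w' w] norm_diff_commute[of \<rho> \<rho> "e w'" "e w"] ae by (auto simp: B_def)
    then show "B w \<subseteq> topspace \<Omega> - S"
      by (auto simp: B_def)
  qed
  moreover have "w0 \<in> S"
    using w0 by (auto simp: S_def)
  moreover have "S \<subseteq> topspace \<Omega>"
    by (auto simp: S_def)
  ultimately have "S = topspace \<Omega>"
    using conn unfolding connected_space_clopen_in closedin_def by blast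
  with w show ?thesis
    by (auto simp: S_def)
qed

text \<open>
  The chart at \<open>w\<close> is \<open>{w'. \<parallel>e w - e w'\<parallel> < 1/2}\<close>.  Its closure satisfies \<open>\<parallel>e w - e w'\<parallel> \<le> 1/2\<close>, where the
  polar part is still defined; this gives local isomorphisms that are continuous up to the boundary of the chart.
\<close>

lemma trivialization_exists:
  assumes sub: "closed_for_subobjects C" and comp: "compact_space \<Omega>" and conn: "connected_space \<Omega>"
    and ne: "topspace \<Omega> \<noteq> {}" and inf: "infinite (UNIV :: 'i set)"
    and e: "(\<rho>, e) \<in> Obj (extension_category C \<Omega>)"
  shows "\<exists>\<rho>\<^sub>0 \<in> Obj C. (trivializations C \<Omega> (\<rho>, e) \<rho>\<^sub>0 :: ('i, 'w, 'a) local_arrows set) \<noteq> {}"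
proof -
  have \<rho>: "\<rho> \<in> Obj C" and ec: "continuous_map \<Omega> (arr_topology C \<rho> \<rho>) e"
    and proj: "\<And>w. w \<in> topspace \<Omega> \<Longrightarrow> e w \<cdot> e w = e w \<and> (e w)\<^sup>\<star> = e w"
    using e by (auto simp: extension_object_iff)
  note ae = continuous_arrD[OF \<rho> \<rho> ec]
  obtain w0 where w0: "w0 \<in> topspace \<Omega>"
    using ne by blast
  have "is_projection C \<rho> (e w0)"
    using ae[OF w0] proj[OF w0] by (simp add: is_projection_def arr_def)
  then obtain \<rho>\<^sub>0 x where \<rho>\<^sub>0: "\<rho>\<^sub>0 \<in> Obj C" and x: "x \<in> Arr C \<rho>\<^sub>0 \<rho>" "x\<^sup>\<star> \<cdot> x = \<iota> \<rho>\<^sub>0" "x \<cdot> x\<^sup>\<star> = e w0"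
    using sub \<rho> unfolding closed_for_subobjects_def by blast
  have "arr \<rho>\<^sub>0 \<rho> x"
    using x \<rho> \<rho>\<^sub>0 by (simp add: arr_def)
  then have "piso (\<rho>, e w0) (full \<rho>\<^sub>0) (x\<^sup>\<star>)"
    using piso_adj[OF piso_isometry[of \<rho>\<^sub>0 \<rho> x]] x by simp
  then have "\<exists>v. piso (\<rho>, e w) (full \<rho>\<^sub>0) v" if "w \<in> topspace \<Omega>" for w
    using fibres_isomorphic[OF e conn w0 _ that] by blast
  then obtain V where V: "\<And>w. w \<in> topspace \<Omega> \<Longrightarrow> piso (\<rho>, e w) (full \<rho>\<^sub>0) (V w)"
    by metis
  define B where "B = (\<lambda>w. {w' \<in> topspace \<Omega>. Nrm C (e w \<ominus> e w') < 1/2})"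
  have B_open: "openin \<Omega> (B w)" and B_self: "w \<in> B w" if "w \<in> topspace \<Omega>" for w
    unfolding B_def using openin_arr_ball(1)[OF \<rho> \<rho> ec, of "e w" "1/2"] ae[OF that] that
      diff_cancel_iff[OF ae[OF that] ae[OF that]]
    by (simp_all add: arr_def)
  have B_closure: "Nrm C (e w \<ominus> e w') \<le> 1/2" if "w \<in> topspace \<Omega>" "w' \<in> \<Omega> closure_of B w" for w w'
  proof -
    have "closedin \<Omega> {w' \<in> topspace \<Omega>. Nrm C (e w \<ominus> e w') \<le> 1/2}"
      using openin_arr_ball(2)[OF \<rho> \<rho> ec, of "e w" "1/2"] ae[OF that(1)] by (simp add: arr_def)
    then have "\<Omega> closure_of B w \<subseteq> {w' \<in> topspace \<Omega>. Nrm C (e w \<ominus> e w') \<le> 1/2}"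
      by (rule closure_of_minimal[rotated]) (auto simp: B_def)
    with that show ?thesis
      by blast
  qed
  obtain \<F> where \<F>: "finite \<F>" "\<F> \<subseteq> B ` topspace \<Omega>" "topspace \<Omega> \<subseteq> \<Union>\<F>"
  proof -
    have "\<forall>U \<in> B ` topspace \<Omega>. openin \<Omega> U" "topspace \<Omega> \<subseteq> \<Union>(B ` topspace \<Omega>)"
      using B_open B_self by auto
    then show thesis
      using comp that unfolding compact_space_alt by meson
  qed
  \<comment> \<open>The infinite index type contains a copy of the finite subcover.\<close>
  obtain I :: "'i set" where I: "finite I" "card I = card \<F>"
    using infinite_arbitrarily_large[OF inf] by blast
  then obtain U where U: "bij_betw U I \<F>"
    using \<F>(1) finite_same_card_bij by blast
  then have "\<forall>i \<in> I. \<exists>w. w \<in> topspace \<Omega> \<and> U i = B w"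
    using \<F>(2) bij_betwE by blast
  then obtain c where c: "\<And>i. i \<in> I \<Longrightarrow> c i \<in> topspace \<Omega>" "\<And>i. i \<in> I \<Longrightarrow> U i = B (c i)"
    by metis
  have cover: "open_cover \<Omega> I U"
  proof -
    have "(\<Union>i\<in>I. U i) = \<Union>\<F>"
      using U by (simp add: bij_betw_def)
    moreover have "\<Union>\<F> \<subseteq> topspace \<Omega>"
      using \<F>(2) by (auto simp: B_def)
    ultimately show ?thesis
      using \<F>(3) c B_open by (auto simp: open_cover_def)
  qed
  let ?v = "\<lambda>i. \<lambda>w \<in> \<Omega> closure_of U i. lift \<rho>\<^sub>0 (V (c i)) (e (c i)) (e w)"
  have "continuous_map (subtopology \<Omega> (\<Omega> closure_of U i)) (arr_topology C \<rho> \<rho>\<^sub>0)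
      (\<lambda>w. lift \<rho>\<^sub>0 (V (c i)) (e (c i)) (e w))" if i: "i \<in> I" for i
    using B_closure[OF c(1)[OF i]] c(2)[OF i]
    by (intro continuous_lift[OF V[OF c(1)[OF i]]] continuous_map_from_subtopology[OF ec]) simp
  moreover have "piso (\<rho>, e w) (full \<rho>\<^sub>0) (lift \<rho>\<^sub>0 (V (c i)) (e (c i)) (e w))"
    if i: "i \<in> I" and w: "w \<in> \<Omega> closure_of U i" for i w
  proof -
    have w': "w \<in> topspace \<Omega>"
      using w closure_of_subset_topspace[of \<Omega> "U i"] by blast
    show ?thesis
      using V[OF c(1)[OF i]] ae[OF w'] proj[OF w'] B_closure[OF c(1)[OF i]] w c(2)[OF i]
      by (intro piso_lift) auto
  qed
  moreover have "topspace (subtopology \<Omega> (\<Omega> closure_of U i)) = \<Omega> closure_of U i" for i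
    by (rule topspace_subtopology_subset[OF closure_of_subset_topspace])
  ultimately have "(I, U, ?v) \<in> trivializations C \<Omega> (\<rho>, e) \<rho>\<^sub>0"
    using \<rho>\<^sub>0 cover unfolding trivializations_iff[OF e] by (simp add: continuous_map_restrict_iff)
  with \<rho>\<^sub>0 show ?thesis
    by blast
qed

end

section \<open>The class of an object\<close>

context cstar_category
begin

lemma transition_cocycle_mem:
  assumes e: "(\<rho>, e) \<in> Obj (extension_category C \<Omega>)"
    and t: "t \<in> trivializations C \<Omega> (\<rho>, e) \<rho>\<^sub>0"
  shows "transition_cocycle C t \<in> cocycles \<Omega> (unitary_group C \<rho>\<^sub>0) (unitary_topology C \<rho>\<^sub>0)"
proof -
  obtain I U v where t_eq: "t = (I, U, v)"
    by (rule prod_cases3)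
  note t' = t[unfolded t_eq]
  note tp = trivialization_piso[OF e t'] and tb = trivialization_base[OF e t']
  have \<rho>: "\<rho> \<in> Obj C"
    using e by (simp add: extension_object_iff)
  have "continuous_map (subtopology \<Omega> (U i \<inter> U j)) (unitary_topology C \<rho>\<^sub>0) (\<lambda>w. v i w \<cdot> (v j w)\<^sup>\<star>)"
    if ij: "i \<in> I" "j \<in> I" for i j
    unfolding unitary_topology_continuous_iff[OF tb(1)]
    using ij by (auto intro!: continuous_cmp[OF tb(1) \<rho> tb(1)] continuous_adj[OF \<rho> tb(1)] tp(3)
        piso_cmp[OF piso_adj[OF tp(1)] tp(1)])
  moreover have "(v i w \<cdot> (v j w)\<^sup>\<star>) \<cdot> v j w \<cdot> (v k w)\<^sup>\<star> = v i w \<cdot> (v k w)\<^sup>\<star>"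
    if I: "i \<in> I" "j \<in> I" "k \<in> I" and w: "w \<in> U i" "w \<in> U j" "w \<in> U k" for i j k w
  proof -
    note vi = tp(1)[OF I(1) w(1)] and vj = tp(1)[OF I(2) w(2)] and vk = tp(1)[OF I(3) w(3)]
    show ?thesis
      using piso_assoc[OF piso_cmp[OF piso_adj[OF vk] vj] piso_adj[OF vj] vi]
        piso_cancel[OF vj piso_adj[OF vk]] by simp
  qed
  ultimately show ?thesis
    using tb(2) by (simp add: t_eq transition_cocycle_def cocycles_def unitary_group_def)
qed

text \<open>
  The relating unitaries are \<open>v i w (v' l w)\<^sup>\<star>\<close>:
  in \<open>(v i w (v' l w)\<^sup>\<star>) (v' l w (v' m w)\<^sup>\<star>) (v' m w (v j w)\<^sup>\<star>)\<close> everything between the outer factors cancels.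
\<close>

lemma transition_cocycles_related:
  assumes e: "(\<rho>, e) \<in> Obj (extension_category C \<Omega>)"
    and t: "t \<in> trivializations C \<Omega> (\<rho>, e) \<rho>\<^sub>0" and t': "t' \<in> trivializations C \<Omega> (\<rho>, e) \<rho>\<^sub>0"
  shows "(transition_cocycle C t, transition_cocycle C t')
    \<in> cocycle_rel \<Omega> (unitary_group C \<rho>\<^sub>0) (unitary_topology C \<rho>\<^sub>0)"
proof -
  obtain I U v I' U' v' where eq: "t = (I, U, v)" "t' = (I', U', v')"
    by (metis prod_cases3)
  note tp = trivialization_piso[OF e t[unfolded eq]] and tb = trivialization_base[OF e t[unfolded eq]]
  note tp' = trivialization_piso[OF e t'[unfolded eq]]
  note \<rho>\<^sub>0 = tb(1)
  have \<rho>: "\<rho> \<in> Obj C"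
    using e by (simp add: extension_object_iff)
  interpret G: topological_group "unitary_group C \<rho>\<^sub>0" "unitary_topology C \<rho>\<^sub>0"
    using \<rho>\<^sub>0 by (rule topological_group_unitary)
  let ?u = "\<lambda>i l w. v i w \<cdot> (v' l w)\<^sup>\<star>"
  have "continuous_map (subtopology \<Omega> (U i \<inter> U' l)) (unitary_topology C \<rho>\<^sub>0) (?u i l)"
    if il: "i \<in> I" "l \<in> I'" for i l
    unfolding unitary_topology_continuous_iff[OF \<rho>\<^sub>0]
    using il by (auto intro!: continuous_cmp[OF \<rho>\<^sub>0 \<rho> \<rho>\<^sub>0] continuous_adj[OF \<rho> \<rho>\<^sub>0] tp(3) tp'(3)
        piso_cmp[OF piso_adj[OF tp'(1)] tp(1)])
  moreover have "v i w \<cdot> (v j w)\<^sup>\<star> = ?u i l w \<otimes>\<^bsub>unitary_group C \<rho>\<^sub>0\<^esub> (v' l w \<cdot> (v' m w)\<^sup>\<star>)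
      \<otimes>\<^bsub>unitary_group C \<rho>\<^sub>0\<^esub> inv\<^bsub>unitary_group C \<rho>\<^sub>0\<^esub> (?u j m w)"
    if I: "i \<in> I" "j \<in> I" "l \<in> I'" "m \<in> I'" and w: "w \<in> U i" "w \<in> U j" "w \<in> U' l" "w \<in> U' m"
    for i j l m w
  proof -
    note vi = tp(1)[OF I(1) w(1)] and vj = tp(1)[OF I(2) w(2)]
    note vl = tp'(1)[OF I(3) w(3)] and vm = tp'(1)[OF I(4) w(4)]
    note vjs = piso_adj[OF vj] and vls = piso_adj[OF vl] and vms = piso_adj[OF vm]
    have "inv\<^bsub>unitary_group C \<rho>\<^sub>0\<^esub> (?u j m w) = v' m w \<cdot> (v j w)\<^sup>\<star>"
      using inv_unitary_group[OF \<rho>\<^sub>0 piso_cmp[OF vms vj]] piso_adj_cmp[OF vms vj] piso_adj_adj[OF vm]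
      by simp
    then have "?u i l w \<otimes>\<^bsub>unitary_group C \<rho>\<^sub>0\<^esub> (v' l w \<cdot> (v' m w)\<^sup>\<star>)
        \<otimes>\<^bsub>unitary_group C \<rho>\<^sub>0\<^esub> inv\<^bsub>unitary_group C \<rho>\<^sub>0\<^esub> (?u j m w)
        = (?u i l w \<cdot> v' l w \<cdot> (v' m w)\<^sup>\<star>) \<cdot> v' m w \<cdot> (v j w)\<^sup>\<star>"
      by (simp add: unitary_group_def)
    also have "?u i l w \<cdot> v' l w \<cdot> (v' m w)\<^sup>\<star> = v i w \<cdot> (v' m w)\<^sup>\<star>"
      using piso_assoc[OF piso_cmp[OF vms vl] vls vi] piso_cancel[OF vl vms] by simp
    also have "(v i w \<cdot> (v' m w)\<^sup>\<star>) \<cdot> v' m w \<cdot> (v j w)\<^sup>\<star> = v i w \<cdot> (v j w)\<^sup>\<star>"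
      using piso_assoc[OF piso_cmp[OF vjs vm] vms vi] piso_cancel[OF vm vjs] by simp
    finally show ?thesis ..
  qed
  ultimately show ?thesis
    using transition_cocycle_mem[OF e t] transition_cocycle_mem[OF e t']
    unfolding eq transition_cocycle_def prod.case G.cocycle_rel_iff
    by (intro conjI exI[of _ ?u] ballI) blast+
qed

lemma delta_eq:
  fixes t :: "('i, 'w, 'a) local_arrows"
  assumes e: "(\<rho>, e) \<in> Obj (extension_category C \<Omega>)"
    and t: "t \<in> trivializations C \<Omega> (\<rho>, e) \<rho>\<^sub>0"
  shows "delta C \<Omega> \<rho>\<^sub>0 (\<rho>, e)
    = cocycle_class \<Omega> (unitary_group C \<rho>\<^sub>0) (unitary_topology C \<rho>\<^sub>0) (transition_cocycle C t)"
proof -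
  obtain I U v where t_eq: "t = (I, U, v)"
    by (rule prod_cases3)
  interpret G: topological_group "unitary_group C \<rho>\<^sub>0" "unitary_topology C \<rho>\<^sub>0"
    using trivialization_base(1)[OF e t[unfolded t_eq]] by (rule topological_group_unitary)
  show ?thesis
    unfolding delta_def
  proof (rule the_equality)
    fix c :: "('i, 'w, 'a) cocycle set"
    assume "\<exists>t' \<in> trivializations C \<Omega> (\<rho>, e) \<rho>\<^sub>0.
      c = cocycle_class \<Omega> (unitary_group C \<rho>\<^sub>0) (unitary_topology C \<rho>\<^sub>0) (transition_cocycle C t')"
    then obtain t' where t': "t' \<in> trivializations C \<Omega> (\<rho>, e) \<rho>\<^sub>0"
      and c: "c = cocycle_class \<Omega> (unitary_group C \<rho>\<^sub>0) (unitary_topology C \<rho>\<^sub>0) (transition_cocycle C t')"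
      by blast
    show "c = cocycle_class \<Omega> (unitary_group C \<rho>\<^sub>0) (unitary_topology C \<rho>\<^sub>0) (transition_cocycle C t)"
      unfolding c G.cocycle_class_eq_iff[OF transition_cocycle_mem[OF e t'] transition_cocycle_mem[OF e t]]
      using transition_cocycles_related[OF e t' t] .
  qed (use t in blast)
qed

text \<open>
  Over a single point, two trivializations \<open>v\<close> and \<open>v'\<close> give the unitary \<open>v' v\<^sup>\<star>\<close> between the model objects;
  conversely a unitary of model objects can be composed with a trivialization.
\<close>

lemma trivializations_unitarily_equivalent_iff:
  fixes t :: "('i, 'w, 'a) local_arrows"
  assumes e: "(\<rho>, e) \<in> Obj (extension_category C \<Omega>)"
    and t: "t \<in> trivializations C \<Omega> (\<rho>, e) \<rho>\<^sub>0"
    and \<rho>\<^sub>1: "\<rho>\<^sub>1 \<in> Obj C" and ne: "topspace \<Omega> \<noteq> {}"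
  shows "(trivializations C \<Omega> (\<rho>, e) \<rho>\<^sub>1 :: ('i, 'w, 'a) local_arrows set) \<noteq> {} \<longleftrightarrow>
    unitarily_equivalent C \<rho>\<^sub>0 \<rho>\<^sub>1"
proof -
  obtain I U v where t_eq: "t = (I, U, v)"
    by (rule prod_cases3)
  note t = t[unfolded t_eq]
  have \<rho>\<^sub>0: "\<rho>\<^sub>0 \<in> Obj C"
    using trivialization_base(1)[OF e t] .
  have ue: "unitarily_equivalent C \<rho>\<^sub>0 \<rho>\<^sub>1 \<longleftrightarrow> (\<exists>u. piso (full \<rho>\<^sub>0) (full \<rho>\<^sub>1) u)"
    using \<rho>\<^sub>0 \<rho>\<^sub>1 by (auto simp: unitarily_equivalent_def piso_def arr_def cmp_ident_right)
  show ?thesis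
    unfolding ue
  proof
    assume "(trivializations C \<Omega> (\<rho>, e) \<rho>\<^sub>1 :: ('i, 'w, 'a) local_arrows set) \<noteq> {}"
    then obtain I' :: "'i set" and U' v' where t': "(I', U', v') \<in> trivializations C \<Omega> (\<rho>, e) \<rho>\<^sub>1"
      by (metis ex_in_conv prod_cases3)
    obtain w where w: "w \<in> topspace \<Omega>"
      using ne by blast
    obtain i l where i: "i \<in> I" "w \<in> U i" and l: "l \<in> I'" "w \<in> U' l"
      using trivialization_base(3)[OF e t w] trivialization_base(3)[OF e t' w] by blast
    have "piso (full \<rho>\<^sub>0) (full \<rho>\<^sub>1) (v' l w \<cdot> (v i w)\<^sup>\<star>)"
      by (rule piso_cmp[OF piso_adj[OF trivialization_piso(1)[OF e t i]] trivialization_piso(1)[OF e t' l]])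
    then show "\<exists>u. piso (full \<rho>\<^sub>0) (full \<rho>\<^sub>1) u" ..
  next
    assume "\<exists>u. piso (full \<rho>\<^sub>0) (full \<rho>\<^sub>1) u"
    then obtain u where u: "piso (full \<rho>\<^sub>0) (full \<rho>\<^sub>1) u" ..
    have "piso (\<rho>, e w) (\<rho>, e w) (e w)" if "w \<in> topspace \<Omega>" for w
      using e that continuous_arrD[of \<rho> \<rho> \<Omega> e w] by (simp add: extension_object_iff piso_def)
    moreover have "continuous_map \<Omega> (arr_topology C \<rho> \<rho>) e"
      using e by (simp add: extension_object_iff)
    ultimately show "(trivializations C \<Omega> (\<rho>, e) \<rho>\<^sub>1 :: ('i, 'w, 'a) local_arrows set) \<noteq> {}"
      using trivialization_transport[OF e e t _ _ u] by blast
  qed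
qed

text \<open>
  If \<open>u\<close> is a unitary field from \<open>e\<close> to \<open>f\<close>, then the \<open>v i w (u w)\<^sup>\<star>\<close> trivialize \<open>f\<close>, and \<open>u\<close> cancels from their
  transition functions.
\<close>

lemma delta_unitary_invariant:
  fixes t :: "('i, 'w, 'a) local_arrows"
  assumes e: "(\<rho>, e) \<in> Obj (extension_category C \<Omega>)" and f: "(\<sigma>, f) \<in> Obj (extension_category C \<Omega>)"
    and eq: "unitarily_equivalent (extension_category C \<Omega>) (\<rho>, e) (\<sigma>, f)"
    and t: "t \<in> trivializations C \<Omega> (\<rho>, e) \<rho>\<^sub>0"
  shows "(trivializations C \<Omega> (\<sigma>, f) \<rho>\<^sub>0 :: ('i, 'w, 'a) local_arrows set) \<noteq> {}"
    and "(delta C \<Omega> \<rho>\<^sub>0 (\<rho>, e) :: ('i, 'w, 'a) cocycle set) = delta C \<Omega> \<rho>\<^sub>0 (\<sigma>, f)"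
proof -
  obtain I U v where t_eq: "t = (I, U, v)"
    by (rule prod_cases3)
  note t = t[unfolded t_eq]
  note tp = trivialization_piso[OF e t]
  have o: "\<rho> \<in> Obj C" "\<sigma> \<in> Obj C" "\<rho>\<^sub>0 \<in> Obj C"
    using e f trivialization_base(1)[OF e t] by (auto simp: extension_object_iff)
  interpret G: topological_group "unitary_group C \<rho>\<^sub>0" "unitary_topology C \<rho>\<^sub>0"
    using o(3) by (rule topological_group_unitary)
  obtain u where u: "continuous_map \<Omega> (arr_topology C \<rho> \<sigma>) u"
    and up: "\<And>w. w \<in> topspace \<Omega> \<Longrightarrow> piso (\<rho>, e w) (\<sigma>, f w) (u w)"
    using eq unfolding extension_unitary_iff[OF e f] by blast
  \<comment> \<open>The model object stays the same, so the left factor in the transport is its identity.\<close>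
  have one: "piso (full \<rho>\<^sub>0) (full \<rho>\<^sub>0) (\<iota> \<rho>\<^sub>0)"
    using arr_ident[OF o(3)] o(3) by (simp add: piso_def adj_ident ident_right)
  define v' where "v' = (\<lambda>i. \<lambda>w \<in> \<Omega> closure_of U i. \<iota> \<rho>\<^sub>0 \<cdot> v i w \<cdot> (u w)\<^sup>\<star>)"
  have t': "(I, U, v') \<in> trivializations C \<Omega> (\<sigma>, f) \<rho>\<^sub>0"
    unfolding v'_def
    by (rule trivialization_transport[OF e f t continuous_adj[OF o(1,2) u] piso_adj[OF up] one])
  then show "(trivializations C \<Omega> (\<sigma>, f) \<rho>\<^sub>0 :: ('i, 'w, 'a) local_arrows set) \<noteq> {}"
    by blast
  have v': "v' i w = v i w \<cdot> (u w)\<^sup>\<star>" if i: "i \<in> I" "w \<in> U i" for i w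
  proof -
    have "w \<in> topspace \<Omega>" "w \<in> \<Omega> closure_of U i"
      using i openin_subset[OF tp(2)[OF i(1)]] closure_of_subset[of "U i" \<Omega>] by blast+
    then show ?thesis
      using piso_ident_left[OF piso_cmp[OF piso_adj[OF up] tp(1)[OF i]]] by (simp add: v'_def)
  qed
  have "((I, U, \<lambda>i j w. v i w \<cdot> (v j w)\<^sup>\<star>), (I, U, \<lambda>i j w. v' i w \<cdot> (v' j w)\<^sup>\<star>))
      \<in> cocycle_rel \<Omega> (unitary_group C \<rho>\<^sub>0) (unitary_topology C \<rho>\<^sub>0)"
  proof (rule G.cocycle_rel_cong)
    show "(I, U, \<lambda>i j w. v i w \<cdot> (v j w)\<^sup>\<star>) \<in> cocycles \<Omega> (unitary_group C \<rho>\<^sub>0) (unitary_topology C \<rho>\<^sub>0)"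
      "(I, U, \<lambda>i j w. v' i w \<cdot> (v' j w)\<^sup>\<star>) \<in> cocycles \<Omega> (unitary_group C \<rho>\<^sub>0) (unitary_topology C \<rho>\<^sub>0)"
      using transition_cocycle_mem[OF e t] transition_cocycle_mem[OF f t']
      by (simp_all add: transition_cocycle_def)
    fix i j w assume i: "i \<in> I" "w \<in> U i" and j: "j \<in> I" "w \<in> U j"
    have "w \<in> topspace \<Omega>"
      using i openin_subset[OF tp(2)[OF i(1)]] by blast
    note uw = up[OF this] and vi = tp(1)[OF i] and vj = tp(1)[OF j]
    note us = piso_adj[OF uw] and vjs = piso_adj[OF vj]
    have "v' i w \<cdot> (v' j w)\<^sup>\<star> = (v i w \<cdot> (u w)\<^sup>\<star>) \<cdot> u w \<cdot> (v j w)\<^sup>\<star>"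
      using piso_adj_cmp[OF us vj] piso_adj_adj[OF uw] by (simp add: v'[OF i] v'[OF j])
    also have "\<dots> = v i w \<cdot> (v j w)\<^sup>\<star>"
      using piso_assoc[OF piso_cmp[OF vjs uw] us vi] piso_cancel[OF uw vjs] by simp
    finally show "v' i w \<cdot> (v' j w)\<^sup>\<star> = v i w \<cdot> (v j w)\<^sup>\<star>" .
  qed
  then show "(delta C \<Omega> \<rho>\<^sub>0 (\<rho>, e) :: ('i, 'w, 'a) cocycle set) = delta C \<Omega> \<rho>\<^sub>0 (\<sigma>, f)"
    unfolding delta_eq[OF e t] delta_eq[OF f t']
    using G.cocycle_class_eq_iff[OF transition_cocycle_mem[OF e t] transition_cocycle_mem[OF f t']]
    by (simp add: transition_cocycle_def)
qed

text \<open>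
  If \<open>u\<close> relates the cocycles, the local isomorphisms \<open>(v' l w)\<^sup>\<star> (u i l w)\<^sup>\<star> v i w\<close> from \<open>e w\<close> to \<open>f w\<close> do not depend on
  \<open>(i, l)\<close>: substituting the relation into \<open>v i w = (v i w (v j w)\<^sup>\<star>) v j w\<close> and cancelling turns the expression for
  \<open>(i, l)\<close> into that for \<open>(j, m)\<close>.
\<close>

lemma unitarily_equivalent_if_cocycles_related:
  assumes e: "(\<rho>, e) \<in> Obj (extension_category C \<Omega>)" and f: "(\<sigma>, f) \<in> Obj (extension_category C \<Omega>)"
    and t: "t \<in> trivializations C \<Omega> (\<rho>, e) \<rho>\<^sub>0" and t': "t' \<in> trivializations C \<Omega> (\<sigma>, f) \<rho>\<^sub>0"
    and rel: "(transition_cocycle C t, transition_cocycle C t')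
      \<in> cocycle_rel \<Omega> (unitary_group C \<rho>\<^sub>0) (unitary_topology C \<rho>\<^sub>0)"
  shows "unitarily_equivalent (extension_category C \<Omega>) (\<rho>, e) (\<sigma>, f)"
proof -
  obtain I U v I' U' v' where eq: "t = (I, U, v)" "t' = (I', U', v')"
    by (metis prod_cases3)
  note tp = trivialization_piso[OF e t[unfolded eq]] and tb = trivialization_base[OF e t[unfolded eq]]
  note tp' = trivialization_piso[OF f t'[unfolded eq]] and tb' = trivialization_base[OF f t'[unfolded eq]]
  note \<rho>\<^sub>0 = tb(1)
  have o: "\<rho> \<in> Obj C" "\<sigma> \<in> Obj C"
    using e f by (auto simp: extension_object_iff)
  interpret G: topological_group "unitary_group C \<rho>\<^sub>0" "unitary_topology C \<rho>\<^sub>0"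
    using \<rho>\<^sub>0 by (rule topological_group_unitary)
  obtain u where u: "\<And>i l. i \<in> I \<Longrightarrow> l \<in> I' \<Longrightarrow>
      continuous_map (subtopology \<Omega> (U i \<inter> U' l)) (unitary_topology C \<rho>\<^sub>0) (u i l)"
    and coh: "\<And>i j l m w. i \<in> I \<Longrightarrow> j \<in> I \<Longrightarrow> l \<in> I' \<Longrightarrow> m \<in> I' \<Longrightarrow> w \<in> U i \<inter> U j \<inter> U' l \<inter> U' m \<Longrightarrow>
      v i w \<cdot> (v j w)\<^sup>\<star> = u i l w \<otimes>\<^bsub>unitary_group C \<rho>\<^sub>0\<^esub> (v' l w \<cdot> (v' m w)\<^sup>\<star>)
        \<otimes>\<^bsub>unitary_group C \<rho>\<^sub>0\<^esub> inv\<^bsub>unitary_group C \<rho>\<^sub>0\<^esub> (u j m w)"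
    using rel unfolding eq transition_cocycle_def prod.case G.cocycle_rel_iff by blast
  have up: "piso (full \<rho>\<^sub>0) (full \<rho>\<^sub>0) (u i l w)" if "i \<in> I" "l \<in> I'" "w \<in> U i" "w \<in> U' l" for i l w
    using u[OF that(1,2)] that(3,4) openin_subset[OF tp(2)[OF that(1)]]
    unfolding unitary_topology_continuous_iff[OF \<rho>\<^sub>0] by auto
  let ?x = "\<lambda>(i, l) w. (v' l w)\<^sup>\<star> \<cdot> (u i l w)\<^sup>\<star> \<cdot> v i w"
  let ?K = "I \<times> I'" and ?W = "\<lambda>(i, l). U i \<inter> U' l"
  have xp: "piso (\<rho>, e w) (\<sigma>, f w) (?x k w)" if kw: "k \<in> ?K" "w \<in> ?W k" for k w
  proof -
    obtain i l where k: "k = (i, l)" "i \<in> I" "l \<in> I'" "w \<in> U i" "w \<in> U' l"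
      using kw by (cases k) auto
    show ?thesis
      unfolding k(1) prod.case
      by (intro piso_cmp[OF piso_cmp[OF tp(1)[OF k(2,4)] piso_adj[OF up[OF k(2-5)]]] piso_adj[OF tp'(1)[OF k(3,5)]]])
  qed
  have agree: "?x k w = ?x k' w" if k: "k \<in> ?K" "w \<in> ?W k" and k': "k' \<in> ?K" "w \<in> ?W k'" for k k' w
  proof -
    obtain i l where il: "k = (i, l)" "i \<in> I" "l \<in> I'" "w \<in> U i" "w \<in> U' l"
      using k by (cases k) auto
    obtain j m where jm: "k' = (j, m)" "j \<in> I" "m \<in> I'" "w \<in> U j" "w \<in> U' m"
      using k' by (cases k') auto
    note vi = tp(1)[OF il(2,4)] and vj = tp(1)[OF jm(2,4)]
    note vl = tp'(1)[OF il(3,5)] and vm = tp'(1)[OF jm(3,5)]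
    note ul = up[OF il(2-5)] and um = up[OF jm(2-5)]
    note uls = piso_adj[OF ul] and ums = piso_adj[OF um] and vls = piso_adj[OF vl] and vms = piso_adj[OF vm]
    note y = piso_cmp[OF vj ums]
    \<comment> \<open>Express \<open>v i w\<close> through \<open>v j w\<close> and replace the transition function by the one of \<open>f\<close>.\<close>
    have "v i w = (v i w \<cdot> (v j w)\<^sup>\<star>) \<cdot> v j w"
      using piso_assoc[OF vj piso_adj[OF vj] vi] piso_source[OF vj] piso_ident_right[OF vi] by simp
    also have "v i w \<cdot> (v j w)\<^sup>\<star> = (u i l w \<cdot> v' l w \<cdot> (v' m w)\<^sup>\<star>) \<cdot> (u j m w)\<^sup>\<star>"
      using coh[of i j l m w] il jm inv_unitary_group[OF \<rho>\<^sub>0 um] by (simp add: unitary_group_def)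
    also have "\<dots> \<cdot> v j w = (u i l w \<cdot> v' l w \<cdot> (v' m w)\<^sup>\<star>) \<cdot> (u j m w)\<^sup>\<star> \<cdot> v j w"
      using piso_assoc[OF vj ums piso_cmp[OF piso_cmp[OF vms vl] ul]] .
    also have "\<dots> = u i l w \<cdot> (v' l w \<cdot> (v' m w)\<^sup>\<star>) \<cdot> (u j m w)\<^sup>\<star> \<cdot> v j w"
      using piso_assoc[OF y piso_cmp[OF vms vl] ul] .
    also have "\<dots> = u i l w \<cdot> v' l w \<cdot> (v' m w)\<^sup>\<star> \<cdot> (u j m w)\<^sup>\<star> \<cdot> v j w"
      using piso_assoc[OF y vms vl] by simp
    finally have "(u i l w)\<^sup>\<star> \<cdot> v i w = v' l w \<cdot> (v' m w)\<^sup>\<star> \<cdot> (u j m w)\<^sup>\<star> \<cdot> v j w"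
      using piso_cancel[OF ul piso_cmp[OF piso_cmp[OF y vms] vl]] by simp
    then show ?thesis
      using piso_cancel[OF vl piso_cmp[OF y vms]] by (simp add: il(1) jm(1))
  qed
  have W_sub: "?W k \<subseteq> topspace \<Omega>" if "k \<in> ?K" for k
    using that openin_subset[OF tp(2)] by fastforce
  obtain x where x: "continuous_map \<Omega> (arr_topology C \<rho> \<sigma>) x"
    and x_eq: "\<And>w k. k \<in> ?K \<Longrightarrow> w \<in> topspace \<Omega> \<inter> ?W k \<Longrightarrow> x w = ?x k w"
  proof (rule pasting_lemma_exists[where X = \<Omega> and I = ?K and T = ?W and Y = "arr_topology C \<rho> \<sigma>" and f = ?x])
    show "topspace \<Omega> \<subseteq> (\<Union>k\<in>?K. ?W k)"
      using tb(3) tb'(3) by fastforce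
    fix k assume "k \<in> ?K"
    then obtain i l where k: "k = (i, l)" "i \<in> I" "l \<in> I'"
      by auto
    show "openin \<Omega> (?W k)"
      using k tp(2) tp'(2) by auto
    have "continuous_map (subtopology \<Omega> (U i \<inter> U' l)) (arr_topology C \<rho>\<^sub>0 \<rho>\<^sub>0) (u i l)"
      using u k unfolding unitary_topology_continuous_iff[OF \<rho>\<^sub>0] by blast
    then show "continuous_map (subtopology \<Omega> (?W k)) (arr_topology C \<rho> \<sigma>) (?x k)"
      unfolding k(1) prod.case
      by (intro continuous_cmp[OF o(1) \<rho>\<^sub>0 o(2)] continuous_cmp[OF o(1) \<rho>\<^sub>0 \<rho>\<^sub>0]
          continuous_adj[OF o(2) \<rho>\<^sub>0] continuous_adj[OF \<rho>\<^sub>0 \<rho>\<^sub>0] tp(3)[OF k(2)] tp'(3)[OF k(3)]) auto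
  next
    fix k k' w assume "k \<in> ?K" "k' \<in> ?K" "w \<in> topspace \<Omega> \<inter> ?W k \<inter> ?W k'"
    then show "?x k w = ?x k' w"
      by (intro agree) blast+
  qed blast
  have "piso (\<rho>, e w) (\<sigma>, f w) (x w)" if w: "w \<in> topspace \<Omega>" for w
  proof -
    obtain i l where "i \<in> I" "l \<in> I'" "w \<in> U i" "w \<in> U' l"
      using tb(3)[OF w] tb'(3)[OF w] by blast
    then show ?thesis
      using xp[of "(i, l)" w] x_eq[of "(i, l)" w] w by simp
  qed
  with x show ?thesis
    unfolding extension_unitary_iff[OF e f] by blast
qed

end

theorem proposition3p11:
  fixes C :: "('o, 'a) cstar_cat" and \<Omega> :: "'w topology"
  assumes "cstar_category C"
    and "closed_for_subobjects C"
    and "compact_space \<Omega>" and "Hausdorff_space \<Omega>"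
    and "connected_space \<Omega>" and "topspace \<Omega> \<noteq> {}"
    and "infinite (UNIV :: 'i set)"
  shows
    "(\<forall>e \<in> Obj (extension_category C \<Omega>).
        (\<exists>\<rho>\<^sub>0 \<in> Obj C. (trivializations C \<Omega> e \<rho>\<^sub>0 :: ('i, 'w, 'a) local_arrows set) \<noteq> {}) \<and>
        (\<forall>\<rho>\<^sub>0 \<in> Obj C. (trivializations C \<Omega> e \<rho>\<^sub>0 :: ('i, 'w, 'a) local_arrows set) \<noteq> {} \<longrightarrow>
           (\<forall>\<rho>\<^sub>1 \<in> Obj C.
              (trivializations C \<Omega> e \<rho>\<^sub>1 :: ('i, 'w, 'a) local_arrows set) \<noteq> {} \<longleftrightarrow>
              unitarily_equivalent C \<rho>\<^sub>0 \<rho>\<^sub>1) \<and>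
           (delta C \<Omega> \<rho>\<^sub>0 e :: ('i, 'w, 'a) cocycle set)
              \<in> H1 \<Omega> (unitary_group C \<rho>\<^sub>0) (unitary_topology C \<rho>\<^sub>0) \<and>
           (\<forall>t \<in> (trivializations C \<Omega> e \<rho>\<^sub>0 :: ('i, 'w, 'a) local_arrows set).
              transition_cocycle C t
                \<in> cocycles \<Omega> (unitary_group C \<rho>\<^sub>0) (unitary_topology C \<rho>\<^sub>0) \<and>
              delta C \<Omega> \<rho>\<^sub>0 e =
                cocycle_class \<Omega> (unitary_group C \<rho>\<^sub>0) (unitary_topology C \<rho>\<^sub>0)
                  (transition_cocycle C t)))) \<and>
     (\<forall>e \<in> Obj (extension_category C \<Omega>). \<forall>f \<in> Obj (extension_category C \<Omega>).
        unitarily_equivalent (extension_category C \<Omega>) e f \<longleftrightarrow>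
        (\<exists>\<rho>\<^sub>0 \<in> Obj C.
           (trivializations C \<Omega> e \<rho>\<^sub>0 :: ('i, 'w, 'a) local_arrows set) \<noteq> {} \<and>
           (trivializations C \<Omega> f \<rho>\<^sub>0 :: ('i, 'w, 'a) local_arrows set) \<noteq> {} \<and>
           (delta C \<Omega> \<rho>\<^sub>0 e :: ('i, 'w, 'a) cocycle set) = delta C \<Omega> \<rho>\<^sub>0 f))"
proof -
  interpret cstar_category C
    by fact
  note triv_exists = trivialization_exists[OF assms(2,3,5,6,7)]
  show ?thesis
  proof (intro conjI ballI impI)
    fix E assume E: "E \<in> Obj (extension_category C \<Omega>)"
    obtain \<rho> e where E_eq: "E = (\<rho>, e)"
      by (cases E)
    note e = E[unfolded E_eq]
    show "\<exists>\<rho>\<^sub>0 \<in> Obj C. (trivializations C \<Omega> E \<rho>\<^sub>0 :: ('i, 'w, 'a) local_arrows set) \<noteq> {}"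
      unfolding E_eq using triv_exists[OF e] .
    fix \<rho>\<^sub>0 assume "\<rho>\<^sub>0 \<in> Obj C"
      and "(trivializations C \<Omega> E \<rho>\<^sub>0 :: ('i, 'w, 'a) local_arrows set) \<noteq> {}"
    then obtain t :: "('i, 'w, 'a) local_arrows" where t: "t \<in> trivializations C \<Omega> (\<rho>, e) \<rho>\<^sub>0"
      unfolding E_eq by blast
    show "(trivializations C \<Omega> E \<rho>\<^sub>1 :: ('i, 'w, 'a) local_arrows set) \<noteq> {} \<longleftrightarrow>
        unitarily_equivalent C \<rho>\<^sub>0 \<rho>\<^sub>1" if "\<rho>\<^sub>1 \<in> Obj C" for \<rho>\<^sub>1
      unfolding E_eq using trivializations_unitarily_equivalent_iff[OF e t that assms(6)] .
    show "(delta C \<Omega> \<rho>\<^sub>0 E :: ('i, 'w, 'a) cocycle set)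
        \<in> H1 \<Omega> (unitary_group C \<rho>\<^sub>0) (unitary_topology C \<rho>\<^sub>0)"
      unfolding E_eq delta_eq[OF e t] H1_def cocycle_class_def
      using transition_cocycle_mem[OF e t] by (rule quotientI)
    fix s :: "('i, 'w, 'a) local_arrows" assume "s \<in> trivializations C \<Omega> E \<rho>\<^sub>0"
    then have s: "s \<in> trivializations C \<Omega> (\<rho>, e) \<rho>\<^sub>0"
      unfolding E_eq .
    show "transition_cocycle C s \<in> cocycles \<Omega> (unitary_group C \<rho>\<^sub>0) (unitary_topology C \<rho>\<^sub>0)"
      using transition_cocycle_mem[OF e s] .
    show "delta C \<Omega> \<rho>\<^sub>0 E =
        cocycle_class \<Omega> (unitary_group C \<rho>\<^sub>0) (unitary_topology C \<rho>\<^sub>0) (transition_cocycle C s)"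
      unfolding E_eq using delta_eq[OF e s] .
  next
    fix E F assume E: "E \<in> Obj (extension_category C \<Omega>)" and F: "F \<in> Obj (extension_category C \<Omega>)"
    obtain \<rho> e \<sigma> f where EF_eq: "E = (\<rho>, e)" "F = (\<sigma>, f)"
      by (cases E, cases F)
    note e = E[unfolded EF_eq] and f = F[unfolded EF_eq]
    show "unitarily_equivalent (extension_category C \<Omega>) E F \<longleftrightarrow>
        (\<exists>\<rho>\<^sub>0 \<in> Obj C.
           (trivializations C \<Omega> E \<rho>\<^sub>0 :: ('i, 'w, 'a) local_arrows set) \<noteq> {} \<and>
           (trivializations C \<Omega> F \<rho>\<^sub>0 :: ('i, 'w, 'a) local_arrows set) \<noteq> {} \<and>
           (delta C \<Omega> \<rho>\<^sub>0 E :: ('i, 'w, 'a) cocycle set) = delta C \<Omega> \<rho>\<^sub>0 F)"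
      unfolding EF_eq
    proof
      assume eq: "unitarily_equivalent (extension_category C \<Omega>) (\<rho>, e) (\<sigma>, f)"
      obtain \<rho>\<^sub>0 and t :: "('i, 'w, 'a) local_arrows"
        where "\<rho>\<^sub>0 \<in> Obj C" and t: "t \<in> trivializations C \<Omega> (\<rho>, e) \<rho>\<^sub>0"
        using triv_exists[OF e] by blast
      then show "\<exists>\<rho>\<^sub>0 \<in> Obj C.
           (trivializations C \<Omega> (\<rho>, e) \<rho>\<^sub>0 :: ('i, 'w, 'a) local_arrows set) \<noteq> {} \<and>
           (trivializations C \<Omega> (\<sigma>, f) \<rho>\<^sub>0 :: ('i, 'w, 'a) local_arrows set) \<noteq> {} \<and>
           (delta C \<Omega> \<rho>\<^sub>0 (\<rho>, e) :: ('i, 'w, 'a) cocycle set) = delta C \<Omega> \<rho>\<^sub>0 (\<sigma>, f)"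
        using delta_unitary_invariant[OF e f eq t] by blast
    next
      assume "\<exists>\<rho>\<^sub>0 \<in> Obj C.
           (trivializations C \<Omega> (\<rho>, e) \<rho>\<^sub>0 :: ('i, 'w, 'a) local_arrows set) \<noteq> {} \<and>
           (trivializations C \<Omega> (\<sigma>, f) \<rho>\<^sub>0 :: ('i, 'w, 'a) local_arrows set) \<noteq> {} \<and>
           (delta C \<Omega> \<rho>\<^sub>0 (\<rho>, e) :: ('i, 'w, 'a) cocycle set) = delta C \<Omega> \<rho>\<^sub>0 (\<sigma>, f)"
      then obtain \<rho>\<^sub>0 and t t' :: "('i, 'w, 'a) local_arrows"
        where \<rho>\<^sub>0: "\<rho>\<^sub>0 \<in> Obj C" and t: "t \<in> trivializations C \<Omega> (\<rho>, e) \<rho>\<^sub>0"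
          and t': "t' \<in> trivializations C \<Omega> (\<sigma>, f) \<rho>\<^sub>0"
          and eq: "(delta C \<Omega> \<rho>\<^sub>0 (\<rho>, e) :: ('i, 'w, 'a) cocycle set) = delta C \<Omega> \<rho>\<^sub>0 (\<sigma>, f)"
        by blast
      interpret G: topological_group "unitary_group C \<rho>\<^sub>0" "unitary_topology C \<rho>\<^sub>0"
        using \<rho>\<^sub>0 by (rule topological_group_unitary)
      have "(transition_cocycle C t, transition_cocycle C t')
          \<in> cocycle_rel \<Omega> (unitary_group C \<rho>\<^sub>0) (unitary_topology C \<rho>\<^sub>0)"
        using eq G.cocycle_class_eq_iff[OF transition_cocycle_mem[OF e t] transition_cocycle_mem[OF f t']]
        unfolding delta_eq[OF e t] delta_eq[OF f t'] by blast
      then show "unitarily_equivalent (extension_category C \<Omega>) (\<rho>, e) (\<sigma>, f)"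
        using unitarily_equivalent_if_cocycles_related[OF e f t t'] by blast
    qed
  qed
qed

end
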